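(* Suppose there exist universal constants $\lambda_c$ and $\lambda_s$ such that $\textsc{Gap-DetMax}[2^{\lambda_s n}, 2^{\lambda_c n}]$ is NP-hard. Then for every fixed number $p > \frac{1}{\lambda_c-\lambda_s}$, it is NP-hard to approximate $\mathcal{Z}^p(A)$ for a positive semi-definite matrix $A\in\mathbb{Q}^{n\times n}$ within a factor of $2^{((\lambda_c-\lambda_s)p-1)n}$. Moreover, unless $\mathsf{RP}=\mathsf{NP}$, no polynomial-time algorithm can draw a sample from a distribution whose total variation distance from the exponentiated DPP of exponent $p>\frac{1}{\lambda_c-\lambda_s}$ is at most $\frac13$.
   Context: For a PSD matrix $A\in\mathbb{Q}^{n\times n}$ and $p>0$, the exponentiated DPP (E-DPP) of exponent $p$ is the distribution on subsets $S\subseteq[n]$ with probability proportional to $\det(A_S)^p$ ($A_S$ the principal submatrix indexed by $S$, $\det(A_\emptyset)=1$), with normalizing constant $\mathcal{Z}^p(A)=\sum_{S\subseteq[n]}\det(A_S)^p$. An estimate $\widehat{\mathcal Z}$ is a $\rho$-approximation ($\rho\ge1$) if $\mathcal{Z}^p\le\widehat{\mathcal Z}\le\rho\,\mathcal{Z}^p$. Let $\mathrm{maxdet}(A)=\max_{S\subseteq[n]}\det(A_S)$; $\textsc{Gap-DetMax}[s(n),c(n)]$ is the promise problem of deciding, for a PSD input matrix of order $n$ promised to satisfy $\mathrm{maxdet}(A)\ge c(n)$ or $\mathrm{maxdet}(A)<s(n)$, which holds. The total variation distance between distributions $\mu,\eta$ on $\Omega$ is $\frac12\sum_{x\in\Omega}|\mu_x-\eta_x|$.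 $\mathsf{RP}$ is the class of decision problems with a probabilistic polynomial-time algorithm accepting yes instances with probability $\ge\frac12$ and always rejecting no instances. *)

theory Defs
  imports
    "HOL-Probability.Probability_Mass_Function"
    "HOL-Library.Log_Nat"
    "HOL-Computational_Algebra.Polynomial"
    "Jordan_Normal_Form.Determinant"
    "Jordan_Normal_Form.DL_Submatrix"
begin

section \<open>Random access machines with logarithmic cost\<close>

text \<open>
  The machine model is the random access machine of Aho, Hopcroft and Ullman (integer cells,
  indirect addressing, arithmetic including multiplication and division) under the logarithmic
  cost criterion, which is polynomially equivalent to the multitape Turing machine. Two
  presentational deviations: control flow is structured, and a program addresses finitely many
  unbounded arrays instead of a single one. As for the machine of Aho, Hopcroft and Ullman, inputs
  and outputs are finite sequences of integers, and their size is the total binary length.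
\<close>

type_synonym word = "int list"

definition isize :: "int \<Rightarrow> nat" where
  "isize i = nat (bitlen \<bar>i\<bar>) + 1"

definition wsize :: "word \<Rightarrow> nat" where
  "wsize w = sum_list (map isize w)"

type_synonym mem = "nat \<Rightarrow> int \<Rightarrow> int"

datatype exp =
    Const int
  | Cell nat exp
  | Add exp exp
  | Sub exp exp
  | Mul exp exp
  | Div exp exp

fun eval :: "exp \<Rightarrow> mem \<Rightarrow> int" where
  "eval (Const i) s = i"
| "eval (Cell a e) s = s a (eval e s)"
| "eval (Add e f) s = eval e s + eval f s"
| "eval (Sub e f) s = eval e s - eval f s"
| "eval (Mul e f) s = eval e s * eval f s"
| "eval (Div e f) s = eval e s div eval f s"

text \<open>
  Every intermediate value is charged its binary length; for a memory access both the
  address and the content are charged.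
\<close>

fun cost :: "exp \<Rightarrow> mem \<Rightarrow> nat" where
  "cost (Const i) s = isize i"
| "cost (Cell a e) s = cost e s + isize (eval (Cell a e) s)"
| "cost (Add e f) s = cost e s + cost f s + isize (eval (Add e f) s)"
| "cost (Sub e f) s = cost e s + cost f s + isize (eval (Sub e f) s)"
| "cost (Mul e f) s = cost e s + cost f s + isize (eval (Mul e f) s)"
| "cost (Div e f) s = cost e s + cost f s + isize (eval (Div e f) s)"

text \<open>
  A word is stored in an array with its length in cell 0 and its entries in the cells from 1 on.
\<close>

definition store_word :: "word \<Rightarrow> int \<Rightarrow> int" where
  "store_word w i =
     (if i = 0 then int (length w)
      else if 1 \<le> i \<and> i \<le> int (length w) then w ! nat (i - 1)
      else 0)"

definition read_word :: "(int \<Rightarrow> int) \<Rightarrow> word" where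
  "read_word m = map m [1..m 0]"

text \<open>
  Tests in \<open>If\<close> and \<open>While\<close> succeed when the value is positive. \<open>Ask a b\<close> submits the word in
  array \<open>a\<close> to the external function \<open>H\<close> (which turns the machine into a machine relative
  to \<open>H\<close>), replaces the content of array \<open>b\<close> by the answer, and is charged for the size of both.
  \<open>Clear a\<close> resets an array to zero at unit cost: the cells that it erases
  were all paid for when they were filled, so this does not change polynomial time.
\<close>

datatype com =
    Skip
  | Store nat exp exp
  | Clear nat
  | Ask nat nat
  | Seq com com
  | If exp com com
  | While exp com

inductive exec :: "(word \<Rightarrow> word) \<Rightarrow> com \<Rightarrow> mem \<Rightarrow> nat \<Rightarrow> mem \<Rightarrow> bool"
  for H :: "word \<Rightarrow> word" where
  Skip: "exec H Skip s 1 s"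
| Store: "exec H (Store a e f) s (1 + cost e s + cost f s)
            (s(a := (s a)(eval e s := eval f s)))"
| Clear: "exec H (Clear a) s 1 (s(a := (\<lambda>_. 0)))"
| Ask: "w = read_word (s a) \<Longrightarrow>
        exec H (Ask a b) s (1 + wsize w + wsize (H w)) (s(b := store_word (H w)))"
| Seq: "exec H c s t s' \<Longrightarrow> exec H d s' t' s'' \<Longrightarrow> exec H (Seq c d) s (1 + t + t') s''"
| IfTrue: "eval e s > 0 \<Longrightarrow> exec H c s t s' \<Longrightarrow> exec H (If e c d) s (1 + cost e s + t) s'"
| IfFalse: "\<not> eval e s > 0 \<Longrightarrow> exec H d s t s' \<Longrightarrow> exec H (If e c d) s (1 + cost e s + t) s'"
| WhileFalse: "\<not> eval e s > 0 \<Longrightarrow> exec H (While e c) s (1 + cost e s) s"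
| WhileTrue: "eval e s > 0 \<Longrightarrow> exec H c s t s' \<Longrightarrow> exec H (While e c) s' t' s'' \<Longrightarrow>
              exec H (While e c) s (1 + cost e s + t + t') s''"

text \<open>
  The \<open>k\<close>-th argument is initially stored in array \<open>k\<close>, and all other cells are zero. The output
  is the final word in array 0; writing it out is charged for, so that the
  output is never longer than the running time.
\<close>

definition init_mem :: "word list \<Rightarrow> mem" where
  "init_mem ws a = (if a < length ws then store_word (ws ! a) else (\<lambda>_. 0))"

definition runs :: "(word \<Rightarrow> word) \<Rightarrow> com \<Rightarrow> word list \<Rightarrow> word \<Rightarrow> nat \<Rightarrow> bool" where
  "runs H c ws out t \<longleftrightarrow>
     (\<exists>t' s. exec H c (init_mem ws) t' s \<and> out = read_word (s 0) \<and> t = t' + wsize out)"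

text \<open>A machine without an external function is one whose questions get the empty answer.\<close>

definition no_help :: "word \<Rightarrow> word" where
  "no_help w = []"

definition runs_within :: "(word \<Rightarrow> word) \<Rightarrow> com \<Rightarrow> word list \<Rightarrow> word \<Rightarrow> nat poly \<Rightarrow> bool" where
  "runs_within H c ws out P \<longleftrightarrow>
     (\<exists>t. runs H c ws out t \<and> t \<le> poly P (sum_list (map wsize ws)))"

definition polytime1 :: "(word \<Rightarrow> word) \<Rightarrow> bool" where
  "polytime1 f \<longleftrightarrow> (\<exists>c P. \<forall>x. runs_within no_help c [x] (f x) P)"

definition polytime2 :: "(word \<Rightarrow> word \<Rightarrow> word) \<Rightarrow> bool" where
  "polytime2 f \<longleftrightarrow> (\<exists>c P. \<forall>x y. runs_within no_help c [x, y] (f x y) P)"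

section \<open>Complexity classes and hardness\<close>

definition bit_words :: "nat \<Rightarrow> word set" where
  "bit_words m = {r. set r \<subseteq> {0, 1} \<and> length r = m}"

text \<open>The output \<open>[1]\<close> means acceptance, every other output rejection.\<close>

definition NP_class :: "word set set" where
  "NP_class = {L. \<exists>V (q :: nat poly). polytime2 V \<and>
     (\<forall>x. x \<in> L \<longleftrightarrow> (\<exists>w \<in> bit_words (poly q (wsize x)). V x w = [1]))}"

text \<open>
  A probabilistic polynomial-time algorithm is a deterministic one with an additional
  argument, a string of polynomially many uniform random bits.
\<close>

definition RP_class :: "word set set" where
  "RP_class = {L. \<exists>V (q :: nat poly). polytime2 V \<and>
     (\<forall>x. (x \<in> L \<longrightarrow>
             measure_pmf.prob (pmf_of_set (bit_words (poly q (wsize x)))) {r. V x r = [1]} \<ge> 1 / 2) \<and>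
          (x \<notin> L \<longrightarrow> (\<forall>r \<in> bit_words (poly q (wsize x)). V x r \<noteq> [1])))}"

text \<open>
  A promise problem is the pair of its yes instances and its no instances; hardness is with
  respect to polynomial-time many-one reductions.
\<close>

definition NP_hard_promise :: "word set \<times> word set \<Rightarrow> bool" where
  "NP_hard_promise Q \<longleftrightarrow> (\<forall>L \<in> NP_class. \<exists>f. polytime1 f \<and>
     (\<forall>x. (x \<in> L \<longrightarrow> f x \<in> fst Q) \<and> (x \<notin> L \<longrightarrow> f x \<in> snd Q)))"

section \<open>Rational matrices as inputs\<close>

definition enc_rat :: "rat \<Rightarrow> word" where
  "enc_rat q = [fst (quotient_of q), snd (quotient_of q)]"

definition enc_mat :: "rat mat \<Rightarrow> word" where
  "enc_mat A = int (dim_row A) #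
     concat (map (\<lambda>i. concat (map (\<lambda>j. enc_rat (A $$ (i, j))) [0..<dim_col A])) [0..<dim_row A])"

definition psd :: "nat \<Rightarrow> rat mat \<Rightarrow> bool" where
  "psd n A \<longleftrightarrow> A \<in> carrier_mat n n \<and> A\<^sup>T = A \<and>
     (\<forall>v \<in> carrier_vec n. 0 \<le> scalar_prod v (map_mat real_of_rat A *\<^sub>v v))"

section \<open>Determinant maximization and exponentiated DPPs\<close>

text \<open>Index sets are subsets of \<open>{..<n}\<close>, since matrices are indexed from 0.\<close>

definition minor :: "rat mat \<Rightarrow> nat set \<Rightarrow> real" where
  "minor A S = real_of_rat (det (submatrix A S S))"

definition maxdet :: "rat mat \<Rightarrow> real" where
  "maxdet A = Max (minor A ` Pow {..<dim_row A})"

definition gap_detmax :: "(nat \<Rightarrow> real) \<Rightarrow> (nat \<Rightarrow> real) \<Rightarrow> word set \<times> word set" where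
  "gap_detmax s c =
     ({enc_mat A | A n. psd n A \<and> maxdet A \<ge> c n}, {enc_mat A | A n. psd n A \<and> maxdet A < s n})"

definition Zp :: "real \<Rightarrow> rat mat \<Rightarrow> real" where
  "Zp p A = (\<Sum>S \<in> Pow {..<dim_row A}. minor A S powr p)"

definition edpp :: "real \<Rightarrow> rat mat \<Rightarrow> nat set \<Rightarrow> real" where
  "edpp p A S = minor A S powr p / Zp p A"

definition rho_approx :: "real \<Rightarrow> real \<Rightarrow> real \<Rightarrow> bool" where
  "rho_approx \<rho> Z est \<longleftrightarrow> Z \<le> est \<and> est \<le> \<rho> * Z"

text \<open>
  \<open>H\<close> answers the encoding of every positive semi-definite matrix \<open>A\<close> of order \<open>n\<close> by a rational
  \<open>\<rho> n\<close>-approximation of \<open>g A\<close> of polynomially bounded size. Nothing is assumed on other words.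
\<close>

definition approximator :: "(rat mat \<Rightarrow> real) \<Rightarrow> (nat \<Rightarrow> real) \<Rightarrow> (word \<Rightarrow> word) \<Rightarrow> bool" where
  "approximator g \<rho> H \<longleftrightarrow>
     (\<forall>n A. psd n A \<longrightarrow> (\<exists>z. H (enc_mat A) = enc_rat z \<and> rho_approx (\<rho> n) (g A) (real_of_rat z))) \<and>
     (\<exists>B :: nat poly. \<forall>n A. psd n A \<longrightarrow> wsize (H (enc_mat A)) \<le> poly B (wsize (enc_mat A)))"

text \<open>
  Approximation is a problem of computing a value, so its NP-hardness is hardness under
  polynomial-time Turing reductions: every language in NP is decided in polynomial time by one
  machine that may consult an arbitrary approximator. The machine does not depend on the
  approximator; its time bound may, through the size of the answers.
\<close>

definition NP_hard_to_approximate :: "(rat mat \<Rightarrow> real) \<Rightarrow> (nat \<Rightarrow> real) \<Rightarrow> bool" where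
  "NP_hard_to_approximate g \<rho> \<longleftrightarrow> (\<forall>L \<in> NP_class. \<exists>c. \<forall>H. approximator g \<rho> H \<longrightarrow>
     (\<exists>P. \<forall>x. \<exists>out. runs_within H c [x] out P \<and> (out = [1] \<longleftrightarrow> x \<in> L)))"

definition tv_dist :: "'a set \<Rightarrow> ('a \<Rightarrow> real) \<Rightarrow> ('a \<Rightarrow> real) \<Rightarrow> real" where
  "tv_dist \<Omega> \<mu> \<eta> = 1 / 2 * (\<Sum>x \<in> \<Omega>. \<bar>\<mu> x - \<eta> x\<bar>)"

definition word_subset :: "word \<Rightarrow> nat set" where
  "word_subset w = {i. int i \<in> set w}"

text \<open>
  \<open>g A r\<close> is the output on the matrix \<open>A\<close> and the random bits \<open>r\<close>, a list of the elements of the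
  sampled set. The sampler is only required to work on positive semi-definite matrices.
\<close>

definition polytime_sampler :: "(rat mat \<Rightarrow> nat set \<Rightarrow> real) \<Rightarrow> real \<Rightarrow> bool" where
  "polytime_sampler \<mu> \<epsilon> \<longleftrightarrow> (\<exists>c P (q :: nat poly) g. \<forall>n A. psd n A \<longrightarrow>
     (let R = bit_words (poly q (wsize (enc_mat A)));
          D = map_pmf (\<lambda>r. word_subset (g A r)) (pmf_of_set R)
      in (\<forall>r \<in> R. runs_within no_help c [enc_mat A, r] (g A r) P) \<and>
         set_pmf D \<subseteq> Pow {..<n} \<and>
         tv_dist (Pow {..<n}) (pmf D) (\<mu> A) \<le> \<epsilon>))"

end

(* Hardness of approximation. The numbers lam_c, lam_s and p may be uncomputable, so the estimate of
   an oracle cannot be compared with the threshold 2^(lam_c p n). Instead the witness of an NP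
   language is searched bit by bit: both continuations are reduced to matrices, of orders n and n',
   and the one whose estimate has the larger n-th root is taken. If one of them is a yes instance,
   then so is the chosen one, and the verifier has the last word at the end of the search.

   Hardness of sampling. Let b be rational with 2^lam_s < b < 2^(lam_c - 1/p). On a yes instance of
   order n the E-DPP gives the sets S with det A_S < b^n mass at most (2 b^p / 2^(lam_c p))^n, which is
   small for large n, while a no instance has no set with det A_S >= b^n at all. So a sample of the
   sampler, checked by computing one determinant, decides the gap problem in RP. The determinant is
   computed by fraction-free elimination in the sense of Bareiss; no pivoting is needed, because in a
   positive semi-definite matrix a vanishing principal minor on the columns T makes these columns
   linearly dependent. *)

theory Submission
  imports Defs
begin


section \<open>Sizes and costs\<close>

text \<open>The search has to ask about partly known witnesses, so the reduction is applied to a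
  second NP language, whose instances carry a witness with open positions. Comparing roots works
  because the estimates for yes and no instances of order n are separated by t^n, with the same t =
  2^(lam_c p) for all n; cross powers make it a comparison of integers. Both results need programs
  for a concrete machine. They are built from closure properties of \<open>poly_comp\<close>. It
  carries a domain, because the number claiming to be the order is polynomially bounded only on
  genuine encodings, and a set of external functions, because one program must serve all
  approximators. The obstacle is size: iterating a polynomial-time map may double the data in each
  round, so every loop comes with a bound on all its intermediate values. For the determinant this
  bound holds because all entries stay minors of one integer matrix. The sampler errs by 1/3 and the
  E-DPP itself by at most 1/6, which leaves the 1/2 of RP. For the finitely many orders where 1/6 is
  not reached, a fixed list of candidate sets is tested too.\<close>

lemma isize_le_iff: "isize i \<le> Suc k \<longleftrightarrow> \<bar>i\<bar> < 2 ^ k"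
proof -
  have "isize i \<le> Suc k \<longleftrightarrow> bitlen \<bar>i\<bar> \<le> int k"
    using bitlen_nonneg[of "\<bar>i\<bar>"] by (auto simp: isize_def)
  then show ?thesis
    using bitlen_le_iff_power[of "\<bar>i\<bar>" "int k"] by simp
qed

lemma isize_pos: "1 \<le> isize i"
  by (simp add: isize_def)

lemma isize_0 [simp]: "isize 0 = 1"
  by (simp add: isize_def)

lemma isize_mono: "\<bar>i\<bar> \<le> \<bar>j\<bar> \<Longrightarrow> isize i \<le> isize j"
proof -
  assume le: "\<bar>i\<bar> \<le> \<bar>j\<bar>"
  obtain k where k: "isize j = Suc k" using isize_pos[of j] by (cases "isize j") auto
  then have "\<bar>j\<bar> < 2 ^ k" using isize_le_iff[of j k] by simp
  then show ?thesis using le k isize_le_iff[of i k] by simp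
qed

text \<open>Division rounds down, so a negative dividend needs its own argument: for j > 0 the
  quotient then lies between \<open>i\<close> and -1. Division by 0 yields 0, and a negative divisor
  is made positive by negating both numbers.\<close>

lemma abs_div_le: "\<bar>i div j\<bar> \<le> \<bar>i :: int\<bar>"
proof -
  have pos: "\<bar>i div j\<bar> \<le> \<bar>i\<bar>" if "j > 0" for i j :: int
  proof (cases "i \<ge> 0")
    case True
    then have "0 \<le> i div j" using that by (simp add: pos_imp_zdiv_nonneg_iff)
    moreover have "i div j \<le> i div 1" using True that by (intro zdiv_mono2) auto
    ultimately show ?thesis by simp
  next
    case False
    have "i * j \<le> i * 1" using False that by (intro mult_left_mono_neg) auto
    then have "i * j div j \<le> i div j" using that by (intro zdiv_mono1) auto
    then have "i \<le> i div j" using that by simp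
    moreover have "i div j < 0" using False that by (simp add: pos_imp_zdiv_neg_iff)
    ultimately show ?thesis by simp
  qed
  consider "j = 0" | "j > 0" | "- j > 0" by linarith
  then show ?thesis using pos[of j i] pos[of "- j" "- i"] by cases auto
qed

text \<open>Sums and products obey the same additive bound; this uniformity is what
  \<open>poly_comp_fold\<close> assumes of its operator.\<close>

lemma isize_arith:
  shows isize_add: "isize (i + j) \<le> isize i + isize j"
    and isize_diff: "isize (i - j) \<le> isize i + isize j"
    and isize_mult: "isize (i * j) \<le> isize i + isize j"
    and isize_div: "isize (i div j) \<le> isize i"
proof -
  obtain k where k: "isize i = Suc k" using isize_pos[of i] by (cases "isize i") auto
  obtain l where l: "isize j = Suc l" using isize_pos[of j] by (cases "isize j") auto
  have ik: "\<bar>i\<bar> < 2 ^ k" using isize_le_iff[of i k] k by simp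
  have jl: "\<bar>j\<bar> < 2 ^ l" using isize_le_iff[of j l] l by simp
  have "(2::int) ^ k \<ge> 1" "(2::int) ^ l \<ge> 1" by simp_all
  \<comment> \<open>Expanded, the first inequality reads 2^k + 2^l \<le> 2^(k+l) + 1, and the extra
    1 is absorbed by doubling the power.\<close>
  then have "((2::int) ^ k - 1) * (2 ^ l - 1) \<ge> 0" and "(2::int) ^ k * 2 ^ l \<ge> 1"
    by (simp_all add: one_le_power flip: power_add)
  then have "(2::int) ^ k + 2 ^ l \<le> 2 ^ (Suc (k + l))"
    by (simp add: power_add algebra_simps)
  with ik jl have sum: "\<bar>i\<bar> + \<bar>j\<bar> < 2 ^ (Suc (k + l))" by linarith
  have SS: "isize i + isize j = Suc (Suc (k + l))" using k l by simp
  show "isize (i + j) \<le> isize i + isize j"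
    unfolding SS isize_le_iff using sum abs_triangle_ineq[of i j] by linarith
  show "isize (i - j) \<le> isize i + isize j"
    unfolding SS isize_le_iff using sum abs_triangle_ineq4[of i j] by linarith
  have "\<bar>i * j\<bar> < 2 ^ k * 2 ^ l"
    unfolding abs_mult using ik jl by (intro mult_strict_mono) auto
  also have "\<dots> \<le> 2 ^ Suc (k + l)" by (simp add: power_add)
  finally show "isize (i * j) \<le> isize i + isize j"
    unfolding SS isize_le_iff .
  have "\<bar>i div j\<bar> \<le> \<bar>i\<bar>" by (rule abs_div_le)
  then show "isize (i div j) \<le> isize i" by (rule isize_mono)
qed

lemma isize_int_le: "isize (int n) \<le> Suc n"
  unfolding isize_le_iff by (simp add: of_nat_less_iff flip: of_nat_power)

abbreviation isz :: "word list \<Rightarrow> nat" where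
  "isz ws \<equiv> sum_list (map wsize ws)"

lemma wsize_simps [simp]:
  "wsize [] = 0" "wsize (x # w) = isize x + wsize w" "wsize (u @ v) = wsize u + wsize v"
  by (simp_all add: wsize_def)

lemma length_le_wsize: "length w \<le> wsize w"
proof (induction w)
  case (Cons x w)
  then show ?case using isize_pos[of x] by simp
qed simp

lemma isize_le_wsize: "x \<in> set w \<Longrightarrow> isize x \<le> wsize w"
  by (induction w) auto

lemma wsize_le_isz: "w \<in> set ws \<Longrightarrow> wsize w \<le> isz ws"
  by (induction ws) auto

lemma wsize_nth_le_isz: "i < length ws \<Longrightarrow> wsize (ws ! i) \<le> isz ws"
  by (simp add: wsize_le_isz)

lemma wsize_bound:
  assumes "\<And>x. x \<in> set w \<Longrightarrow> isize x \<le> B"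
  shows "wsize w \<le> length w * B"
  using assms by (induction w) (auto simp: add_mono)

section \<open>Bounds on memory contents and on the cost of expressions\<close>

definition cells_bounded :: "mem \<Rightarrow> nat \<Rightarrow> bool" where
  "cells_bounded s N \<longleftrightarrow> (\<forall>a i. isize (s a i) \<le> N)"

lemma cells_boundedD: "cells_bounded s N \<Longrightarrow> isize (s a i) \<le> N"
  by (simp add: cells_bounded_def)

lemma cells_bounded_mono: "cells_bounded s N \<Longrightarrow> N \<le> M \<Longrightarrow> cells_bounded s M"
  unfolding cells_bounded_def using le_trans by blast

lemma cells_bounded_pos: "cells_bounded s N \<Longrightarrow> 1 \<le> N"
  using isize_pos le_trans unfolding cells_bounded_def by blast

text \<open>Each operator at most adds the sizes of its operands, and a memory access yields at most
  \<open>N\<close> whatever the address. The expression is fixed, so sizes grow by a constant factor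
  only.\<close>

lemma cost_linear:
  "\<exists>C. \<forall>s N. cells_bounded s N \<longrightarrow> cost e s \<le> C * N \<and> isize (eval e s) \<le> C * N"
proof (induction e)
  case (Const i)
  have "isize i \<le> isize i * N" if "cells_bounded s N" for s N
    using cells_bounded_pos[OF that] by simp
  then show ?case by (intro exI[of _ "isize i"]) auto
next
  case (Cell a e)
  then obtain C where C: "\<And>s N. cells_bounded s N \<Longrightarrow> cost e s \<le> C * N" by blast
  have "cost (Cell a e) s \<le> (C + 1) * N \<and> isize (eval (Cell a e) s) \<le> (C + 1) * N"
    if "cells_bounded s N" for s N
    using C[OF that] cells_boundedD[OF that, of a "eval e s"] by simp
  then show ?case by blast
next
  case (Add e f)
  then obtain C D where C: "\<And>s N. cells_bounded s N \<Longrightarrow> cost e s \<le> C * N \<and> isize (eval e s) \<le> C * N"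
    and D: "\<And>s N. cells_bounded s N \<Longrightarrow> cost f s \<le> D * N \<and> isize (eval f s) \<le> D * N" by blast
  have "cost (Add e f) s \<le> (2 * C + 2 * D) * N \<and> isize (eval (Add e f) s) \<le> (2 * C + 2 * D) * N"
    if "cells_bounded s N" for s N
    using C[OF that] D[OF that] isize_add[of "eval e s" "eval f s"] by (auto simp: algebra_simps)
  then show ?case by blast
next
  case (Sub e f)
  then obtain C D where C: "\<And>s N. cells_bounded s N \<Longrightarrow> cost e s \<le> C * N \<and> isize (eval e s) \<le> C * N"
    and D: "\<And>s N. cells_bounded s N \<Longrightarrow> cost f s \<le> D * N \<and> isize (eval f s) \<le> D * N" by blast
  have "cost (Sub e f) s \<le> (2 * C + 2 * D) * N \<and> isize (eval (Sub e f) s) \<le> (2 * C + 2 * D) * N"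
    if "cells_bounded s N" for s N
    using C[OF that] D[OF that] isize_diff[of "eval e s" "eval f s"] by (auto simp: algebra_simps)
  then show ?case by blast
next
  case (Mul e f)
  then obtain C D where C: "\<And>s N. cells_bounded s N \<Longrightarrow> cost e s \<le> C * N \<and> isize (eval e s) \<le> C * N"
    and D: "\<And>s N. cells_bounded s N \<Longrightarrow> cost f s \<le> D * N \<and> isize (eval f s) \<le> D * N" by blast
  have "cost (Mul e f) s \<le> (2 * C + 2 * D) * N \<and> isize (eval (Mul e f) s) \<le> (2 * C + 2 * D) * N"
    if "cells_bounded s N" for s N
    using C[OF that] D[OF that] isize_mult[of "eval e s" "eval f s"] by (auto simp: algebra_simps)
  then show ?case by blast
next
  case (Div e f)
  then obtain C D where C: "\<And>s N. cells_bounded s N \<Longrightarrow> cost e s \<le> C * N \<and> isize (eval e s) \<le> C * N"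
    and D: "\<And>s N. cells_bounded s N \<Longrightarrow> cost f s \<le> D * N \<and> isize (eval f s) \<le> D * N" by blast
  have "cost (Div e f) s \<le> (2 * C + 2 * D) * N \<and> isize (eval (Div e f) s) \<le> (2 * C + 2 * D) * N"
    if "cells_bounded s N" for s N
    using C[OF that] D[OF that] isize_div[of "eval e s" "eval f s"] by (auto simp: algebra_simps)
  then show ?case by blast
qed

lemma costs_linear:
  "\<exists>C. \<forall>e \<in> set es. \<forall>s N. cells_bounded s N \<longrightarrow> cost e s \<le> C * N \<and> isize (eval e s) \<le> C * N"
proof (induction es)
  case (Cons e es)
  obtain C where C: "\<forall>e \<in> set es. \<forall>s N. cells_bounded s N \<longrightarrow> cost e s \<le> C * N \<and> isize (eval e s) \<le> C * N"
    using Cons by blast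
  obtain D where D: "\<forall>s N. cells_bounded s N \<longrightarrow> cost e s \<le> D * N \<and> isize (eval e s) \<le> D * N"
    using cost_linear by blast
  have "C * N \<le> (C + D) * N" "D * N \<le> (C + D) * N" for N :: nat by (simp_all add: algebra_simps)
  then have "\<forall>e \<in> set (e # es). \<forall>s N. cells_bounded s N \<longrightarrow>
      cost e s \<le> (C + D) * N \<and> isize (eval e s) \<le> (C + D) * N"
    using C D by (metis le_trans set_ConsD)
  then show ?case by blast
qed simp

lemma isize_eval_le_cost: "isize (eval e s) \<le> cost e s"
  by (cases e) auto

lemma store_word_Nil [simp]: "store_word [] = (\<lambda>_. 0)"
  by (auto simp: store_word_def)

lemma store_word_simps [simp]:
  "store_word w 0 = int (length w)"
  "store_word (x # w) 1 = x"
  by (auto simp: store_word_def)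

lemma store_word_nth [simp]: "i < length w \<Longrightarrow> store_word w (int i + 1) = w ! i"
  by (auto simp: store_word_def)

lemma store_word_nth' [simp]: "i < length w \<Longrightarrow> store_word w (1 + int i) = w ! i"
  by (auto simp: store_word_def)

lemma read_store_word [simp]: "read_word (store_word w) = w"
proof (rule nth_equalityI)
  fix i assume "i < length (read_word (store_word w))"
  then show "read_word (store_word w) ! i = w ! i"
    by (simp add: read_word_def store_word_def)
qed (simp add: read_word_def)

lemma isize_store_word: "isize (store_word w i) \<le> wsize w + 1"
proof -
  consider "i = 0" | "1 \<le> i" "i \<le> int (length w)" | "store_word w i = 0"
    unfolding store_word_def by presburger
  then show ?thesis
  proof cases
    case 1
    then show ?thesis using isize_int_le[of "length w"] length_le_wsize[of w] by simp
  next
    case 2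
    then have "store_word w i \<in> set w" by (auto simp: store_word_def)
    then show ?thesis using isize_le_wsize by fastforce
  qed simp
qed

text \<open>Reading an array as a word and storing it again keeps the entries of the word, clears
  the cells outside it, and replaces the length cell by \<open>nat (m 0)\<close>; no content
  grows.\<close>

lemma isize_store_read_word:
  assumes "\<And>i. isize (m i) \<le> N"
  shows "isize (store_word (read_word m) i) \<le> N"
proof -
  have "1 \<le> N" using assms isize_pos le_trans by blast
  consider "i = 0" | "1 \<le> i" "i \<le> m 0" "i \<noteq> 0" | "store_word (read_word m) i = 0"
  proof (cases "i = 0 \<or> 1 \<le> i \<and> i \<le> m 0")
    case False
    then have "store_word (read_word m) i = 0" by (auto simp: store_word_def read_word_def)
    then show thesis using that(3) by blast
  qed (use that in auto)
  then show ?thesis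
  proof cases
    case 1
    then have "isize (store_word (read_word m) i) \<le> isize (m 0)"
      by (intro isize_mono) (simp add: read_word_def)
    then show ?thesis using assms le_trans by blast
  next
    case 2
    then have "store_word (read_word m) i = m i"
      by (simp add: store_word_def read_word_def)
    then show ?thesis using assms by simp
  qed (use \<open>1 \<le> N\<close> in simp)
qed

lemma cells_bounded_init: "cells_bounded (init_mem ws) (isz ws + 1)"
  unfolding cells_bounded_def
proof (intro allI)
  fix a i
  show "isize (init_mem ws a i) \<le> isz ws + 1"
  proof (cases "a < length ws")
    case True
    have "isize (store_word (ws ! a) i) \<le> wsize (ws ! a) + 1" by (rule isize_store_word)
    also have "\<dots> \<le> isz ws + 1" using wsize_nth_le_isz[OF True] by simp
    finally show ?thesis using True by (simp add: init_mem_def)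
  qed (simp add: init_mem_def)
qed

text \<open>Every value written into a cell was charged by its size when it was computed or
  answered, so contents grow by at most the elapsed time.\<close>

lemma exec_cells_bounded:
  "exec H c s t s' \<Longrightarrow> cells_bounded s N \<Longrightarrow> cells_bounded s' (N + t)"
proof (induction arbitrary: N rule: exec.induct)
  case (Store a e f s)
  have "isize ((s(a := (s a)(eval e s := eval f s))) aa i) \<le> N + (1 + cost e s + cost f s)" for aa i
    using isize_eval_le_cost[of f s] cells_boundedD[OF Store, of aa i]
    by (cases "aa = a \<and> i = eval e s") auto
  then show ?case unfolding cells_bounded_def by blast
next
  case (Clear a s)
  then show ?case using cells_bounded_pos[OF Clear] by (auto simp: cells_bounded_def intro: le_SucI)
next
  case (Ask w s a b)
  have "isize ((s(b := store_word (H w))) aa i) \<le> N + (1 + wsize w + wsize (H w))" for aa i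
    using isize_store_word[of "H w" i] cells_boundedD[OF Ask.prems, of aa i] by (cases "aa = b") auto
  then show ?case unfolding cells_bounded_def by blast
next
  case (Seq c s t s' d t' s'')
  have "cells_bounded s'' (N + t + t')" using Seq by blast
  then show ?case by (rule cells_bounded_mono) simp
next
  case (IfTrue e s c t s' d)
  have "cells_bounded s' (N + t)" using IfTrue by blast
  then show ?case by (rule cells_bounded_mono) simp
next
  case (IfFalse e s d t s' c)
  have "cells_bounded s' (N + t)" using IfFalse by blast
  then show ?case by (rule cells_bounded_mono) simp
next
  case (WhileTrue e s c t s' t' s'')
  have "cells_bounded s'' (N + t + t')" using WhileTrue by blast
  then show ?case by (rule cells_bounded_mono) simp
qed (auto elim: cells_bounded_mono)

section \<open>Subroutines\<close>

fun rename_exp :: "(nat \<Rightarrow> nat) \<Rightarrow> exp \<Rightarrow> exp" where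
  "rename_exp r (Const i) = Const i"
| "rename_exp r (Cell a e) = Cell (r a) (rename_exp r e)"
| "rename_exp r (Add e f) = Add (rename_exp r e) (rename_exp r f)"
| "rename_exp r (Sub e f) = Sub (rename_exp r e) (rename_exp r f)"
| "rename_exp r (Mul e f) = Mul (rename_exp r e) (rename_exp r f)"
| "rename_exp r (Div e f) = Div (rename_exp r e) (rename_exp r f)"

fun rename :: "(nat \<Rightarrow> nat) \<Rightarrow> com \<Rightarrow> com" where
  "rename r Skip = Skip"
| "rename r (Store a e f) = Store (r a) (rename_exp r e) (rename_exp r f)"
| "rename r (Clear a) = Clear (r a)"
| "rename r (Ask a b) = Ask (r a) (r b)"
| "rename r (Seq c d) = Seq (rename r c) (rename r d)"
| "rename r (If e c d) = If (rename_exp r e) (rename r c) (rename r d)"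
| "rename r (While e c) = While (rename_exp r e) (rename r c)"

lemma rename_exp_sem:
  assumes "S \<circ> r = s"
  shows "eval (rename_exp r e) S = eval e s \<and> cost (rename_exp r e) S = cost e s"
  using assms by (induction e) auto

text \<open>The original run is seen through \<open>r\<close> inside a larger memory
  \<open>S\<close>. Injectivity prevents two arrays from being merged, the time is unchanged, and
  the last conjunct is the frame property on which subroutine calls rest.\<close>

lemma exec_rename:
  assumes "inj r"
  shows "exec H c s t s' \<Longrightarrow> S \<circ> r = s \<Longrightarrow>
    \<exists>S'. exec H (rename r c) S t S' \<and> S' \<circ> r = s' \<and> (\<forall>b. b \<notin> range r \<longrightarrow> S' b = S b)"
proof (induction arbitrary: S rule: exec.induct)
  case (Skip s)
  then show ?case using exec.Skip[of H S] by auto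
next
  case (Store a e f s)
  have "exec H (rename r (Store a e f)) S (1 + cost e s + cost f s)
      (S(r a := (S (r a))(eval e s := eval f s)))"
    using exec.Store[of H "r a" "rename_exp r e" "rename_exp r f" S] rename_exp_sem[OF Store] by simp
  moreover have "(S(r a := (S (r a))(eval e s := eval f s))) \<circ> r = s(a := (s a)(eval e s := eval f s))"
    using Store assms by (auto simp: fun_eq_iff inj_def)
  moreover have "\<forall>b. b \<notin> range r \<longrightarrow> (S(r a := (S (r a))(eval e s := eval f s))) b = S b" by auto
  ultimately show ?case by blast
next
  case (Clear a s)
  have "(S(r a := (\<lambda>_. 0))) \<circ> r = s(a := (\<lambda>_. 0))"
    using Clear assms by (auto simp: fun_eq_iff inj_def)
  moreover have "exec H (rename r (Clear a)) S 1 (S(r a := (\<lambda>_. 0)))"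
    using exec.Clear[of H "r a" S] by simp
  moreover have "\<forall>b. b \<notin> range r \<longrightarrow> (S(r a := (\<lambda>_. 0))) b = S b" by auto
  ultimately show ?case by blast
next
  case (Ask w s a b)
  have "w = read_word (S (r a))" using Ask by auto
  from exec.Ask[of w S "r a" H "r b"] this
  have "exec H (rename r (Ask a b)) S (1 + wsize w + wsize (H w)) (S(r b := store_word (H w)))" by simp
  moreover have "(S(r b := store_word (H w))) \<circ> r = s(b := store_word (H w))"
    using Ask assms by (auto simp: fun_eq_iff inj_def)
  moreover have "\<forall>ba. ba \<notin> range r \<longrightarrow> (S(r b := store_word (H w))) ba = S ba" by auto
  ultimately show ?case by blast
next
  case (Seq c s t s' d t' s'')
  then obtain S' where S': "exec H (rename r c) S t S'" "S' \<circ> r = s'" "\<forall>b. b \<notin> range r \<longrightarrow> S' b = S b"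
    by blast
  with Seq.IH(2) obtain S'' where "exec H (rename r d) S' t' S''" "S'' \<circ> r = s''"
    "\<forall>b. b \<notin> range r \<longrightarrow> S'' b = S' b" by blast
  moreover have "exec H (rename r (Seq c d)) S (1 + t + t') S''"
    using exec.Seq[OF S'(1) calculation(1)] by simp
  ultimately show ?case using S' by (intro exI[of _ S'']) auto
next
  case (IfTrue e s c t s' d)
  then obtain S' where S': "exec H (rename r c) S t S'" "S' \<circ> r = s'" "\<forall>b. b \<notin> range r \<longrightarrow> S' b = S b"
    by blast
  then show ?case using exec.IfTrue[of "rename_exp r e" S H "rename r c" t S' "rename r d"] IfTrue.hyps(1)
      rename_exp_sem[OF IfTrue.prems, of e] by auto
next
  case (IfFalse e s d t s' c)
  then obtain S' where S': "exec H (rename r d) S t S'" "S' \<circ> r = s'" "\<forall>b. b \<notin> range r \<longrightarrow> S' b = S b"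
    by blast
  then show ?case using exec.IfFalse[of "rename_exp r e" S H "rename r d" t S' "rename r c"] IfFalse.hyps(1)
      rename_exp_sem[OF IfFalse.prems, of e] by auto
next
  case (WhileFalse e s c)
  then show ?case using exec.WhileFalse[of "rename_exp r e" S H "rename r c"]
      rename_exp_sem[OF WhileFalse.prems, of e] by auto
next
  case (WhileTrue e s c t s' t' s'')
  then obtain S' where S': "exec H (rename r c) S t S'" "S' \<circ> r = s'" "\<forall>b. b \<notin> range r \<longrightarrow> S' b = S b"
    by blast
  with WhileTrue.IH(2) obtain S'' where S'': "exec H (rename r (While e c)) S' t' S''" "S'' \<circ> r = s''"
    "\<forall>b. b \<notin> range r \<longrightarrow> S'' b = S' b" by blast
  have "exec H (rename r (While e c)) S (1 + cost e s + t + t') S''"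
    using exec.WhileTrue[of "rename_exp r e" S H "rename r c" t S' t' S''] WhileTrue.hyps(1)
      rename_exp_sem[OF WhileTrue.prems, of e] S' S'' by auto
  then show ?case using S' S'' by auto
qed

text \<open>A program mentions finitely many arrays; this bound tells a caller which ones have to be
  cleared after a subroutine has run.\<close>

fun write_bound :: "com \<Rightarrow> nat" where
  "write_bound Skip = 0"
| "write_bound (Store a e f) = Suc a"
| "write_bound (Clear a) = Suc a"
| "write_bound (Ask a b) = Suc b"
| "write_bound (Seq c d) = max (write_bound c) (write_bound d)"
| "write_bound (If e c d) = max (write_bound c) (write_bound d)"
| "write_bound (While e c) = write_bound c"

lemma exec_write_bound: "exec H c s t s' \<Longrightarrow> write_bound c \<le> a \<Longrightarrow> s' a = s a"
  by (induction rule: exec.induct) auto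

text \<open>The empty answers of \<open>no_help\<close> are simulated by clearing, so that a program without external
  function can be used as a subroutine of an oracle machine.\<close>

fun silence :: "com \<Rightarrow> com" where
  "silence (Ask a b) = Clear b"
| "silence (Seq c d) = Seq (silence c) (silence d)"
| "silence (If e c d) = If e (silence c) (silence d)"
| "silence (While e c) = While e (silence c)"
| "silence c = c"

text \<open>The time can only drop: clearing costs 1, whereas a question is also charged for its
  text.\<close>

lemma exec_silence: "exec no_help c s t s' \<Longrightarrow> \<exists>t' \<le> t. exec H (silence c) s t' s'"
proof (induction rule: exec.induct)
  case (Ask w s a b)
  have "store_word (no_help w) = (\<lambda>_. 0)" by (simp add: no_help_def)
  then have "exec H (silence (Ask a b)) s 1 (s(b := store_word (no_help w)))"
    using exec.Clear[of H b s] by simp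
  then show ?case by (metis le_add1 add.assoc)
next
  case (Seq c s t s' d t' s'')
  then obtain u u' where "u \<le> t" "u' \<le> t'" "exec H (silence c) s u s'" "exec H (silence d) s' u' s''" by blast
  then show ?case using exec.Seq[of H "silence c" s u s' "silence d" u' s''] by (intro exI[of _ "1 + u + u'"]) auto
next
  case (IfTrue e s c t s' d)
  then obtain u where "u \<le> t" "exec H (silence c) s u s'" by blast
  then show ?case using exec.IfTrue[of e s H "silence c" u s' "silence d"] IfTrue.hyps(1) by (intro exI[of _ "1 + cost e s + u"]) auto
next
  case (IfFalse e s d t s' c)
  then obtain u where "u \<le> t" "exec H (silence d) s u s'" by blast
  then show ?case using exec.IfFalse[of e s H "silence d" u s' "silence c"] IfFalse.hyps(1) by (intro exI[of _ "1 + cost e s + u"]) auto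
next
  case (WhileTrue e s c t s' t' s'')
  then obtain u u' where "u \<le> t" "u' \<le> t'" "exec H (silence c) s u s'" "exec H (silence (While e c)) s' u' s''" by blast
  then show ?case using exec.WhileTrue[of e s H "silence c" u s' u' s''] WhileTrue.hyps(1)
    by (intro exI[of _ "1 + cost e s + u + u'"]) auto
next
  case (Skip s) then show ?case using exec.Skip[of H s] by auto
next
  case (Store a e f s) show ?case
    by (rule exI, rule conjI, rule le_refl) (simp only: silence.simps exec.Store)
next
  case (Clear a s) show ?case
    by (rule exI, rule conjI, rule le_refl) (simp only: silence.simps exec.Clear)
next
  case (WhileFalse e s c) then show ?case using exec.WhileFalse[of e s H "silence c"] by auto
qed

text \<open>\<open>S j\<close> is the memory before round j, given explicitly by the user of the
  lemma. The factor \<open>Suc n\<close> includes the final test, which fails.\<close>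

lemma exec_While_iterate:
  assumes "\<And>j. j < n \<Longrightarrow> eval e (S j) > 0 \<and> (\<exists>t \<le> B. exec H c (S j) t (S (Suc j)))"
    and "\<not> eval e (S n) > 0"
    and "\<And>j. j \<le> n \<Longrightarrow> cost e (S j) \<le> E"
  shows "\<exists>t \<le> Suc n * (1 + E + B). exec H (While e c) (S 0) t (S n)"
  using assms
proof (induction n arbitrary: S)
  case 0
  then show ?case using exec.WhileFalse[of e "S 0" H c] by (intro exI[of _ "1 + cost e (S 0)"]) auto
next
  case (Suc n)
  have "\<exists>t \<le> Suc n * (1 + E + B). exec H (While e c) (S (Suc 0)) t (S (Suc n))"
    using Suc.prems by (intro Suc.IH[of "\<lambda>j. S (Suc j)"]) auto
  then obtain t' where t': "t' \<le> Suc n * (1 + E + B)" "exec H (While e c) (S (Suc 0)) t' (S (Suc n))" by blast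
  obtain t where t: "t \<le> B" "exec H c (S 0) t (S (Suc 0))" using Suc.prems(1)[of 0] by auto
  have "exec H (While e c) (S 0) (1 + cost e (S 0) + t + t') (S (Suc n))"
    using exec.WhileTrue[OF _ t(2) t'(2)] Suc.prems(1)[of 0] by simp
  moreover have "cost e (S 0) \<le> E" using Suc.prems(3)[of 0] by simp
  then have "1 + cost e (S 0) + t + t' \<le> Suc (Suc n) * (1 + E + B)" using t t' by simp
  ultimately show ?case by blast
qed

text \<open>The length cell of \<open>b\<close> is rewritten in every round, so after j rounds
  \<open>b\<close> holds the first j entries as a well-formed word; this is the loop invariant. A
  negative length cell of \<open>a\<close> stops the loop at once and yields the empty word, in
  agreement with \<open>read_word\<close>.\<close>

definition copy :: "nat \<Rightarrow> nat \<Rightarrow> nat \<Rightarrow> com" where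
  "copy a b x = Seq (Clear b) (Seq (Clear x) (Seq
     (While (Sub (Cell a (Const 0)) (Cell x (Const 0)))
       (Seq (Store x (Const 0) (Add (Cell x (Const 0)) (Const 1)))
       (Seq (Store b (Cell x (Const 0)) (Cell a (Cell x (Const 0))))
            (Store b (Const 0) (Cell x (Const 0))))))
     (Clear x)))"

lemma exec_copy:
  assumes neq: "a \<noteq> b" "x \<noteq> a" "x \<noteq> b"
  shows "\<exists>C. \<forall>H s N. cells_bounded s N \<longrightarrow>
    (\<exists>t \<le> C * N * Suc (length (read_word (s a))).
      exec H (copy a b x) s t (s(b := store_word (read_word (s a)), x := (\<lambda>_. 0))))"
proof -
  let ?X = "Cell x (Const 0)"
  let ?A = "Cell a (Const 0)"
  obtain C where C: "\<And>e s N. e \<in> set [Const 0, ?X, Add ?X (Const 1), Cell a ?X, Sub ?A ?X] \<Longrightarrow>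
      cells_bounded s N \<Longrightarrow> cost e s \<le> C * N"
    using costs_linear[of "[Const 0, ?X, Add ?X (Const 1), Cell a ?X, Sub ?A ?X]"] by metis
  let ?body = "Seq (Store x (Const 0) (Add ?X (Const 1)))
       (Seq (Store b ?X (Cell a ?X)) (Store b (Const 0) ?X))"
  have main: "\<exists>t \<le> (7 * C + 20) * N * Suc (length (read_word (s a))).
      exec H (copy a b x) s t (s(b := store_word (read_word (s a)), x := (\<lambda>_. 0)))"
    if bd: "cells_bounded s N" for H s N
  proof -
    define w where "w = read_word (s a)"
    define S where "S j = s(b := store_word (take j w), x := (\<lambda>_. 0)(0 := int j))" for j
    have N: "1 \<le> N" using cells_bounded_pos[OF bd] .
    have nth: "w ! j = s a (int j + 1)" if "j < length w" for j
      using that by (simp add: w_def read_word_def add.commute)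
    have len: "length w = nat (s a 0)" by (simp add: w_def read_word_def)
    \<comment> \<open>The indices j and k are separate because within a round the loop index is
      already \<open>Suc j\<close> while \<open>b\<close> still holds only j entries.\<close>
    have cb: "cells_bounded (s(b := store_word (take j w), x := (\<lambda>_. 0)(0 := int k))) N"
      if "j \<le> length w" "k \<le> length w" for j k
    proof -
      have k: "isize (int k) \<le> N" if "k \<le> length w" for k
      proof (cases "k = 0")
        case False
        then have "\<bar>int k\<bar> \<le> \<bar>s a 0\<bar>" using that len by linarith
        then show ?thesis using isize_mono cells_boundedD[OF bd, of a 0] le_trans by blast
      qed (use N in simp)
      have "isize (store_word (take j w) i) \<le> N" for i
      proof -
        consider "i = 0" | l where "l < j" "store_word (take j w) i = w ! l" | "store_word (take j w) i = 0"
        proof -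
          assume a: "i = 0 \<Longrightarrow> thesis" "\<And>l. l < j \<Longrightarrow> store_word (take j w) i = w ! l \<Longrightarrow> thesis"
            "store_word (take j w) i = 0 \<Longrightarrow> thesis"
          show thesis
          proof (cases "1 \<le> i \<and> i \<le> int j")
            case True
            then show ?thesis using a(2)[of "nat (i - 1)"] \<open>j \<le> length w\<close> by (auto simp: store_word_def)
          next
            case False
            then have "i = 0 \<or> store_word (take j w) i = 0"
              using \<open>j \<le> length w\<close> by (auto simp: store_word_def)
            then show ?thesis using a(1,3) by blast
          qed
        qed
        then show ?thesis
        proof cases
          case 1 then show ?thesis using k[OF \<open>j \<le> length w\<close>] \<open>j \<le> length w\<close> by simp
        next
          case 2 then show ?thesis using nth[of l] cells_boundedD[OF bd] \<open>j \<le> length w\<close> by simp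
        qed (use N in simp)
      qed
      then show ?thesis using bd k[OF \<open>k \<le> length w\<close>] N by (auto simp: cells_bounded_def)
    qed
    have loop: "\<exists>t \<le> Suc (length w) * (1 + C * N + (6 * C * N + 5)). exec H (While (Sub ?A ?X) ?body) (S 0) t (S (length w))"
    proof (rule exec_While_iterate)
      fix j assume j: "j < length w"
      have pos: "eval (Sub ?A ?X) (S j) > 0" using j neq len by (simp add: S_def)
      define s1 where "s1 = s(b := store_word (take j w), x := (\<lambda>_. 0)(0 := int (Suc j)))"
      define s2 where "s2 = s1(b := (store_word (take j w))(int j + 1 := w ! j))"
      have e1: "exec H (Store x (Const 0) (Add ?X (Const 1))) (S j) (1 + cost (Const 0) (S j) + cost (Add ?X (Const 1)) (S j)) s1"
      proof -
        have "s1 = (S j)(x := (S j x)(eval (Const 0) (S j) := eval (Add ?X (Const 1)) (S j)))"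
          using neq by (auto simp: s1_def S_def fun_eq_iff)
        then show ?thesis using exec.Store[of H x "Const 0" "Add ?X (Const 1)" "S j"] by simp
      qed
      have e2: "exec H (Store b ?X (Cell a ?X)) s1 (1 + cost ?X s1 + cost (Cell a ?X) s1) s2"
      proof -
        have "s2 = s1(b := (s1 b)(eval ?X s1 := eval (Cell a ?X) s1))"
          using neq nth[OF j] by (auto simp: s1_def s2_def fun_eq_iff add.commute)
        then show ?thesis using exec.Store[of H b ?X "Cell a ?X" s1] by simp
      qed
      have s2b: "cells_bounded s2 N"
      proof -
        have s1: "cells_bounded s1 N" using cb[of j "Suc j"] j unfolding s1_def by simp
        have "s2 aa i = (if aa = b \<and> i = int j + 1 then w ! j else s1 aa i)" for aa i
          using neq by (simp add: s2_def s1_def)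
        then show ?thesis
          using s1 nth[OF j] cells_boundedD[OF bd] unfolding cells_bounded_def by simp
      qed
      have e3: "exec H (Store b (Const 0) ?X) s2 (1 + cost (Const 0) s2 + cost ?X s2) (S (Suc j))"
      proof -
        have "store_word (take (Suc j) w) = (store_word (take j w))(int j + 1 := w ! j, 0 := int (Suc j))"
        proof
          fix i
          show "store_word (take (Suc j) w) i = ((store_word (take j w))(int j + 1 := w ! j, 0 := int (Suc j))) i"
            using j by (auto simp: store_word_def nth_take)
        qed
        then have "S (Suc j) = s2(b := (s2 b)(eval (Const 0) s2 := eval ?X s2))"
          using neq by (auto simp: s1_def s2_def S_def fun_eq_iff)
        then show ?thesis using exec.Store[of H b "Const 0" ?X s2] by simp
      qed
      have S: "cells_bounded (S j) N" "cells_bounded s1 N" unfolding S_def s1_def using cb[of j j] cb[of j "Suc j"] j by auto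
      note c = C[OF _ S(1)] C[OF _ S(2)] C[OF _ s2b]
      let ?t = "1 + (1 + cost (Const 0) (S j) + cost (Add ?X (Const 1)) (S j))
        + (1 + (1 + cost ?X s1 + cost (Cell a ?X) s1) + (1 + cost (Const 0) s2 + cost ?X s2))"
      have ex: "exec H ?body (S j) ?t (S (Suc j))" using exec.Seq[OF e1 exec.Seq[OF e2 e3]] .
      have "?t \<le> 6 * C * N + 5"
        using c(1)[of "Const 0"] c(1)[of "Add ?X (Const 1)"] c(2)[of ?X] c(2)[of "Cell a ?X"]
          c(3)[of "Const 0"] c(3)[of ?X] by simp
      then show "eval (Sub ?A ?X) (S j) > 0 \<and> (\<exists>t \<le> 6 * C * N + 5. exec H ?body (S j) t (S (Suc j)))"
        using pos ex by blast
    next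
      show "\<not> eval (Sub ?A ?X) (S (length w)) > 0" using neq len by (simp add: S_def)
    next
      fix j assume "j \<le> length w"
      then have "cells_bounded (S j) N" unfolding S_def using cb by auto
      then show "cost (Sub ?A ?X) (S j) \<le> C * N" by (intro C) simp
    qed
    then obtain t where t: "t \<le> Suc (length w) * (1 + C * N + (6 * C * N + 5))"
      "exec H (While (Sub ?A ?X) ?body) (S 0) t (S (length w))" by blast
    have z: "S 0 = s(b := (\<lambda>_. 0), x := (\<lambda>_. 0))" by (auto simp: S_def)
    have f: "(S (length w))(x := (\<lambda>_. 0)) = s(b := store_word w, x := (\<lambda>_. 0))" by (auto simp: S_def)
    have ex: "exec H (copy a b x) s (1 + 1 + (1 + 1 + (1 + t + 1))) (s(b := store_word w, x := (\<lambda>_. 0)))"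
      unfolding copy_def
      apply (rule exec.Seq[OF exec.Clear], rule exec.Seq[OF exec.Clear])
      apply (rule exec.Seq)
       apply (rule t(2)[unfolded z])
      using exec.Clear[of H x "S (length w)"] f by simp
    let ?L = "Suc (length w)"
    have "t \<le> ?L * (7 * C * N + 6)" using t(1) by (simp add: algebra_simps)
    also have "\<dots> \<le> ?L * (7 * C * N + 6 * N)" using N by (intro mult_left_mono) auto
    finally have "t \<le> (7 * C + 6) * N * ?L" by (simp add: algebra_simps)
    moreover have "6 \<le> 6 * N * ?L" using N by (cases N) auto
    ultimately have "1 + 1 + (1 + 1 + (1 + t + 1)) \<le> (7 * C + 12) * N * ?L" by (simp add: algebra_simps)
    also have "\<dots> \<le> (7 * C + 20) * N * ?L" by (intro mult_right_mono) auto
    finally show ?thesis using ex unfolding w_def by blast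
  qed
  then show ?thesis by blast
qed


fun load :: "nat \<Rightarrow> nat \<Rightarrow> nat list \<Rightarrow> com" where
  "load x b [] = Skip"
| "load x b (a # as) = Seq (copy a b x) (load x (Suc b) as)"

lemma exec_load:
  \<comment> \<open>All sources lie below \<open>x\<close> and all targets above it, so no copy
    overwrites a later source. The index array \<open>x\<close> is zero beforehand because every
    copy leaves it cleared, and so it counts as unchanged.\<close>
  "x < b \<Longrightarrow> \<forall>a \<in> set as. a < x \<Longrightarrow> \<exists>C. \<forall>H s N. cells_bounded s N \<longrightarrow> s x = (\<lambda>_. 0) \<longrightarrow>
     (\<forall>a \<in> set as. length (read_word (s a)) \<le> N) \<longrightarrow>
     (\<exists>t \<le> C * N * Suc N. exec H (load x b as) s t
        (\<lambda>a. if b \<le> a \<and> a < b + length as then store_word (read_word (s (as ! (a - b)))) else s a))"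
proof (induction as arbitrary: b)
  case Nil
  have nil: "\<exists>t \<le> 1 * N * Suc N. exec H (load x b []) s t
      (\<lambda>a. if b \<le> a \<and> a < b + length [] then store_word (read_word (s ([] ! (a - b)))) else s a)"
    if "cells_bounded s N" for H s N
  proof (intro exI conjI)
    have "(\<lambda>a. if b \<le> a \<and> a < b + length [] then store_word (read_word (s ([] ! (a - b)))) else s a) = s"
      by (rule ext) (simp add: not_le[symmetric])
    then show "exec H (load x b []) s 1
        (\<lambda>a. if b \<le> a \<and> a < b + length [] then store_word (read_word (s ([] ! (a - b)))) else s a)"
      using exec.Skip[of H s] by simp
    show "1 \<le> 1 * N * Suc N" using cells_bounded_pos[OF that] by (simp add: Suc_le_eq)
  qed
  show ?case by (rule exI[of _ 1], intro allI impI, rule nil)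
next
  case (Cons a as)
  have ax: "a < x" "\<forall>a \<in> set as. a < x" "x < Suc b" using Cons.prems by auto
  obtain C where C: "\<And>H s N. cells_bounded s N \<Longrightarrow> s x = (\<lambda>_. 0) \<Longrightarrow>
     (\<forall>a \<in> set as. length (read_word (s a)) \<le> N) \<Longrightarrow>
     (\<exists>t \<le> C * N * Suc N. exec H (load x (Suc b) as) s t
        (\<lambda>a. if Suc b \<le> a \<and> a < Suc b + length as then store_word (read_word (s (as ! (a - Suc b)))) else s a))"
    using Cons.IH[OF ax(3,2)] by blast
  have "a \<noteq> b" "x \<noteq> a" "x \<noteq> b" using ax(1) Cons.prems by auto
  from exec_copy[OF this] obtain D where D: "\<And>H s N. cells_bounded s N \<Longrightarrow>
     (\<exists>t \<le> D * N * Suc (length (read_word (s a))).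
        exec H (copy a b x) s t (s(b := store_word (read_word (s a)), x := (\<lambda>_. 0))))"
    by blast
  have cons: "\<exists>t \<le> (C + D + 1) * N * Suc N. exec H (load x b (a # as)) s t
        (\<lambda>aa. if b \<le> aa \<and> aa < b + length (a # as) then store_word (read_word (s ((a # as) ! (aa - b)))) else s aa)"
    if bd: "cells_bounded s N" and x0: "s x = (\<lambda>_. 0)"
      and len: "\<forall>a \<in> set (a # as). length (read_word (s a)) \<le> N" for H s N
  proof -
    let ?s = "s(b := store_word (read_word (s a)), x := (\<lambda>_. 0))"
    obtain t where t: "t \<le> D * N * Suc (length (read_word (s a)))" "exec H (copy a b x) s t ?s"
      using D[OF bd, of H] by blast
    have N: "1 \<le> N" using cells_bounded_pos[OF bd] .
    have bd': "cells_bounded ?s N"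
      using bd isize_store_read_word[of "s a" N] N by (auto simp: cells_bounded_def)
    have same: "?s a' = s a'" if "a' \<in> set as" for a' using that ax(2) Cons.prems by force
    obtain t' where t': "t' \<le> C * N * Suc N" "exec H (load x (Suc b) as) ?s t'
        (\<lambda>a. if Suc b \<le> a \<and> a < Suc b + length as then store_word (read_word (?s (as ! (a - Suc b)))) else ?s a)"
      using C[OF bd', of H] len same by auto
    have fin: "(\<lambda>a. if Suc b \<le> a \<and> a < Suc b + length as then store_word (read_word (?s (as ! (a - Suc b)))) else ?s a)
      = (\<lambda>aa. if b \<le> aa \<and> aa < b + length (a # as) then store_word (read_word (s ((a # as) ! (aa - b)))) else s aa)"
      (is "?l = ?r")
    proof
      fix aa
      consider "Suc b \<le> aa" "aa < Suc b + length as" | "aa = b" | "aa \<noteq> b" "\<not> (Suc b \<le> aa \<and> aa < Suc b + length as)"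
        by linarith
      then show "?l aa = ?r aa"
      proof cases
        case 1
        then have "as ! (aa - Suc b) \<in> set as" by simp
        from same[OF this] show ?thesis using 1 by (simp add: nth_Cons' )
      next
        case 2
        then show ?thesis using Cons.prems by simp
      next
        case 3
        then have "\<not> (b \<le> aa \<and> aa < b + length (a # as))" by auto
        then have "?r aa = s aa" by (simp only: if_False)
        moreover have "?l aa = ?s aa" using 3(2) by (simp only: if_False)
        moreover have "?s aa = s aa" using 3(1) x0 by simp
        ultimately show ?thesis by simp
      qed
    qed
    have "exec H (load x b (a # as)) s (1 + t + t')
        (\<lambda>aa. if b \<le> aa \<and> aa < b + length (a # as) then store_word (read_word (s ((a # as) ! (aa - b)))) else s aa)"
      using exec.Seq[OF t(2) t'(2)] unfolding fin load.simps .
    moreover have "t \<le> D * N * Suc N"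
      using t(1) len by (meson Suc_le_mono le_trans list.set_intros(1) mult_le_mono2)
    then have "1 + t + t' \<le> (C + D + 1) * N * Suc N"
    proof -
      assume "t \<le> D * N * Suc N"
      moreover have "1 \<le> N * Suc N" using N by simp
      ultimately show ?thesis using t'(1) by (simp add: algebra_simps)
    qed
    ultimately show ?thesis by blast
  qed
  show ?case by (rule exI[of _ "C + D + 1"], intro allI impI, rule cons)
qed

fun clears :: "nat list \<Rightarrow> com" where
  "clears [] = Skip"
| "clears (a # as) = Seq (Clear a) (clears as)"

lemma exec_clears:
  "exec H (clears as) s (1 + 2 * length as) (\<lambda>a. if a \<in> set as then (\<lambda>_. 0) else s a)"
proof (induction as arbitrary: s)
  case Nil
  then show ?case using exec.Skip[of H s] by simp
next
  case (Cons a as)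
  have "(\<lambda>a'. if a' \<in> set as then (\<lambda>_. 0) else (s(a := (\<lambda>_. 0))) a')
    = (\<lambda>a'. if a' \<in> set (a # as) then (\<lambda>_. 0) else s a')" by auto
  then show ?case using exec.Seq[OF exec.Clear[of H a s] Cons[of "s(a := (\<lambda>_. 0))"]] by simp
qed

text \<open>The subroutine works on the arrays above \<open>K\<close>; array \<open>K\<close> is the loop index of the copies.\<close>

definition call :: "nat \<Rightarrow> nat list \<Rightarrow> com \<Rightarrow> nat \<Rightarrow> com" where
  "call K as c b = Seq (load K (Suc K) as) (Seq (rename (\<lambda>a. Suc K + a) c)
     (Seq (copy (Suc K) b K) (clears [K..<Suc K + length as + write_bound c])))"

lemma init_mem_nth [simp]: "a < length ws \<Longrightarrow> init_mem ws a = store_word (ws ! a)"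
  by (simp add: init_mem_def)

lemma init_mem_beyond [simp]: "length ws \<le> a \<Longrightarrow> init_mem ws a = (\<lambda>_. 0)"
  by (simp add: init_mem_def)

lemma init_mem_update: "b < length ws \<Longrightarrow> init_mem (ws[b := w]) = (init_mem ws)(b := store_word w)"
  by (auto simp: init_mem_def fun_eq_iff)

lemma init_mem_pad: "init_mem (ws @ replicate n []) = init_mem ws"
  by (auto simp: init_mem_def fun_eq_iff nth_append)

text \<open>Between calls the memory always has the form \<open>init_mem vs\<close>. Since the call
  clears whatever it used above the variables, its whole effect is one update of the list
  \<open>vs\<close>, and programs can be composed by reasoning about lists of words. Copying costs
  the length times the size of a cell, hence the square.\<close>

lemma exec_call:
  assumes as: "\<forall>a \<in> set as. a < K" and b: "b < K"
  shows "\<exists>C. \<forall>H vs out t. length vs = K \<longrightarrow> runs H c (map (\<lambda>a. vs ! a) as) out t \<longrightarrow>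
    (\<exists>t' \<le> C * (isz vs + t + 1) ^ 2. exec H (call K as c b) (init_mem vs) t' (init_mem (vs[b := out])))"
proof -
  obtain C1 where C1: "\<And>H s N. cells_bounded s N \<Longrightarrow> s K = (\<lambda>_. 0) \<Longrightarrow>
     (\<forall>a \<in> set as. length (read_word (s a)) \<le> N) \<Longrightarrow>
     (\<exists>t \<le> C1 * N * Suc N. exec H (load K (Suc K) as) s t
        (\<lambda>a. if Suc K \<le> a \<and> a < Suc K + length as then store_word (read_word (s (as ! (a - Suc K)))) else s a))"
    using exec_load[of K "Suc K" as] as by auto
  obtain C2 where C2: "\<And>H s N. cells_bounded s N \<Longrightarrow>
     (\<exists>t \<le> C2 * N * Suc (length (read_word (s (Suc K)))).
        exec H (copy (Suc K) b K) s t (s(b := store_word (read_word (s (Suc K))), K := (\<lambda>_. 0))))"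
    using exec_copy[of "Suc K" b K] b by auto
  define L where "L = [K..<Suc K + length as + write_bound c]"
  let ?C = "2 * C1 + C2 + 2 * length L + 5"
  have "\<exists>t' \<le> ?C * (isz vs + t + 1) ^ 2. exec H (call K as c b) (init_mem vs) t' (init_mem (vs[b := out]))"
    if K: "length vs = K" and run: "runs H c (map (\<lambda>a. vs ! a) as) out t" for H vs out t
  proof -
    define N where "N = isz vs + 1"
    define args where "args = map (\<lambda>a. vs ! a) as"
    have bd: "cells_bounded (init_mem vs) N" unfolding N_def by (rule cells_bounded_init)
    have len: "length (read_word (init_mem vs a)) \<le> N" if "a \<in> set as" for a
      using as that K length_le_wsize[of "vs ! a"] wsize_nth_le_isz[of a vs] by (simp add: N_def)
    \<comment> \<open>The empty word stands for array \<open>K\<close>, the loop index of the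
      copies, which separates the variables from the arguments.\<close>
    define s1 where "s1 = init_mem (vs @ [] # args)"
    have "(\<lambda>a. if Suc K \<le> a \<and> a < Suc K + length as then store_word (read_word (init_mem vs (as ! (a - Suc K)))) else init_mem vs a) = s1"
    proof
      fix a
      consider "Suc K \<le> a" "a < Suc K + length as" | "a = K" | "a < K" | "Suc K + length as \<le> a"
        by linarith
      then show "(if Suc K \<le> a \<and> a < Suc K + length as then store_word (read_word (init_mem vs (as ! (a - Suc K)))) else init_mem vs a) = s1 a"
      proof cases
        case 1
        then have "as ! (a - Suc K) < K" using as by simp
        then show ?thesis using 1 K by (simp add: s1_def args_def nth_append nth_Cons')
      qed (use K in \<open>simp_all add: s1_def args_def nth_append\<close>)
    qed
    then obtain t1 where t1: "t1 \<le> C1 * N * Suc N" "exec H (load K (Suc K) as) (init_mem vs) t1 s1"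
      using C1[OF bd, of H] len K by auto
    obtain t2 s' where t2: "exec H c (init_mem args) t2 s'" and out: "out = read_word (s' 0)"
      and t: "t = t2 + wsize out" using run unfolding runs_def args_def by blast
    have "s1 \<circ> (\<lambda>a. Suc K + a) = init_mem args"
      using K by (auto simp: s1_def init_mem_def fun_eq_iff nth_append)
    from exec_rename[OF _ t2 this] obtain s2 where s2: "exec H (rename (\<lambda>a. Suc K + a) c) s1 t2 s2"
      "s2 \<circ> (\<lambda>a. Suc K + a) = s'" "\<forall>b. b \<notin> range (\<lambda>a. Suc K + a) \<longrightarrow> s2 b = s1 b" by (auto simp: inj_def)
    have bd1: "cells_bounded s1 N"
    proof -
      have "isize (s1 a i) \<le> N" for a i
      proof -
        consider "a < K" | "a = K" | j where "a = Suc K + j" "j < length as" | "length (vs @ [] # args) \<le> a"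
        proof -
          assume *: "a < K \<Longrightarrow> thesis" "a = K \<Longrightarrow> thesis" "\<And>j. a = Suc K + j \<Longrightarrow> j < length as \<Longrightarrow> thesis"
            "length (vs @ [] # args) \<le> a \<Longrightarrow> thesis"
          show thesis
          proof (cases "a \<le> K")
            case False
            then show ?thesis using *(3)[of "a - Suc K"] *(4) K
              by (cases "a - Suc K < length as") (auto simp: args_def)
          qed (use *(1,2) in linarith)
        qed
        then show ?thesis
        proof cases
          case 1
          then have "s1 a = init_mem vs a" using K by (simp add: s1_def nth_append)
          then show ?thesis using cells_boundedD[OF bd] by simp
        next
          case (3 j)
          then have "s1 a = init_mem vs (as ! j)" using K as by (simp add: s1_def nth_append args_def)
          then show ?thesis using cells_boundedD[OF bd] by simp
        qed (use K in \<open>simp_all add: s1_def nth_append N_def\<close>)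
      qed
      then show ?thesis by (simp add: cells_bounded_def)
    qed
    have bd2: "cells_bounded s2 (N + t2)" using exec_cells_bounded[OF s2(1) bd1] .
    have s20: "s2 (Suc K) = s' 0" using s2(2) by auto
    obtain t3 where t3: "t3 \<le> C2 * (N + t2) * Suc (length out)"
      "exec H (copy (Suc K) b K) s2 t3 (s2(b := store_word out, K := (\<lambda>_. 0)))"
      using C2[OF bd2, of H] s20 out by auto
    have fin: "(\<lambda>a. if a \<in> set L then (\<lambda>_. 0) else (s2(b := store_word out, K := (\<lambda>_. 0))) a)
      = init_mem (vs[b := out])" (is "?l = _")
    proof
      fix a
      consider "a = b" | "a < K" "a \<noteq> b" | "a \<in> set L" | "Suc K + length as + write_bound c \<le> a"
        unfolding L_def set_upt atLeastLessThan_iff by linarith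
      then show "?l a = init_mem (vs[b := out]) a"
      proof cases
        case 1
        then show ?thesis using K b by (simp add: L_def)
      next
        case 2
        then have "a \<notin> range ((+) (Suc K))" by auto
        then have "s2 a = s1 a" using s2(3) by auto
        then show ?thesis using 2 K by (simp add: L_def s1_def nth_append)
      next
        case 3
        then have "length (vs[b := out]) \<le> a" using K by (auto simp: L_def)
        then show ?thesis using 3 by (simp del: length_list_update)
      next
        case 4
        \<comment> \<open>Such an array is neither an argument nor written by the subroutine, so it
          has been zero throughout.\<close>
        define j where "j = a - Suc K"
        have a: "a = Suc K + j" "write_bound c \<le> j" "length as \<le> j" using 4 by (auto simp: j_def)
        have "s2 a = s' j" using s2(2) a(1) by auto
        also have "\<dots> = init_mem args j" using exec_write_bound[OF t2 a(2)] .
        also have "\<dots> = (\<lambda>_. 0)" using a(3) by (simp add: args_def)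
        finally show ?thesis using 4 K b by (simp add: L_def)
      qed
    qed
    have ex: "exec H (call K as c b) (init_mem vs)
        (1 + t1 + (1 + t2 + (1 + t3 + (1 + 2 * length L)))) (init_mem (vs[b := out]))"
      using exec.Seq[OF t1(2) exec.Seq[OF s2(1) exec.Seq[OF t3(2) exec_clears[of H L]]], unfolded fin]
      unfolding call_def L_def .
    define M where "M = isz vs + t + 1"
    have M: "N \<le> M" "N + t2 \<le> M" "1 \<le> M" by (auto simp: M_def N_def t)
    have "t1 \<le> C1 * N * Suc N" by (rule t1)
    also have "\<dots> \<le> C1 * M * (2 * M)" using M by (intro mult_le_mono) auto
    finally have 1: "t1 \<le> 2 * C1 * M ^ 2" by (simp add: power2_eq_square algebra_simps)
    have "Suc (length out) \<le> M" using length_le_wsize[of out] by (simp add: t M_def)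
    then have "C2 * (N + t2) * Suc (length out) \<le> C2 * M * M" using M by (intro mult_le_mono) auto
    then have 3: "t3 \<le> C2 * M ^ 2" using t3(1) by (simp add: power2_eq_square algebra_simps)
    have "M \<le> M ^ 2" "1 \<le> M ^ 2" using M by (simp_all add: power2_eq_square)
    then have 2: "t2 \<le> M ^ 2" using M by linarith
    have sum: "1 + u + (1 + v + (1 + w + (1 + 2 * l))) \<le> a + c + b + (4 + 2 * l) * 1"
      if "u \<le> a" "v \<le> b" "w \<le> c" for a b c l u v w :: nat using that by simp
    have "1 + t1 + (1 + t2 + (1 + t3 + (1 + 2 * length L)))
      \<le> 2 * C1 * M ^ 2 + C2 * M ^ 2 + M ^ 2 + (4 + 2 * length L) * 1"
      by (rule sum[OF 1 2 3])
    also have "\<dots> \<le> 2 * C1 * M ^ 2 + C2 * M ^ 2 + M ^ 2 + (4 + 2 * length L) * M ^ 2"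
      by (intro add_left_mono mult_left_mono \<open>1 \<le> M ^ 2\<close>) simp
    also have "\<dots> = ?C * M ^ 2" by (simp add: algebra_simps)
    finally have "1 + t1 + (1 + t2 + (1 + t3 + (1 + 2 * length L))) \<le> ?C * M ^ 2" .
    with ex show ?thesis unfolding M_def by (intro exI conjI)
  qed
  then show ?thesis by blast
qed

section \<open>Functions computable in polynomial time\<close>

lemma poly_nat_mono: "x \<le> y \<Longrightarrow> poly (P :: nat poly) x \<le> poly P y"
  by (induction P) (auto intro: add_mono mult_mono)

definition poly_bounded :: "word list set \<Rightarrow> (word list \<Rightarrow> nat) \<Rightarrow> bool" where
  "poly_bounded D f \<longleftrightarrow> (\<exists>P :: nat poly. \<forall>ws \<in> D. f ws \<le> poly P (isz ws))"

lemma poly_boundedI: "(\<And>ws. ws \<in> D \<Longrightarrow> f ws \<le> poly P (isz ws)) \<Longrightarrow> poly_bounded D f"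
  by (auto simp: poly_bounded_def)

lemma poly_bounded_const [intro, simp]: "poly_bounded D (\<lambda>_. c)"
  by (rule poly_boundedI[of _ _ "[:c:]"]) simp

lemma poly_bounded_isz [intro, simp]: "poly_bounded D isz"
  by (rule poly_boundedI[of _ _ "[:0, 1:]"]) simp

lemma poly_bounded_add [intro]:
  assumes "poly_bounded D f" "poly_bounded D g"
  shows "poly_bounded D (\<lambda>ws. f ws + g ws)"
proof -
  from assms obtain P Q where "\<forall>ws \<in> D. f ws \<le> poly P (isz ws)" "\<forall>ws \<in> D. g ws \<le> poly Q (isz ws)"
    unfolding poly_bounded_def by blast
  then show ?thesis by (intro poly_boundedI[of _ _ "P + Q"]) (auto intro: add_mono)
qed

lemma poly_bounded_mult [intro]:
  assumes "poly_bounded D f" "poly_bounded D g"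
  shows "poly_bounded D (\<lambda>ws. f ws * g ws)"
proof -
  from assms obtain P Q where "\<forall>ws \<in> D. f ws \<le> poly P (isz ws)" "\<forall>ws \<in> D. g ws \<le> poly Q (isz ws)"
    unfolding poly_bounded_def by blast
  then show ?thesis by (intro poly_boundedI[of _ _ "P * Q"]) (auto intro: mult_mono)
qed

lemma poly_bounded_Suc [intro]: "poly_bounded D f \<Longrightarrow> poly_bounded D (\<lambda>ws. Suc (f ws))"
  using poly_bounded_add[of D f "\<lambda>_. 1"] by simp

lemma poly_bounded_power [intro]: "poly_bounded D f \<Longrightarrow> poly_bounded D (\<lambda>ws. f ws ^ k)"
  by (induction k) (simp_all add: poly_bounded_mult)

lemma poly_bounded_mono: "poly_bounded D g \<Longrightarrow> (\<And>ws. ws \<in> D \<Longrightarrow> f ws \<le> g ws) \<Longrightarrow> poly_bounded D f"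
  unfolding poly_bounded_def by (meson le_trans)

lemma poly_bounded_poly [intro]:
  assumes "poly_bounded D f"
  shows "poly_bounded D (\<lambda>ws. poly P (f ws))"
proof -
  from assms obtain Q where "\<forall>ws \<in> D. f ws \<le> poly Q (isz ws)"
    unfolding poly_bounded_def by blast
  then show ?thesis
    by (intro poly_boundedI[of _ _ "pcompose P Q"]) (simp add: poly_pcompose poly_nat_mono)
qed

lemma poly_bounded_wsize_nth: "\<forall>ws \<in> D. i < length ws \<Longrightarrow> poly_bounded D (\<lambda>ws. wsize (ws ! i))"
  by (rule poly_bounded_mono[OF poly_bounded_isz]) (simp add: wsize_nth_le_isz)

text \<open>One program serves all external functions in \<open>HH\<close>, but the time bound may depend on them.
  Nothing is required for arguments outside \<open>D\<close>.\<close>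

definition poly_comp :: "(word \<Rightarrow> word) set \<Rightarrow> word list set \<Rightarrow> ((word \<Rightarrow> word) \<Rightarrow> word list \<Rightarrow> word) \<Rightarrow> bool" where
  "poly_comp HH D f \<longleftrightarrow> (\<exists>c. \<forall>H \<in> HH. \<exists>T. poly_bounded D T \<and>
     (\<forall>ws \<in> D. \<exists>t \<le> T ws. runs H c ws (f H ws) t))"

lemma poly_compE:
  assumes "poly_comp HH D f"
  obtains c T where "\<And>H. H \<in> HH \<Longrightarrow> poly_bounded D (T H)"
    and "\<And>H ws. H \<in> HH \<Longrightarrow> ws \<in> D \<Longrightarrow> \<exists>t \<le> T H ws. runs H c ws (f H ws) t"
  using assms unfolding poly_comp_def by metis

lemma poly_compI:
  assumes "\<And>H. H \<in> HH \<Longrightarrow> poly_bounded D (T H)"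
    and "\<And>H ws. H \<in> HH \<Longrightarrow> ws \<in> D \<Longrightarrow>
      \<exists>t s. exec H c (init_mem ws) t s \<and> read_word (s 0) = f H ws \<and> t + wsize (f H ws) \<le> T H ws"
  shows "poly_comp HH D f"
  unfolding poly_comp_def runs_def
proof (intro exI[of _ c] ballI)
  fix H assume "H \<in> HH"
  then show "\<exists>T. poly_bounded D T \<and> (\<forall>ws\<in>D. \<exists>t\<le>T ws. \<exists>t' s. exec H c (init_mem ws) t' s \<and>
      f H ws = read_word (s 0) \<and> t = t' + wsize (f H ws))"
    using assms by (intro exI[of _ "T H"]) metis
qed

lemma poly_comp_cong:
  "(\<And>H ws. H \<in> HH \<Longrightarrow> ws \<in> D \<Longrightarrow> f H ws = g H ws) \<Longrightarrow> poly_comp HH D f \<Longrightarrow> poly_comp HH D g"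
  unfolding poly_comp_def by (metis (no_types, lifting))

text \<open>The definition of \<open>runs\<close> charges for writing the output, so a time bound is
  also a bound on the result.\<close>

lemma poly_comp_wsize:
  assumes "poly_comp HH D f" "H \<in> HH"
  shows "poly_bounded D (\<lambda>ws. wsize (f H ws))"
proof -
  obtain c T where c: "\<And>H. H \<in> HH \<Longrightarrow> poly_bounded D (T H)"
    "\<And>H ws. H \<in> HH \<Longrightarrow> ws \<in> D \<Longrightarrow> \<exists>t \<le> T H ws. runs H c ws (f H ws) t"
    using assms(1) by (rule poly_compE) blast
  have "wsize (f H ws) \<le> T H ws" if D: "ws \<in> D" for ws
  proof -
    obtain t where "t \<le> T H ws" "runs H c ws (f H ws) t" using c(2)[OF assms(2) D] by blast
    then show ?thesis by (auto simp: runs_def)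
  qed
  then show ?thesis by (rule poly_bounded_mono[OF c(1)[OF assms(2)]])
qed

section \<open>Elementary programs\<close>

lemma exec_Store:
  "s' = s(a := (s a)(eval e s := eval f s)) \<Longrightarrow> exec H (Store a e f) s (1 + cost e s + cost f s) s'"
  using exec.Store by simp

lemma poly_bounded_cost: "poly_bounded D (\<lambda>ws. cost e (init_mem ws))"
proof -
  obtain C where C: "\<forall>s N. cells_bounded s N \<longrightarrow> cost e s \<le> C * N \<and> isize (eval e s) \<le> C * N"
    using cost_linear by blast
  show ?thesis
  proof (rule poly_bounded_mono)
    show "poly_bounded D (\<lambda>ws. C * (isz ws + 1))"
      by (intro poly_bounded_add poly_bounded_mult poly_bounded_const poly_bounded_isz)
    show "cost e (init_mem ws) \<le> C * (isz ws + 1)" for ws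
      using C cells_bounded_init by blast
  qed
qed

text \<open>The value is stored before the length, since \<open>e\<close> may read the length cell
  of array 0 and has to be evaluated on the initial memory.\<close>

lemma poly_comp_scalar: "poly_comp HH D (\<lambda>H ws. [eval e (init_mem ws)])"
proof (rule poly_compI)
  fix H ws
  let ?s = "init_mem ws"
  let ?s1 = "?s(0 := (?s 0)(1 := eval e ?s))"
  let ?s2 = "?s(0 := (?s 0)(1 := eval e ?s, 0 := 1))"
  have "exec H (Store 0 (Const 1) e) ?s (1 + cost (Const 1) ?s + cost e ?s) ?s1"
    by (rule exec_Store) simp
  moreover have "exec H (Store 0 (Const 0) (Const 1)) ?s1 (1 + cost (Const 0) ?s1 + cost (Const 1) ?s1) ?s2"
    by (rule exec_Store) (simp add: fun_eq_iff)
  ultimately have ex: "exec H (Seq (Store 0 (Const 1) e) (Store 0 (Const 0) (Const 1))) ?s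
    (1 + (1 + cost (Const 1) ?s + cost e ?s) + (1 + cost (Const 0) ?s1 + cost (Const 1) ?s1)) ?s2"
    by (rule exec.Seq)
  have rd: "read_word (?s2 0) = [eval e ?s]" by (simp add: read_word_def)
  show "\<exists>t s. exec H (Seq (Store 0 (Const 1) e) (Store 0 (Const 0) (Const 1))) (init_mem ws) t s \<and>
      read_word (s 0) = [eval e (init_mem ws)] \<and> t + wsize [eval e (init_mem ws)] \<le> 4 + 2 * isize 1 + 2 * cost e ?s"
    by (intro exI conjI, rule ex, rule rd) (use isize_eval_le_cost[of e ?s] in auto)
next
  show "poly_bounded D (\<lambda>ws. 4 + 2 * isize 1 + 2 * cost e (init_mem ws))"
    by (intro poly_bounded_add poly_bounded_mult poly_bounded_const poly_bounded_cost)
qed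

lemma store_word_update:
  assumes "1 \<le> i" "i \<le> int (length w)"
  shows "(store_word w)(i := x) = store_word (w[nat (i - 1) := x])"
proof
  fix j
  consider "j = i" | "j \<noteq> i" "1 \<le> j" "j \<le> int (length w)" | "j \<noteq> i" "\<not> (1 \<le> j \<and> j \<le> int (length w))"
    by blast
  then show "((store_word w)(i := x)) j = store_word (w[nat (i - 1) := x]) j"
  proof cases
    case 1
    then show ?thesis using assms by (simp add: store_word_def)
  next
    case 2
    then have "nat (j - 1) \<noteq> nat (i - 1)" using assms by linarith
    then show ?thesis using 2 by (simp add: store_word_def)
  next
    case 3
    then show ?thesis by (auto simp: store_word_def)
  qed
qed

lemma store_word_snoc:
  "(store_word w)(int (length w) + 1 := x, 0 := int (length w) + 1) = store_word (w @ [x])"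
proof
  fix j
  consider "j = 0" | "j = int (length w) + 1" | "1 \<le> j" "j \<le> int (length w)" | "j < 0" | "j > int (length w) + 1"
    by linarith
  then show "((store_word w)(int (length w) + 1 := x, 0 := int (length w) + 1)) j = store_word (w @ [x]) j"
  proof cases
    case 3
    then have "nat (j - 1) < length w" by linarith
    then show ?thesis using 3 by (simp add: store_word_def nth_append)
  qed (simp_all add: store_word_def)
qed

lemma poly_comp_update:
  assumes "\<And>ws. ws \<in> D \<Longrightarrow> ws \<noteq> [] \<and> 1 \<le> eval e (init_mem ws) \<and> eval e (init_mem ws) \<le> int (length (ws ! 0))"
  shows "poly_comp HH D (\<lambda>H ws. (ws ! 0)[nat (eval e (init_mem ws) - 1) := eval f (init_mem ws)])"
proof (rule poly_compI)
  fix H ws assume D: "ws \<in> D"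
  let ?s = "init_mem ws"
  let ?w = "(ws ! 0)[nat (eval e ?s - 1) := eval f ?s]"
  let ?s1 = "?s(0 := (?s 0)(eval e ?s := eval f ?s))"
  have ex: "exec H (Store 0 e f) ?s (1 + cost e ?s + cost f ?s) ?s1" by (rule exec_Store) simp
  have "?s1 0 = store_word ?w"
    using assms[OF D] by (simp add: store_word_update)
  then have rd: "read_word (?s1 0) = ?w" by simp
  have "wsize ?w \<le> wsize (ws ! 0) + isize (eval f ?s)"
  proof -
    have "wsize (w[i := x]) \<le> wsize w + isize x" for w i x
      by (induction w arbitrary: i) (auto split: nat.split)
    then show ?thesis .
  qed
  also have "\<dots> \<le> isz ws + cost f ?s"
    using isize_eval_le_cost[of f ?s] wsize_nth_le_isz[of 0 ws] assms[OF D] by (intro add_mono) auto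
  finally show "\<exists>t s. exec H (Store 0 e f) ?s t s \<and> read_word (s 0) = ?w \<and>
      t + wsize ?w \<le> 1 + cost e ?s + 2 * cost f ?s + isz ws"
    using ex rd by (intro exI[of _ "1 + cost e ?s + cost f ?s"] exI[of _ ?s1] conjI) auto
next
  show "poly_bounded D (\<lambda>ws. 1 + cost e (init_mem ws) + 2 * cost f (init_mem ws) + isz ws)"
    by (intro poly_bounded_add poly_bounded_mult poly_bounded_const poly_bounded_cost poly_bounded_isz)
qed

lemma poly_comp_snoc:
  assumes "\<And>ws. ws \<in> D \<Longrightarrow> ws \<noteq> []"
  shows "poly_comp HH D (\<lambda>H ws. ws ! 0 @ [eval f (init_mem ws)])"
proof (rule poly_compI)
  let ?e = "Add (Cell 0 (Const 0)) (Const 1)"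
  fix H ws assume D: "ws \<in> D"
  let ?s = "init_mem ws"
  let ?w = "ws ! 0 @ [eval f ?s]"
  let ?s1 = "?s(0 := (?s 0)(eval ?e ?s := eval f ?s))"
  let ?s2 = "?s1(0 := (?s1 0)(0 := ?s1 0 0 + 1))"
  have ex: "exec H (Store 0 ?e f) ?s (1 + cost ?e ?s + cost f ?s) ?s1" by (rule exec_Store) simp
  have ex2: "exec H (Store 0 (Const 0) ?e) ?s1 (1 + cost (Const 0) ?s1 + cost ?e ?s1) ?s2"
    by (rule exec_Store) simp
  have s0: "?s 0 = store_word (ws ! 0)" using assms[OF D] by simp
  have l1: "?s1 0 0 = ?s 0 0" using s0 by simp
  then have ce: "cost ?e ?s1 = cost ?e ?s" by simp
  have "?s2 0 = store_word ?w"
    using s0 store_word_snoc[of "ws ! 0" "eval f ?s"] by simp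
  then have rd: "read_word (?s2 0) = ?w" by simp
  have "wsize ?w \<le> isz ws + cost f ?s"
    using isize_eval_le_cost[of f ?s] wsize_nth_le_isz[of 0 ws] assms[OF D] by auto
  then have le: "1 + (1 + cost ?e ?s + cost f ?s) + (1 + cost (Const 0) ?s1 + cost ?e ?s1) + wsize ?w
    \<le> 4 + 2 * cost ?e ?s + 2 * cost f ?s + isz ws" unfolding ce by simp
  show "\<exists>t s. exec H (Seq (Store 0 ?e f) (Store 0 (Const 0) ?e)) ?s t s \<and> read_word (s 0) = ?w \<and>
      t + wsize ?w \<le> 4 + 2 * cost ?e ?s + 2 * cost f ?s + isz ws"
    by (intro exI conjI, rule exec.Seq[OF ex ex2], rule rd, rule le)
next
  show "poly_bounded D (\<lambda>ws. 4 + 2 * cost (Add (Cell 0 (Const 0)) (Const 1)) (init_mem ws) + 2 * cost f (init_mem ws) + isz ws)"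
    by (intro poly_bounded_add poly_bounded_mult poly_bounded_const poly_bounded_cost poly_bounded_isz)
qed

text \<open>Each branch is only required to work on its own part of the domain; the sum of the two
  polynomials bounds the time on either part.\<close>

lemma poly_comp_if:
  assumes f: "poly_comp HH {ws \<in> D. eval e (init_mem ws) > 0} f"
    and g: "poly_comp HH {ws \<in> D. \<not> eval e (init_mem ws) > 0} g"
  shows "poly_comp HH D (\<lambda>H ws. if eval e (init_mem ws) > 0 then f H ws else g H ws)"
proof -
  let ?p = "\<lambda>ws. eval e (init_mem ws) > 0"
  obtain c T where c: "\<And>H. H \<in> HH \<Longrightarrow> poly_bounded {ws \<in> D. ?p ws} (T H)"
    "\<And>H ws. H \<in> HH \<Longrightarrow> ws \<in> {ws \<in> D. ?p ws} \<Longrightarrow> \<exists>t \<le> T H ws. runs H c ws (f H ws) t"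
    using f by (rule poly_compE) blast
  obtain d U where d: "\<And>H. H \<in> HH \<Longrightarrow> poly_bounded {ws \<in> D. \<not> ?p ws} (U H)"
    "\<And>H ws. H \<in> HH \<Longrightarrow> ws \<in> {ws \<in> D. \<not> ?p ws} \<Longrightarrow> \<exists>t \<le> U H ws. runs H d ws (g H ws) t"
    using g by (rule poly_compE) blast
  let ?T = "\<lambda>H ws. 1 + cost e (init_mem ws) + (if ?p ws then T H ws else U H ws)"
  show ?thesis
  proof (rule poly_compI[of _ _ ?T "If e c d"])
    fix H assume H: "H \<in> HH"
    obtain P Q where PQ: "\<forall>ws \<in> {ws \<in> D. ?p ws}. T H ws \<le> poly P (isz ws)"
      "\<forall>ws \<in> {ws \<in> D. \<not> ?p ws}. U H ws \<le> poly Q (isz ws)"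
      using c(1)[OF H] d(1)[OF H] unfolding poly_bounded_def by blast
    have "poly_bounded D (\<lambda>ws. if ?p ws then T H ws else U H ws)"
      by (rule poly_boundedI[of _ _ "P + Q"]) (use PQ in \<open>auto intro: trans_le_add1 trans_le_add2\<close>)
    then show "poly_bounded D (?T H)"
      by (intro poly_bounded_add poly_bounded_const poly_bounded_cost)
  next
    fix H ws assume H: "H \<in> HH" and D: "ws \<in> D"
    show "\<exists>t s. exec H (If e c d) (init_mem ws) t s \<and> read_word (s 0) = (if ?p ws then f H ws else g H ws) \<and>
        t + wsize (if ?p ws then f H ws else g H ws) \<le> ?T H ws"
    proof (cases "?p ws")
      case True
      then obtain t s where "exec H c (init_mem ws) t s" "f H ws = read_word (s 0)"
        "t + wsize (f H ws) \<le> T H ws" using c(2)[OF H] D unfolding runs_def by blast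
      then show ?thesis using exec.IfTrue[OF True, of H c t s d] True
        by (intro exI[of _ "1 + cost e (init_mem ws) + t"] exI[of _ s]) auto
    next
      case False
      then obtain t s where "exec H d (init_mem ws) t s" "g H ws = read_word (s 0)"
        "t + wsize (g H ws) \<le> U H ws" using d(2)[OF H] D unfolding runs_def by blast
      then show ?thesis using exec.IfFalse[OF False, of H d t s c] False
        by (intro exI[of _ "1 + cost e (init_mem ws) + t"] exI[of _ s]) auto
    qed
  qed
qed

text \<open>This is where the polynomial bound on the answers of an approximator enters the running
  time.\<close>

lemma poly_comp_ask:
  assumes ne: "\<And>ws. ws \<in> D \<Longrightarrow> ws \<noteq> []"
    and H: "\<And>H. H \<in> HH \<Longrightarrow> poly_bounded D (\<lambda>ws. wsize (H (ws ! 0)))"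
  shows "poly_comp HH D (\<lambda>H ws. H (ws ! 0))"
proof (rule poly_compI)
  fix H assume "H \<in> HH"
  then show "poly_bounded D (\<lambda>ws. 1 + isz ws + 2 * wsize (H (ws ! 0)))"
    by (intro poly_bounded_add poly_bounded_mult poly_bounded_const poly_bounded_isz H)
next
  fix H ws assume D: "ws \<in> D"
  have ex: "exec H (Ask 0 0) (init_mem ws) (1 + wsize (ws ! 0) + wsize (H (ws ! 0)))
      ((init_mem ws)(0 := store_word (H (ws ! 0))))"
    using exec.Ask[of "ws ! 0" "init_mem ws" 0 H 0] ne[OF D] by simp
  show "\<exists>t s. exec H (Ask 0 0) (init_mem ws) t s \<and> read_word (s 0) = H (ws ! 0) \<and>
      t + wsize (H (ws ! 0)) \<le> 1 + isz ws + 2 * wsize (H (ws ! 0))"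
    by (intro exI conjI, rule ex) (use wsize_nth_le_isz[of 0 ws] ne[OF D] in auto)
qed

text \<open>The fixed number of arguments guarantees that array \<open>k\<close> is free to serve as
  the loop index of the copy.\<close>

lemma poly_comp_proj:
  assumes len: "\<And>ws. ws \<in> D \<Longrightarrow> length ws = k" and i: "i < k"
  shows "poly_comp HH D (\<lambda>H ws. ws ! i)"
proof (cases "i = 0")
  case True
  show ?thesis
  proof (rule poly_compI[of _ _ "\<lambda>H ws. 1 + isz ws"])
    fix H ws assume D: "ws \<in> D"
    show "\<exists>t s. exec H Skip (init_mem ws) t s \<and> read_word (s 0) = ws ! i \<and> t + wsize (ws ! i) \<le> 1 + isz ws"
      using True exec.Skip[of H "init_mem ws"] len[OF D] i wsize_nth_le_isz[of i ws]
      by (intro exI[of _ 1] exI[of _ "init_mem ws"]) auto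
  qed auto
next
  case False
  obtain C where C: "\<And>H s N. cells_bounded s N \<Longrightarrow> \<exists>t \<le> C * N * Suc (length (read_word (s i))).
      exec H (copy i 0 k) s t (s(0 := store_word (read_word (s i)), k := (\<lambda>_. 0)))"
    using exec_copy[of i 0 k] False i by auto
  show ?thesis
  proof (rule poly_compI[of _ _ "\<lambda>H ws. C * (isz ws + 1) * Suc (isz ws) + isz ws"])
    fix H ws assume D: "ws \<in> D"
    obtain t where t: "t \<le> C * (isz ws + 1) * Suc (length (ws ! i))"
      "exec H (copy i 0 k) (init_mem ws) t ((init_mem ws)(0 := store_word (ws ! i), k := (\<lambda>_. 0)))"
      using C[OF cells_bounded_init[of ws], of H] len[OF D] i by auto
    have w: "wsize (ws ! i) \<le> isz ws" using wsize_nth_le_isz len[OF D] i by simp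
    then have "length (ws ! i) \<le> isz ws" using length_le_wsize le_trans by blast
    then have "C * (isz ws + 1) * Suc (length (ws ! i)) \<le> C * (isz ws + 1) * Suc (isz ws)"
      by (intro mult_left_mono) auto
    then have le: "t + wsize (ws ! i) \<le> C * (isz ws + 1) * Suc (isz ws) + isz ws"
      using t(1) w by linarith
    show "\<exists>t s. exec H (copy i 0 k) (init_mem ws) t s \<and> read_word (s 0) = ws ! i \<and>
        t + wsize (ws ! i) \<le> C * (isz ws + 1) * Suc (isz ws) + isz ws"
      by (intro exI conjI, rule t(2)) (use i le in auto)
  qed (intro poly_bounded_add poly_bounded_mult poly_bounded_Suc poly_bounded_const poly_bounded_isz)
qed


text \<open>The given program may contain questions that were answered by \<open>no_help\<close>;
  silencing it makes the same program correct relative to every \<open>H\<close>.\<close>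

lemma poly_comp_polytime1:
  assumes f: "polytime1 f" and len: "\<And>ws. ws \<in> D \<Longrightarrow> length ws = 1"
  shows "poly_comp HH D (\<lambda>H ws. f (ws ! 0))"
proof -
  obtain c P where c: "\<And>x. runs_within no_help c [x] (f x) P" using f unfolding polytime1_def by blast
  show ?thesis
  proof (rule poly_compI[of _ _ "\<lambda>H ws. poly P (isz ws)" "silence c"])
    fix H ws assume D: "ws \<in> D"
    then obtain x where ws: "ws = [x]" using len[OF D] by (auto simp: length_Suc_conv)
    obtain t s where t: "exec no_help c (init_mem ws) t s" "f x = read_word (s 0)"
      "t + wsize (f x) \<le> poly P (isz ws)"
      using c[of x] unfolding runs_within_def runs_def ws by auto
    obtain t' where t': "t' \<le> t" "exec H (silence c) (init_mem ws) t' s"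
      using exec_silence[OF t(1)] by blast
    have "t' + wsize (f (ws ! 0)) \<le> poly P (isz ws)" using t t' ws by simp
    then show "\<exists>t s. exec H (silence c) (init_mem ws) t s \<and> read_word (s 0) = f (ws ! 0) \<and>
        t + wsize (f (ws ! 0)) \<le> poly P (isz ws)"
      using t(2) t'(2) ws by (intro exI[of _ t'] exI[of _ s]) simp
  qed (intro poly_bounded_poly poly_bounded_isz)
qed

lemma poly_comp_polytime2:
  assumes f: "polytime2 f" and len: "\<And>ws. ws \<in> D \<Longrightarrow> length ws = 2"
  shows "poly_comp HH D (\<lambda>H ws. f (ws ! 0) (ws ! 1))"
proof -
  obtain c P where c: "\<And>x y. runs_within no_help c [x, y] (f x y) P" using f unfolding polytime2_def by blast
  show ?thesis
  proof (rule poly_compI[of _ _ "\<lambda>H ws. poly P (isz ws)" "silence c"])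
    fix H ws assume D: "ws \<in> D"
    then obtain x y where ws: "ws = [x, y]" using len[OF D] by (auto simp: length_Suc_conv numeral_2_eq_2)
    obtain t s where t: "exec no_help c (init_mem ws) t s" "f x y = read_word (s 0)"
      "t + wsize (f x y) \<le> poly P (isz ws)"
      using c[of x y] unfolding runs_within_def runs_def ws by auto
    obtain t' where t': "t' \<le> t" "exec H (silence c) (init_mem ws) t' s"
      using exec_silence[OF t(1)] by blast
    have "t' + wsize (f (ws ! 0) (ws ! 1)) \<le> poly P (isz ws)" using t t' ws by simp
    then show "\<exists>t s. exec H (silence c) (init_mem ws) t s \<and> read_word (s 0) = f (ws ! 0) (ws ! 1) \<and>
        t + wsize (f (ws ! 0) (ws ! 1)) \<le> poly P (isz ws)"
      using t(2) t'(2) ws by (intro exI[of _ t'] exI[of _ s]) simp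
  qed (intro poly_bounded_poly poly_bounded_isz)
qed

lemma poly_comp_runs_within:
  assumes "poly_comp HH D f"
  shows "\<exists>c. \<forall>H \<in> HH. \<exists>P. \<forall>ws \<in> D. runs_within H c ws (f H ws) P"
proof -
  obtain c T where c: "\<And>H. H \<in> HH \<Longrightarrow> poly_bounded D (T H)"
    "\<And>H ws. H \<in> HH \<Longrightarrow> ws \<in> D \<Longrightarrow> \<exists>t \<le> T H ws. runs H c ws (f H ws) t"
    using assms by (rule poly_compE) blast
  have "\<exists>P. \<forall>ws \<in> D. runs_within H c ws (f H ws) P" if H: "H \<in> HH" for H
  proof -
    obtain P where "\<forall>ws \<in> D. T H ws \<le> poly P (isz ws)" using c(1)[OF H] unfolding poly_bounded_def by blast
    then show ?thesis using c(2)[OF H] unfolding runs_within_def by (meson le_trans)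
  qed
  then show ?thesis by blast
qed

lemma polytime2I:
  assumes "poly_comp {no_help} {ws. length ws = 2} (\<lambda>H ws. f (ws ! 0) (ws ! 1))"
  shows "polytime2 f"
proof -
  obtain c P where "\<forall>ws \<in> {ws. length ws = 2}. runs_within no_help c ws (f (ws ! 0) (ws ! 1)) P"
    using poly_comp_runs_within[OF assms] by blast
  then have "runs_within no_help c [x, y] (f ([x, y] ! 0) ([x, y] ! 1)) P" for x y by (rule bspec) simp
  then show ?thesis unfolding polytime2_def by (simp, blast)
qed

section \<open>Composition and loops\<close>

lemma poly_bounded_isz_map:
  assumes "\<And>g. g \<in> set gs \<Longrightarrow> poly_comp HH D g" "H \<in> HH"
  shows "poly_bounded D (\<lambda>ws. isz (map (\<lambda>g. g H ws) gs))"
  using assms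
proof (induction gs)
  case (Cons g gs)
  then show ?case using poly_bounded_add[OF poly_comp_wsize[of HH D g H] Cons.IH] by simp
qed simp

text \<open>The results go one by one into \<open>R\<close> reserved arrays behind the arguments,
  which stay intact, so that each function still sees the original \<open>ws\<close>. Unfilled
  arrays are the empty words of the padding.\<close>

lemma exec_calls:
  assumes len: "\<And>ws. ws \<in> D \<Longrightarrow> length ws = k"
  shows "(\<And>g. g \<in> set gs \<Longrightarrow> poly_comp HH D g) \<Longrightarrow> length gs \<le> R \<Longrightarrow>
    \<exists>c. \<forall>H \<in> HH. \<exists>T. poly_bounded D T \<and> (\<forall>ws \<in> D. \<exists>t \<le> T ws.
      exec H c (init_mem ws) t (init_mem (ws @ map (\<lambda>g. g H ws) gs @ replicate (R - length gs) [])))"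
proof (induction gs rule: rev_induct)
  case Nil
  show ?case
  proof (intro exI[of _ Skip] ballI exI[of _ "\<lambda>_. 1"] conjI)
    fix H ws
    show "\<exists>t \<le> 1. exec H Skip (init_mem ws) t (init_mem (ws @ map (\<lambda>g. g H ws) [] @ replicate (R - length []) []))"
      using exec.Skip[of H "init_mem ws"] init_mem_pad by auto
  qed simp
next
  case (snoc g gs)
  have gs: "g' \<in> set gs \<Longrightarrow> poly_comp HH D g'" for g' using snoc.prems by simp
  obtain c where c: "\<And>H. H \<in> HH \<Longrightarrow> \<exists>T. poly_bounded D T \<and> (\<forall>ws \<in> D. \<exists>t \<le> T ws.
      exec H c (init_mem ws) t (init_mem (ws @ map (\<lambda>g. g H ws) gs @ replicate (R - length gs) [])))"
    using snoc.IH[OF gs] snoc.prems(2) by auto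
  have "poly_comp HH D g" using snoc.prems by simp
  then obtain d U where d: "\<And>H. H \<in> HH \<Longrightarrow> poly_bounded D (U H)"
    "\<And>H ws. H \<in> HH \<Longrightarrow> ws \<in> D \<Longrightarrow> \<exists>t \<le> U H ws. runs H d ws (g H ws) t"
    by (rule poly_compE) blast
  define l where "l = length gs"
  have l: "l < R" using snoc.prems(2) by (simp add: l_def)
  have "\<forall>a \<in> set [0..<k]. a < k + R" "k + l < k + R" using l by auto
  from exec_call[OF this, of d] obtain C where C: "\<And>H vs out t. length vs = k + R \<Longrightarrow> runs H d (map (\<lambda>a. vs ! a) [0..<k]) out t \<Longrightarrow>
    (\<exists>t' \<le> C * (isz vs + t + 1) ^ 2. exec H (call (k + R) [0..<k] d (k + l)) (init_mem vs) t' (init_mem (vs[k + l := out])))"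
    by blast
  show ?case
  proof (rule exI[of _ "Seq c (call (k + R) [0..<k] d (k + l))"], intro ballI)
    fix H assume H: "H \<in> HH"
    obtain T where T: "poly_bounded D T" "\<And>ws. ws \<in> D \<Longrightarrow> \<exists>t \<le> T ws.
      exec H c (init_mem ws) t (init_mem (ws @ map (\<lambda>g. g H ws) gs @ replicate (R - length gs) []))"
      using c[OF H] by blast
    let ?vs = "\<lambda>ws. ws @ map (\<lambda>g. g H ws) gs @ replicate (R - l) []"
    let ?I = "\<lambda>ws. isz ws + isz (map (\<lambda>g. g H ws) gs)"
    let ?T = "\<lambda>ws. 1 + T ws + C * (?I ws + U H ws + 1) ^ 2"
    show "\<exists>T. poly_bounded D T \<and> (\<forall>ws \<in> D. \<exists>t \<le> T ws. exec H (Seq c (call (k + R) [0..<k] d (k + l)))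
        (init_mem ws) t (init_mem (ws @ map (\<lambda>g. g H ws) (gs @ [g]) @ replicate (R - length (gs @ [g])) [])))"
    proof (intro exI[of _ ?T] conjI ballI)
      show "poly_bounded D ?T"
        by (intro poly_bounded_add poly_bounded_mult poly_bounded_power poly_bounded_const poly_bounded_isz
            T(1) d(1)[OF H] poly_bounded_isz_map[OF gs H])
    next
      fix ws assume D: "ws \<in> D"
      obtain t where t: "t \<le> T ws" "exec H c (init_mem ws) t (init_mem (?vs ws))"
        using T(2)[OF D] by (auto simp: l_def)
      obtain u where u: "u \<le> U H ws" "runs H d ws (g H ws) u" using d(2)[OF H D] by blast
      have "map (\<lambda>a. ?vs ws ! a) [0..<k] = ws"
        using len[OF D] by (intro nth_equalityI) (auto simp: nth_append)
      then have run: "runs H d (map (\<lambda>a. ?vs ws ! a) [0..<k]) (g H ws) u" using u(2) by simp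
      have lv: "length (?vs ws) = k + R" using len[OF D] l by (simp add: l_def)
      obtain t' where t': "t' \<le> C * (isz (?vs ws) + u + 1) ^ 2"
        "exec H (call (k + R) [0..<k] d (k + l)) (init_mem (?vs ws)) t' (init_mem ((?vs ws)[k + l := g H ws]))"
        using C[OF lv run] by blast
      have "isz (replicate m []) = 0" for m by (induction m) auto
      then have "isz (?vs ws) = ?I ws" by simp
      then have "isz (?vs ws) + u + 1 \<le> ?I ws + U H ws + 1" using u(1) by linarith
      then have "C * (isz (?vs ws) + u + 1) ^ 2 \<le> C * (?I ws + U H ws + 1) ^ 2"
        by (intro mult_left_mono power_mono) auto
      then have le: "1 + t + t' \<le> ?T ws" using t(1) t'(1) by linarith
      obtain m where m: "R - l = Suc m" using l by (cases "R - l") auto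
      then have m': "R - length (gs @ [g]) = m" by (simp add: l_def)
      have upd: "(?vs ws)[k + l := g H ws] = ws @ map (\<lambda>g. g H ws) (gs @ [g]) @ replicate (R - length (gs @ [g])) []"
        unfolding m' unfolding m using len[OF D] by (simp add: list_update_append l_def)
      show "\<exists>t \<le> ?T ws. exec H (Seq c (call (k + R) [0..<k] d (k + l)))
        (init_mem ws) t (init_mem (ws @ map (\<lambda>g. g H ws) (gs @ [g]) @ replicate (R - length (gs @ [g])) []))"
        using le exec.Seq[OF t(2) t'(2)[unfolded upd]] by blast
    qed
  qed
qed

lemma poly_comp_comp:
  assumes f: "poly_comp HH D' f" and gs: "\<And>g. g \<in> set gs \<Longrightarrow> poly_comp HH D g"
    and D': "\<And>H ws. H \<in> HH \<Longrightarrow> ws \<in> D \<Longrightarrow> map (\<lambda>g. g H ws) gs \<in> D'"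
    and len: "\<And>ws. ws \<in> D \<Longrightarrow> length ws = k"
  shows "poly_comp HH D (\<lambda>H ws. f H (map (\<lambda>g. g H ws) gs))"
proof -
  \<comment> \<open>The spare array guarantees that array 0, which receives the result, belongs to
    the variables even if there are no arguments and no inner functions.\<close>
  define R where "R = Suc (length gs)"
  obtain d U where d: "\<And>H. H \<in> HH \<Longrightarrow> poly_bounded D' (U H)"
    "\<And>H ws. H \<in> HH \<Longrightarrow> ws \<in> D' \<Longrightarrow> \<exists>t \<le> U H ws. runs H d ws (f H ws) t"
    using f by (rule poly_compE) blast
  obtain c where c: "\<forall>H \<in> HH. \<exists>T. poly_bounded D T \<and> (\<forall>ws \<in> D. \<exists>t \<le> T ws.
      exec H c (init_mem ws) t (init_mem (ws @ map (\<lambda>g. g H ws) gs @ replicate (R - length gs) [])))"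
    using exec_calls[OF len gs, of gs R] by (auto simp: R_def)
  obtain T where T: "\<And>H. H \<in> HH \<Longrightarrow> poly_bounded D (T H)" "\<And>H ws. H \<in> HH \<Longrightarrow> ws \<in> D \<Longrightarrow> \<exists>t \<le> T H ws.
      exec H c (init_mem ws) t (init_mem (ws @ map (\<lambda>g. g H ws) gs @ [[]]))"
    using bchoice[OF c] by (auto simp: R_def)
  have "\<forall>a \<in> set [k..<k + length gs]. a < k + R" "0 < k + R" by (auto simp: R_def)
  from exec_call[OF this, of d] obtain C where C:
    "\<And>H vs out t. length vs = k + R \<Longrightarrow> runs H d (map (\<lambda>a. vs ! a) [k..<k + length gs]) out t \<Longrightarrow>
    (\<exists>t' \<le> C * (isz vs + t + 1) ^ 2. exec H (call (k + R) [k..<k + length gs] d 0) (init_mem vs) t' (init_mem (vs[0 := out])))"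
    by blast
  \<comment> \<open>The bound for \<open>f\<close> speaks of its own arguments in \<open>D'\<close>.
    Its polynomial, applied to their polynomially bounded sizes, turns it into a bound on
    \<open>D\<close>.\<close>
  have "\<forall>H \<in> HH. \<exists>P. \<forall>ws \<in> D'. U H ws \<le> poly P (isz ws)" using d(1) by (auto simp: poly_bounded_def)
  from bchoice[OF this] obtain P where P: "\<And>H ws. H \<in> HH \<Longrightarrow> ws \<in> D' \<Longrightarrow> U H ws \<le> poly (P H) (isz ws)" by blast
  let ?args = "\<lambda>H ws. map (\<lambda>g. g H ws) gs"
  let ?T = "\<lambda>H ws. 1 + T H ws + C * (isz ws + isz (?args H ws) + poly (P H) (isz (?args H ws)) + 1) ^ 2
    + poly (P H) (isz (?args H ws))"
  show ?thesis
  proof (rule poly_compI[of _ _ ?T])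
    fix H assume H: "H \<in> HH"
    show "poly_bounded D (?T H)"
      by (intro poly_bounded_add poly_bounded_mult poly_bounded_power poly_bounded_const poly_bounded_isz
          T(1) H poly_bounded_poly poly_bounded_isz_map[OF gs H])
  next
    fix H ws assume H: "H \<in> HH" and D: "ws \<in> D"
    let ?vs = "ws @ ?args H ws @ [[]]"
    obtain t where t: "t \<le> T H ws" "exec H c (init_mem ws) t (init_mem ?vs)"
      using T(2)[OF H D] by blast
    have args: "?args H ws \<in> D'" by (rule D'[OF H D])
    obtain u where u: "u \<le> U H (?args H ws)" "runs H d (?args H ws) (f H (?args H ws)) u"
      using d(2)[OF H args] by blast
    have "map (\<lambda>a. ?vs ! a) [k..<k + length gs] = ?args H ws"
      using len[OF D] by (intro nth_equalityI) (auto simp: nth_append)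
    then have run: "runs H d (map (\<lambda>a. ?vs ! a) [k..<k + length gs]) (f H (?args H ws)) u" using u(2) by simp
    have lv: "length ?vs = k + R" using len[OF D] by (simp add: R_def)
    obtain t' where t': "t' \<le> C * (isz ?vs + u + 1) ^ 2"
      "exec H (call (k + R) [k..<k + length gs] d 0) (init_mem ?vs) t' (init_mem (?vs[0 := f H (?args H ws)]))"
      using C[OF lv run] by blast
    have uP: "u \<le> poly (P H) (isz (?args H ws))" using u(1) P[OF H args] by linarith
    have iv: "isz ?vs = isz ws + isz (?args H ws)" by simp
    have "C * (isz ?vs + u + 1) ^ 2 \<le> C * (isz ws + isz (?args H ws) + poly (P H) (isz (?args H ws)) + 1) ^ 2"
      unfolding iv using uP by (intro mult_left_mono power_mono) auto
    moreover have "wsize (f H (?args H ws)) \<le> u" using u(2) unfolding runs_def by auto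
    ultimately have le: "1 + t + t' + wsize (f H (?args H ws)) \<le> ?T H ws" using t(1) t'(1) uP by linarith
    show "\<exists>t s. exec H (Seq c (call (k + R) [k..<k + length gs] d 0)) (init_mem ws) t s \<and>
      read_word (s 0) = f H (?args H ws) \<and> t + wsize (f H (?args H ws)) \<le> ?T H ws"
    proof (intro exI conjI)
      show "exec H (Seq c (call (k + R) [k..<k + length gs] d 0)) (init_mem ws) (1 + t + t')
          (init_mem (?vs[0 := f H (?args H ws)]))"
        by (rule exec.Seq[OF t(2) t'(2)])
      show "read_word (init_mem (?vs[0 := f H (?args H ws)]) 0) = f H (?args H ws)"
        by (subst init_mem_nth) auto
      show "1 + t + t' + wsize (f H (?args H ws)) \<le> ?T H ws" by (rule le)
    qed
  qed
qed

primrec loop_state :: "(word list \<Rightarrow> word) \<Rightarrow> word list \<Rightarrow> word \<Rightarrow> nat \<Rightarrow> word" where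
  "loop_state g ws a 0 = a"
| "loop_state g ws a (Suc j) = g (ws @ [loop_state g ws a j, [int j]])"

text \<open>The decisive assumption is the bound \<open>M\<close> on the accumulator in all rounds:
  without it the iteration of a polynomial-time step could grow exponentially. The program stops by
  testing \<open>e\<close>; the number \<open>n\<close> of rounds occurs only in the analysis, so it
  may itself be what the loop is meant to find.\<close>

lemma poly_comp_loop:
  assumes len: "\<And>ws. ws \<in> D \<Longrightarrow> length ws = k" and k: "0 < k"
    and init: "poly_comp HH D init"
    and g: "poly_comp HH D' g"
    and step: "\<And>H ws j. H \<in> HH \<Longrightarrow> ws \<in> D \<Longrightarrow> j < n H ws \<Longrightarrow>
      ws @ [loop_state (g H) ws (init H ws) j, [int j]] \<in> D' \<and>
      eval e (init_mem (ws @ [loop_state (g H) ws (init H ws) j, [int j]])) > 0"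
    and stop: "\<And>H ws. H \<in> HH \<Longrightarrow> ws \<in> D \<Longrightarrow>
      \<not> eval e (init_mem (ws @ [loop_state (g H) ws (init H ws) (n H ws), [int (n H ws)]])) > 0"
    and n: "\<And>H. H \<in> HH \<Longrightarrow> poly_bounded D (n H)"
    and M: "\<And>H. H \<in> HH \<Longrightarrow> poly_bounded D (M H)"
      "\<And>H ws j. H \<in> HH \<Longrightarrow> ws \<in> D \<Longrightarrow> j \<le> n H ws \<Longrightarrow> wsize (loop_state (g H) ws (init H ws) j) \<le> M H ws"
  shows "poly_comp HH D (\<lambda>H ws. loop_state (g H) ws (init H ws) (n H ws))"
proof -
  define K where "K = k + 2"
  obtain ci Ti where ci: "\<And>H. H \<in> HH \<Longrightarrow> poly_bounded D (Ti H)"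
    "\<And>H ws. H \<in> HH \<Longrightarrow> ws \<in> D \<Longrightarrow> \<exists>t \<le> Ti H ws. runs H ci ws (init H ws) t"
    using init by (rule poly_compE) blast
  obtain cg Tg where cg: "\<And>H. H \<in> HH \<Longrightarrow> poly_bounded D' (Tg H)"
    "\<And>H ws. H \<in> HH \<Longrightarrow> ws \<in> D' \<Longrightarrow> \<exists>t \<le> Tg H ws. runs H cg ws (g H ws) t"
    using g by (rule poly_compE) blast
  have "\<forall>H \<in> HH. \<exists>P. \<forall>ws \<in> D'. Tg H ws \<le> poly P (isz ws)" using cg(1) by (auto simp: poly_bounded_def)
  from bchoice[OF this] obtain P where P: "\<And>H ws. H \<in> HH \<Longrightarrow> ws \<in> D' \<Longrightarrow> Tg H ws \<le> poly (P H) (isz ws)" by blast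
  have "\<forall>a \<in> set [0..<k]. a < K" "k < K" by (auto simp: K_def)
  from exec_call[OF this, of ci] obtain Ci where Ci:
    "\<And>H vs out t. length vs = K \<Longrightarrow> runs H ci (map (\<lambda>a. vs ! a) [0..<k]) out t \<Longrightarrow>
    (\<exists>t' \<le> Ci * (isz vs + t + 1) ^ 2. exec H (call K [0..<k] ci k) (init_mem vs) t' (init_mem (vs[k := out])))"
    by blast
  have "\<forall>a \<in> set [0..<K]. a < K" "k < K" by (auto simp: K_def)
  from exec_call[OF this, of cg] obtain Cg where Cg:
    "\<And>H vs out t. length vs = K \<Longrightarrow> runs H cg (map (\<lambda>a. vs ! a) [0..<K]) out t \<Longrightarrow>
    (\<exists>t' \<le> Cg * (isz vs + t + 1) ^ 2. exec H (call K [0..<K] cg k) (init_mem vs) t' (init_mem (vs[k := out])))"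
    by blast
  let ?inc = "Add (Cell (k + 1) (Const 1)) (Const 1)"
  obtain Ce where Ce: "\<forall>e' \<in> set [e, ?inc]. \<forall>s N. cells_bounded s N \<longrightarrow> cost e' s \<le> Ce * N \<and> isize (eval e' s) \<le> Ce * N"
    using costs_linear by blast
  have Ce': "cost e s \<le> Ce * N" "cost ?inc s \<le> Ce * N" if "cells_bounded s N" for s N
    using Ce that by (auto simp del: cost.simps)
  have "k \<noteq> 0" "K \<noteq> k" "K \<noteq> 0" using k by (auto simp: K_def)
  from exec_copy[OF this] obtain Cc where Cc: "\<And>H s N. cells_bounded s N \<Longrightarrow>
    (\<exists>t \<le> Cc * N * Suc (length (read_word (s k))).
      exec H (copy k 0 K) s t (s(0 := store_word (read_word (s k)), K := (\<lambda>_. 0))))" by blast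
  let ?body = "Seq (call K [0..<K] cg k) (Store (k + 1) (Const 1) ?inc)"
  let ?prog = "Seq (call K [0..<k] ci k) (Seq (Store (k + 1) (Const 0) (Const 1)) (Seq (While e ?body) (copy k 0 K)))"
  \<comment> \<open>Bounds the arguments, the accumulator and the counter together in every round;
    the counter contributes at most n + 1.\<close>
  define W where "W H ws = isz ws + M H ws + n H ws + 1" for H ws
  define B where "B H ws = 1 + Cg * (W H ws + poly (P H) (W H ws) + 1) ^ 2 + (1 + isize 1 + Ce * (W H ws + 1))" for H ws
  define T where "T H ws = 1 + Ci * (isz ws + Ti H ws + 1) ^ 2 + (1 + (1 + isize 0 + isize 1) +
     (1 + Suc (n H ws) * (1 + Ce * (W H ws + 1) + B H ws) + Cc * (W H ws + 1) * Suc (W H ws))) + M H ws" for H ws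
  show ?thesis
  proof (rule poly_compI[of _ _ T ?prog])
    fix H assume H: "H \<in> HH"
    have W: "poly_bounded D (W H)" unfolding W_def
      by (intro poly_bounded_add poly_bounded_const poly_bounded_isz n[OF H] M(1)[OF H])
    have B: "poly_bounded D (B H)" unfolding B_def
      by (intro poly_bounded_add poly_bounded_mult poly_bounded_power poly_bounded_const poly_bounded_poly W)
    show "poly_bounded D (T H)" unfolding T_def
      by (intro poly_bounded_add poly_bounded_mult poly_bounded_power poly_bounded_const poly_bounded_isz
          poly_bounded_Suc W B n[OF H] M(1)[OF H] ci(1)[OF H])
  next
    fix H ws assume H: "H \<in> HH" and D: "ws \<in> D"
    define acc where "acc = loop_state (g H) ws (init H ws)"
    define N where "N = n H ws"
    define w where "w = W H ws"
    have lw: "length ws = k" using len[OF D] .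
    have accS: "acc (Suc j) = g H (ws @ [acc j, [int j]])" for j by (simp add: acc_def)
    have accM: "wsize (acc j) \<le> M H ws" if "j \<le> N" for j using M(2)[OF H D] that by (simp add: acc_def N_def)
    have sz: "isz (ws @ [acc i, [int j]]) \<le> w" if "i \<le> N" "j \<le> N" for i j
      using accM[OF that(1)] isize_int_le[of j] that(2) by (simp add: w_def W_def N_def)
    have cb: "cells_bounded (init_mem (ws @ [acc i, [int j]])) (w + 1)" if "i \<le> N" "j \<le> N" for i j
      using cells_bounded_mono[OF cells_bounded_init] sz[OF that] by simp
    obtain u where u: "u \<le> Ti H ws" "runs H ci ws (init H ws) u" using ci(2)[OF H D] by blast
    define vs0 :: "word list" where "vs0 = ws @ [[], []]"
    have vs0: "init_mem vs0 = init_mem ws" "length vs0 = K" "isz vs0 = isz ws" "map (\<lambda>a. vs0 ! a) [0..<k] = ws"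
      using init_mem_pad[of ws 2] lw unfolding vs0_def
      by (auto simp: K_def numeral_2_eq_2 nth_append intro!: nth_equalityI)
    have run0: "runs H ci (map (\<lambda>a. vs0 ! a) [0..<k]) (init H ws) u" using u(2) vs0(4) by simp
    have "vs0[k := init H ws] = ws @ [acc 0, []]"
      using lw by (simp add: vs0_def list_update_append acc_def)
    then obtain t1 where t1: "t1 \<le> Ci * (isz ws + u + 1) ^ 2"
      "exec H (call K [0..<k] ci k) (init_mem ws) t1 (init_mem (ws @ [acc 0, []]))"
      using Ci[OF vs0(2) run0] vs0(1,3) by auto
    have upd: "init_mem (ws @ [a, b']) = (init_mem (ws @ [a, b]))(k + 1 := store_word b')" for a b b'
      using init_mem_update[of "k + 1" "ws @ [a, b]" b'] lw by (simp add: list_update_append)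
    have ex2: "exec H (Store (k + 1) (Const 0) (Const 1)) (init_mem (ws @ [acc 0, []]))
        (1 + isize 0 + isize 1) (init_mem (ws @ [acc 0, [int 0]]))"
    proof -
      have "(\<lambda>_. 0)(0 := 1) = store_word [0]"
        by (auto simp: store_word_def fun_eq_iff)
      then have "init_mem (ws @ [acc 0, [int 0]]) = (init_mem (ws @ [acc 0, []]))(k + 1 :=
          (init_mem (ws @ [acc 0, []]) (k + 1))(eval (Const 0) (init_mem (ws @ [acc 0, []])) := eval (Const 1) (init_mem (ws @ [acc 0, []]))))"
        using lw by (subst upd[of "acc 0" _ "[]"]) (simp add: nth_append)
      from exec_Store[OF this] show ?thesis by simp
    qed
    have "\<exists>t \<le> Suc N * (1 + Ce * (w + 1) + B H ws). exec H (While e ?body)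
      (init_mem (ws @ [acc 0, [int 0]])) t (init_mem (ws @ [acc N, [int N]]))"
    proof (rule exec_While_iterate)
      fix j assume "j \<le> N"
      then show "cost e (init_mem (ws @ [acc j, [int j]])) \<le> Ce * (w + 1)" by (intro Ce' cb)
    next
      show "\<not> eval e (init_mem (ws @ [acc N, [int N]])) > 0" using stop[OF H D] by (simp add: acc_def N_def)
    next
      fix j assume j: "j < N"
      have D': "ws @ [acc j, [int j]] \<in> D'" and pos: "eval e (init_mem (ws @ [acc j, [int j]])) > 0"
        using step[OF H D] j by (auto simp: acc_def N_def)
      obtain v where v: "v \<le> Tg H (ws @ [acc j, [int j]])" "runs H cg (ws @ [acc j, [int j]]) (acc (Suc j)) v"
        using cg(2)[OF H D'] unfolding accS by blast
      let ?vs = "ws @ [acc j, [int j]]"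
      have lv: "length ?vs = K" using lw by (simp add: K_def)
      have "map (\<lambda>a. ?vs ! a) [0..<K] = ?vs" using lv map_nth[of ?vs] by simp
      then have run: "runs H cg (map (\<lambda>a. ?vs ! a) [0..<K]) (acc (Suc j)) v" using v(2) by simp
      have "?vs[k := acc (Suc j)] = ws @ [acc (Suc j), [int j]]" using lw by (simp add: list_update_append)
      then obtain t where t: "t \<le> Cg * (isz ?vs + v + 1) ^ 2"
        "exec H (call K [0..<K] cg k) (init_mem ?vs) t (init_mem (ws @ [acc (Suc j), [int j]]))"
        using Cg[OF lv run] by auto
      let ?s = "init_mem (ws @ [acc (Suc j), [int j]])"
      have ex3: "exec H (Store (k + 1) (Const 1) ?inc) ?s (1 + cost (Const 1) ?s + cost ?inc ?s)
          (init_mem (ws @ [acc (Suc j), [int (Suc j)]]))"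
      proof (rule exec_Store)
        have "(store_word [int j])(1 := int j + 1) = store_word [int (Suc j)]"
          by (subst store_word_update) (auto simp: add.commute)
        then show "init_mem (ws @ [acc (Suc j), [int (Suc j)]]) = ?s(k + 1 := (?s (k + 1))(eval (Const 1) ?s := eval ?inc ?s))"
          using lw by (subst upd[of _ _ "[int j]"]) (simp add: nth_append)
      qed
      have "poly (P H) (isz ?vs) \<le> poly (P H) w" using sz[of j j] j by (intro poly_nat_mono) auto
      then have "v \<le> poly (P H) w" using v(1) P[OF H D'] by linarith
      then have "Cg * (isz ?vs + v + 1) ^ 2 \<le> Cg * (w + poly (P H) w + 1) ^ 2"
        using sz[of j j] j by (intro mult_left_mono power_mono) auto
      with t(1) have tB: "t \<le> Cg * (w + poly (P H) w + 1) ^ 2" by (rule le_trans)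
      have "cost ?inc ?s \<le> Ce * (w + 1)" using j by (intro Ce' cb) auto
      with tB have "1 + t + (1 + cost (Const 1) ?s + cost ?inc ?s) \<le> B H ws"
        unfolding B_def w_def[symmetric] cost.simps(1) by (intro add_mono order_refl)
      then show "eval e (init_mem ?vs) > 0 \<and> (\<exists>t \<le> B H ws. exec H ?body (init_mem ?vs) t (init_mem (ws @ [acc (Suc j), [int (Suc j)]])))"
        using pos exec.Seq[OF t(2) ex3] by blast
    qed
    then obtain t2 where t2: "t2 \<le> Suc N * (1 + Ce * (w + 1) + B H ws)" "exec H (While e ?body)
      (init_mem (ws @ [acc 0, [int 0]])) t2 (init_mem (ws @ [acc N, [int N]]))" by blast
    let ?f = "init_mem (ws @ [acc N, [int N]])"
    have fk: "?f k = store_word (acc N)" using lw by (simp add: nth_append)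
    obtain t3 where t3: "t3 \<le> Cc * (w + 1) * Suc (length (acc N))"
      "exec H (copy k 0 K) ?f t3 (?f(0 := store_word (acc N), K := (\<lambda>_. 0)))"
      using Cc[OF cb[of N N], of H] unfolding fk read_store_word by blast
    have "length (acc N) \<le> w" using length_le_wsize[of "acc N"] accM[of N] by (simp add: w_def W_def)
    then have "Cc * (w + 1) * Suc (length (acc N)) \<le> Cc * (w + 1) * Suc w" by (intro mult_left_mono) auto
    then have t3': "t3 \<le> Cc * (w + 1) * Suc w" using t3(1) by linarith
    have "Ci * (isz ws + u + 1) ^ 2 \<le> Ci * (isz ws + Ti H ws + 1) ^ 2"
      using u(1) by (intro mult_left_mono power_mono) auto
    then have t1': "t1 \<le> Ci * (isz ws + Ti H ws + 1) ^ 2" using t1(1) by linarith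
    have sum: "1 + a + (1 + b + (1 + c + d)) + m \<le> 1 + a' + (1 + b + (1 + c' + d')) + m'"
      if "a \<le> a'" "c \<le> c'" "d \<le> d'" "m \<le> m'" for a b c d m a' c' d' m' :: nat using that by simp
    have le: "1 + t1 + (1 + (1 + isize 0 + isize 1) + (1 + t2 + t3)) + wsize (acc N) \<le> T H ws"
      unfolding T_def w_def[symmetric] N_def[symmetric]
      by (rule sum[OF t1' t2(1) t3' accM]) simp
    have ex: "exec H ?prog (init_mem ws) (1 + t1 + (1 + (1 + isize 0 + isize 1) + (1 + t2 + t3)))
        (?f(0 := store_word (acc N), K := (\<lambda>_. 0)))"
      by (rule exec.Seq[OF t1(2) exec.Seq[OF ex2 exec.Seq[OF t2(2) t3(2)]]])
    have rd: "read_word ((?f(0 := store_word (acc N), K := (\<lambda>_. 0))) 0) = acc N"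
      by (simp add: K_def)
    show "\<exists>t s. exec H ?prog (init_mem ws) t s \<and> read_word (s 0) = loop_state (g H) ws (init H ws) (n H ws) \<and>
        t + wsize (loop_state (g H) ws (init H ws) (n H ws)) \<le> T H ws"
      unfolding acc_def[symmetric] N_def[symmetric]
      by (intro exI conjI, rule ex, rule rd, rule le)
  qed
qed


section \<open>Combinators for argument lists of fixed length\<close>

definition arity :: "nat \<Rightarrow> word list set \<Rightarrow> bool" where
  "arity k D \<longleftrightarrow> (\<forall>ws \<in> D. length ws = k)"

abbreviation args :: "nat \<Rightarrow> word list set" where
  "args k \<equiv> {ws. length ws = k}"

lemma arityD: "arity k D \<Longrightarrow> ws \<in> D \<Longrightarrow> length ws = k"
  by (simp add: arity_def)

lemma arity_args [simp]: "arity k (args k)"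
  by (simp add: arity_def)

lemma poly_comp_nth: "arity k D \<Longrightarrow> i < k \<Longrightarrow> poly_comp HH D (\<lambda>H ws. ws ! i)"
  by (rule poly_comp_proj) (auto dest: arityD)

lemma poly_comp_call:
  assumes "poly_comp HH D' f" "arity k D" "\<And>g. g \<in> set gs \<Longrightarrow> poly_comp HH D g"
    and "\<And>H ws. H \<in> HH \<Longrightarrow> ws \<in> D \<Longrightarrow> map (\<lambda>g. g H ws) gs \<in> D'"
  shows "poly_comp HH D (\<lambda>H ws. f H (map (\<lambda>g. g H ws) gs))"
  by (rule poly_comp_comp[OF assms(1,3,4) arityD[OF assms(2)]])

lemma poly_comp_reindex:
  assumes f: "poly_comp HH D' f" and D: "arity k D" "\<forall>i \<in> set ii. i < k"
    and D': "\<And>ws. ws \<in> D \<Longrightarrow> map (\<lambda>i. ws ! i) ii \<in> D'"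
  shows "poly_comp HH D (\<lambda>H ws. f H (map (\<lambda>i. ws ! i) ii))"
  using poly_comp_call[OF f D(1), of "map (\<lambda>i H ws. ws ! i) ii"] D poly_comp_nth[OF D(1)] D'
  by (auto simp: comp_def)

lemma poly_comp_scalars:
  assumes "arity k D" "\<And>g. g \<in> set gs \<Longrightarrow> poly_comp HH D g"
  shows "poly_comp HH D (\<lambda>H ws. [eval e (init_mem (map (\<lambda>g. g H ws) gs))])"
  using poly_comp_call[OF poly_comp_scalar[of HH UNIV e] assms] by simp

lemma poly_comp_int: "poly_comp HH D (\<lambda>H ws. [c])"
  using poly_comp_scalar[of HH D "Const c"] by simp

lemma poly_comp_read:
  assumes "arity k D" "poly_comp HH D f" "poly_comp HH D (\<lambda>H ws. [i H ws])"
  shows "poly_comp HH D (\<lambda>H ws. [store_word (f H ws) (i H ws)])"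
  using poly_comp_scalars[OF assms(1), of "[f, \<lambda>H ws. [i H ws]]" HH "Cell 0 (Cell 1 (Const 1))"] assms(2,3)
  by (auto simp: init_mem_def)

lemma poly_comp_length:
  assumes "arity k D" "poly_comp HH D f"
  shows "poly_comp HH D (\<lambda>H ws. [int (length (f H ws))])"
  using poly_comp_read[OF assms poly_comp_int[of HH D 0]] by simp

lemma poly_comp_scalar_nth:
  assumes "arity k D" "i < k"
  shows "poly_comp HH D (\<lambda>H ws. [store_word (ws ! i) 1])"
  by (intro poly_comp_read[OF assms(1)] poly_comp_nth[OF assms] poly_comp_int)

lemma poly_comp_arith:
  assumes "arity k D" "poly_comp HH D (\<lambda>H ws. [x H ws])" "poly_comp HH D (\<lambda>H ws. [y H ws])"
  shows poly_comp_add: "poly_comp HH D (\<lambda>H ws. [x H ws + y H ws])"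
    and poly_comp_diff: "poly_comp HH D (\<lambda>H ws. [x H ws - y H ws])"
    and poly_comp_mult: "poly_comp HH D (\<lambda>H ws. [x H ws * y H ws])"
    and poly_comp_div: "poly_comp HH D (\<lambda>H ws. [x H ws div y H ws])"
proof -
  note c = poly_comp_scalars[OF assms(1), of "[\<lambda>H ws. [x H ws], \<lambda>H ws. [y H ws]]" HH]
  let ?x = "Cell 0 (Const 1)" and ?y = "Cell 1 (Const 1)"
  show "poly_comp HH D (\<lambda>H ws. [x H ws + y H ws])"
    using c[of "Add ?x ?y"] assms(2,3) by (auto simp: init_mem_def)
  show "poly_comp HH D (\<lambda>H ws. [x H ws - y H ws])"
    using c[of "Sub ?x ?y"] assms(2,3) by (auto simp: init_mem_def)
  show "poly_comp HH D (\<lambda>H ws. [x H ws * y H ws])"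
    using c[of "Mul ?x ?y"] assms(2,3) by (auto simp: init_mem_def)
  show "poly_comp HH D (\<lambda>H ws. [x H ws div y H ws])"
    using c[of "Div ?x ?y"] assms(2,3) by (auto simp: init_mem_def)
qed

lemma poly_comp_mod:
  assumes "arity k D" "poly_comp HH D (\<lambda>H ws. [x H ws])" "poly_comp HH D (\<lambda>H ws. [y H ws])"
  shows "poly_comp HH D (\<lambda>H ws. [x H ws mod y H ws])"
proof -
  have "poly_comp HH D (\<lambda>H ws. [x H ws - y H ws * (x H ws div y H ws)])"
    by (intro poly_comp_diff[OF assms(1)] poly_comp_mult[OF assms(1)] poly_comp_div[OF assms(1)] assms)
  then show ?thesis by (simp add: minus_mult_div_eq_mod)
qed

text \<open>In contrast to \<open>poly_comp_if\<close> the condition is computed by a program, and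
  both branches are computed before the choice, so each has to be computable on all of
  \<open>D\<close>.\<close>

lemma poly_comp_cond:
  assumes D: "arity k D" and c: "poly_comp HH D (\<lambda>H ws. [c H ws])" and f: "poly_comp HH D f" and g: "poly_comp HH D g"
  shows "poly_comp HH D (\<lambda>H ws. if c H ws > 0 then f H ws else g H ws)"
proof -
  have ar: "arity 3 (args 3)" "arity 3 {ws \<in> args 3. P ws}" for P by (auto simp: arity_def)
  have "poly_comp HH (args 3) (\<lambda>H ws. if eval (Cell 0 (Const 1)) (init_mem ws) > 0 then ws ! 1 else ws ! 2)"
    by (intro poly_comp_if poly_comp_nth[OF ar(2)]) auto
  from poly_comp_call[OF this D, of "[\<lambda>H ws. [c H ws], f, g]"] c f g
  have "poly_comp HH D (\<lambda>H ws. let vs = map (\<lambda>g. g H ws) [\<lambda>H ws. [c H ws], f, g] in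
      if eval (Cell 0 (Const 1)) (init_mem vs) > 0 then vs ! 1 else vs ! 2)"
    unfolding Let_def by (simp only: set_simps insert_iff empty_iff) (auto simp: init_mem_def)
  then show ?thesis by (rule poly_comp_cong[rotated]) (simp add: init_mem_def)
qed

lemma poly_comp_cond_scalar:
  assumes "arity k D" "poly_comp HH D (\<lambda>H ws. [c H ws])"
    "poly_comp HH D (\<lambda>H ws. [x H ws])" "poly_comp HH D (\<lambda>H ws. [y H ws])"
  shows "poly_comp HH D (\<lambda>H ws. [if c H ws > 0 then x H ws else y H ws])"
  using poly_comp_cond[OF assms] by (rule poly_comp_cong[rotated]) auto

lemma poly_comp_append1:
  assumes D: "arity k D" and f: "poly_comp HH D f" and x: "poly_comp HH D (\<lambda>H ws. [x H ws])"
  shows "poly_comp HH D (\<lambda>H ws. f H ws @ [x H ws])"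
proof -
  have "poly_comp HH (args 2) (\<lambda>H ws. ws ! 0 @ [eval (Cell 1 (Const 1)) (init_mem ws)])"
    by (rule poly_comp_snoc) auto
  from poly_comp_call[OF this D, of "[f, \<lambda>H ws. [x H ws]]"] f x show ?thesis
    by (auto simp: init_mem_def)
qed

lemma poly_comp_list_update:
  assumes D: "arity k D" and f: "poly_comp HH D f" and x: "poly_comp HH D (\<lambda>H ws. [x H ws])"
    and i: "poly_comp HH D (\<lambda>H ws. [int (i H ws)])"
    and less: "\<And>H ws. H \<in> HH \<Longrightarrow> ws \<in> D \<Longrightarrow> i H ws < length (f H ws)"
  shows "poly_comp HH D (\<lambda>H ws. (f H ws)[i H ws := x H ws])"
proof -
  let ?D = "{[w, [int j], v] | w j v. j < length w}"
  let ?e = "Add (Cell 1 (Const 1)) (Const 1)"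
  have "poly_comp HH ?D (\<lambda>H ws. (ws ! 0)[nat (eval ?e (init_mem ws) - 1) := eval (Cell 2 (Const 1)) (init_mem ws)])"
    by (rule poly_comp_update) (auto simp: init_mem_def)
  from poly_comp_call[OF this D, of "[f, \<lambda>H ws. [int (i H ws)], \<lambda>H ws. [x H ws]]"] f x i less show ?thesis
    by (auto simp: init_mem_def)
qed

lemma poly_comp_Nil: "poly_comp HH D (\<lambda>H ws. [])"
proof (rule poly_compI[of _ _ "\<lambda>_ _. 1" "Clear 0"])
  fix H ws
  show "\<exists>t s. exec H (Clear 0) (init_mem ws) t s \<and> read_word (s 0) = [] \<and> t + wsize [] \<le> 1"
    by (intro exI conjI, rule exec.Clear) (auto simp: read_word_def)
qed simp

lemma poly_comp_const:
  assumes "arity k D"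
  shows "poly_comp HH D (\<lambda>H ws. w)"
  by (induction w rule: rev_induct)
    (simp_all add: poly_comp_Nil poly_comp_append1[OF assms] poly_comp_int)

text \<open>Obtained from \<open>poly_comp_loop\<close> by passing the number of rounds as one more
  argument, with which the guard compares the counter. The primed functions skip this argument, so
  the loop runs through the same states.\<close>

lemma poly_comp_for:
  assumes D: "arity k D" and k: "0 < k"
    and init: "poly_comp HH D init" and g: "poly_comp HH D' g"
    and N: "poly_comp HH D (\<lambda>H ws. [int (N ws)])" "poly_bounded D N"
    and step: "\<And>H ws j. H \<in> HH \<Longrightarrow> ws \<in> D \<Longrightarrow> j < N ws \<Longrightarrow> ws @ [loop_state (g H) ws (init H ws) j, [int j]] \<in> D'"
    and M: "\<And>H. H \<in> HH \<Longrightarrow> poly_bounded D (M H)"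
      "\<And>H ws j. H \<in> HH \<Longrightarrow> ws \<in> D \<Longrightarrow> j \<le> N ws \<Longrightarrow> wsize (loop_state (g H) ws (init H ws) j) \<le> M H ws"
  shows "poly_comp HH D (\<lambda>H ws. loop_state (g H) ws (init H ws) (N ws))"
proof -
  define Dn where "Dn = (\<lambda>ws. ws @ [[int (N ws)]]) ` D"
  define D2 where "D2 = {ws @ [[int (N ws)], a, [int j]] | ws a j. ws \<in> D \<and> ws @ [a, [int j]] \<in> D'}"
  have ar: "arity (k + 1) Dn" "arity (k + 3) D2" using D by (auto simp: arity_def Dn_def D2_def)
  let ?i1 = "[0..<k]" and ?i2 = "[0..<k] @ [k + 1, k + 2]"
  have i1: "map (\<lambda>i. (ws @ vs) ! i) ?i1 = ws" if "ws \<in> D" for ws vs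
    using arityD[OF D that] by (intro nth_equalityI) (auto simp: nth_append)
  have i2: "map (\<lambda>i. (ws @ [b, a, c]) ! i) ?i2 = ws @ [a, c]" if "ws \<in> D" for ws a b c
    using arityD[OF D that] i1[OF that] by (simp add: nth_append)
  define init' where "init' = (\<lambda>H vs. init H (map (\<lambda>i. vs ! i) ?i1))"
  define g' where "g' = (\<lambda>H vs. g H (map (\<lambda>i. vs ! i) ?i2))"
  have init': "poly_comp HH Dn init'" unfolding init'_def
    using i1 by (intro poly_comp_reindex[OF init ar(1)]) (auto simp: Dn_def)
  have g': "poly_comp HH D2 g'" unfolding g'_def
    by (rule poly_comp_reindex[OF g ar(2)]) (use i2 in \<open>auto simp: D2_def\<close>)
  have eq: "loop_state (g' H) (ws @ [[int (N ws)]]) (init' H (ws @ [[int (N ws)]])) j = loop_state (g H) ws (init H ws) j"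
    if "ws \<in> D" for H ws j
  proof (induction j)
    case 0
    then show ?case using i1[OF that] by (simp add: init'_def)
  next
    case (Suc j)
    then show ?case using i2[OF that] by (simp add: g'_def)
  qed
  define N' where "N' = (\<lambda>vs. N (map (\<lambda>i. vs ! i) ?i1))"
  have N': "N' (ws @ vs) = N ws" if "ws \<in> D" for ws vs unfolding N'_def i1[OF that] ..
  have bd: "poly_bounded Dn (\<lambda>vs. f (map (\<lambda>i. vs ! i) ?i1))" if bf: "poly_bounded D f" for f
  proof -
    obtain P where P: "\<forall>ws \<in> D. f ws \<le> poly P (isz ws)" using bf unfolding poly_bounded_def by blast
    show ?thesis
    proof (rule poly_boundedI)
      fix vs assume "vs \<in> Dn"
      then obtain ws where ws: "ws \<in> D" "vs = ws @ [[int (N ws)]]" by (auto simp: Dn_def)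
      have "f ws \<le> poly P (isz ws)" using P ws by blast
      also have "\<dots> \<le> poly P (isz vs)" unfolding ws(2) by (rule poly_nat_mono) simp
      finally show "f (map (\<lambda>i. vs ! i) ?i1) \<le> poly P (isz vs)" using i1[OF ws(1)] ws(2) by simp
    qed
  qed
  \<comment> \<open>Array \<open>k\<close> holds the number of rounds, \<open>k + 1\<close> the
    accumulator and \<open>k + 2\<close> the counter.\<close>
  let ?e = "Sub (Cell k (Const 1)) (Cell (k + 2) (Const 1))"
  have ev: "eval ?e (init_mem ((ws @ [[x]]) @ [a, [int j]])) = x - int j" if "ws \<in> D" for ws x a j
    using arityD[OF D that] by (simp add: init_mem_def nth_append)
  have lp: "poly_comp HH Dn (\<lambda>H vs. loop_state (g' H) vs (init' H vs) (N' vs))"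
  proof (rule poly_comp_loop[OF _ _ init' g'])
    show "length ws = k + 1" if "ws \<in> Dn" for ws using arityD[OF ar(1) that] .
    show "0 < k + 1" by simp
  next
    fix H vs j assume H: "H \<in> HH" and vs: "vs \<in> Dn" and j: "j < N' vs"
    then obtain ws where ws: "ws \<in> D" "vs = ws @ [[int (N ws)]]" by (auto simp: Dn_def)
    have j': "j < N ws" using j ws N' by simp
    have "vs @ [loop_state (g' H) vs (init' H vs) j, [int j]] \<in> D2"
      using step[OF H ws(1) j'] ws eq[OF ws(1), of H j] unfolding D2_def by auto
    moreover have "eval ?e (init_mem (vs @ [loop_state (g' H) vs (init' H vs) j, [int j]])) > 0"
      unfolding ws(2) using ev[OF ws(1)] j' by simp
    ultimately show "vs @ [loop_state (g' H) vs (init' H vs) j, [int j]] \<in> D2 \<and>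
        eval ?e (init_mem (vs @ [loop_state (g' H) vs (init' H vs) j, [int j]])) > 0" ..
  next
    fix H vs assume H: "H \<in> HH" and vs: "vs \<in> Dn"
    then obtain ws where ws: "ws \<in> D" "vs = ws @ [[int (N ws)]]" by (auto simp: Dn_def)
    show "\<not> eval ?e (init_mem (vs @ [loop_state (g' H) vs (init' H vs) (N' vs), [int (N' vs)]])) > 0"
      unfolding ws(2) using ev[OF ws(1)] N'[OF ws(1)] by simp
  next
    show "poly_bounded Dn N'" unfolding N'_def by (rule bd[OF N(2)])
  next
    fix H assume "H \<in> HH"
    then show "poly_bounded Dn (\<lambda>vs. M H (map (\<lambda>i. vs ! i) ?i1))" by (intro bd M)
  next
    fix H vs j assume H: "H \<in> HH" and vs: "vs \<in> Dn" and j: "j \<le> N' vs"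
    then obtain ws where ws: "ws \<in> D" "vs = ws @ [[int (N ws)]]" by (auto simp: Dn_def)
    show "wsize (loop_state (g' H) vs (init' H vs) j) \<le> M H (map (\<lambda>i. vs ! i) ?i1)"
      using M(2)[OF H ws(1), of j] j N'[OF ws(1)] i1[OF ws(1)] eq[OF ws(1)] ws(2) by simp
  qed
  have gs: "poly_comp HH D g" if "g \<in> set (map (\<lambda>i H ws. ws ! i) [0..<k] @ [\<lambda>H ws. [int (N ws)]])" for g
    using that N(1) poly_comp_nth[OF D] by auto
  have mp: "map (\<lambda>g. g H ws) (map (\<lambda>i H ws. ws ! i) [0..<k] @ [\<lambda>H ws. [int (N ws)]]) = ws @ [[int (N ws)]]" if "ws \<in> D" for H ws
    using i1[OF that, of "[]"] by (simp add: comp_def)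
  have "poly_comp HH D (\<lambda>H ws. (\<lambda>H vs. loop_state (g' H) vs (init' H vs) (N' vs)) H
      (map (\<lambda>g. g H ws) (map (\<lambda>i H ws. ws ! i) [0..<k] @ [\<lambda>H ws. [int (N ws)]])))"
    by (rule poly_comp_call[OF lp D gs]) (assumption, subst mp, assumption, simp add: Dn_def)
  then show ?thesis
    by (rule poly_comp_cong[rotated]) (simp only: mp N' eq)
qed

text \<open>The accumulator is the list of the values found so far. An index below
  \<open>N ws\<close> adds at most \<open>N ws + 1\<close> to the size of the arguments, which
  bounds every entry and hence the list.\<close>

lemma poly_comp_tabulate:
  assumes D: "arity k D" and k: "0 < k"
    and g: "poly_comp HH D' (\<lambda>H ws. [g H ws])"
    and N: "poly_comp HH D (\<lambda>H ws. [int (N ws)])" "poly_bounded D N"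
    and D': "\<And>ws i. ws \<in> D \<Longrightarrow> i < N ws \<Longrightarrow> ws @ [[int i]] \<in> D'"
  shows "poly_comp HH D (\<lambda>H ws. map (\<lambda>i. g H (ws @ [[int i]])) [0..<N ws])"
proof -
  define D2 where "D2 = {ws @ [a, [int j]] | ws a j. ws \<in> D \<and> j < N ws}"
  have ar: "arity (k + 2) D2" using D by (auto simp: arity_def D2_def)
  let ?ii = "[0..<k] @ [k + 1]"
  have ii: "map (\<lambda>i. (ws @ [a, b]) ! i) ?ii = ws @ [b]" if "ws \<in> D" for ws a b
    using arityD[OF D that] by (intro nth_equalityI) (auto simp: nth_append)
  have nk: "(ws @ [a, b]) ! k = a" if "ws \<in> D" for ws a and b :: word
    using arityD[OF D that] by (simp add: nth_append)
  define g' where "g' = (\<lambda>H vs. vs ! k @ [g H (map (\<lambda>i. vs ! i) ?ii)])"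
  have "poly_comp HH D2 (\<lambda>H vs. [g H (map (\<lambda>i. vs ! i) ?ii)])"
    by (rule poly_comp_reindex[OF g ar]) (use ii D' in \<open>auto simp: D2_def simp del: map_append\<close>)
  then have g': "poly_comp HH D2 g'" unfolding g'_def
    by (intro poly_comp_append1[OF ar] poly_comp_nth[OF ar]) auto
  have eq: "loop_state (g' H) ws [] j = map (\<lambda>i. g H (ws @ [[int i]])) [0..<j]" if "ws \<in> D" for H ws j
  proof (induction j)
    case (Suc j)
    have "g' H (ws @ [a, b]) = a @ [g H (ws @ [b])]" for a b
      unfolding g'_def nk[OF that] ii[OF that] ..
    then show ?case using Suc by simp
  qed simp
  have "\<exists>P. \<forall>ws \<in> D'. isize (g H ws) \<le> poly P (isz ws)" if "H \<in> HH" for H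
    using poly_comp_wsize[OF g that] by (auto simp: poly_bounded_def)
  then obtain P where P: "\<And>H ws. H \<in> HH \<Longrightarrow> ws \<in> D' \<Longrightarrow> isize (g H ws) \<le> poly (P H) (isz ws)"
    by metis
  have "poly_comp HH D (\<lambda>H ws. loop_state (g' H) ws ((\<lambda>H ws. []) H ws) (N ws))"
  proof (rule poly_comp_for[OF D k poly_comp_Nil g' N])
    fix H ws j assume H: "H \<in> HH" and ws: "ws \<in> D" and j: "j < N ws"
    show "ws @ [loop_state (g' H) ws [] j, [int j]] \<in> D2" using ws j by (auto simp: D2_def)
  next
    fix H assume H: "H \<in> HH"
    show "poly_bounded D (\<lambda>ws. N ws * poly (P H) (isz ws + (N ws + 1)))"
      by (intro poly_bounded_mult poly_bounded_poly poly_bounded_add poly_bounded_isz poly_bounded_const N)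
  next
    fix H ws j assume H: "H \<in> HH" and ws: "ws \<in> D" and j: "j \<le> N ws"
    have "wsize (loop_state (g' H) ws [] j) \<le> length (loop_state (g' H) ws [] j) * poly (P H) (isz ws + (N ws + 1))"
    proof (rule wsize_bound)
      fix x assume "x \<in> set (loop_state (g' H) ws [] j)"
      then obtain i where i: "i < j" "x = g H (ws @ [[int i]])" unfolding eq[OF ws] by auto
      have "isize x \<le> poly (P H) (isz (ws @ [[int i]]))" unfolding i(2) using i(1) j ws by (intro P[OF H] D') auto
      also have "\<dots> \<le> poly (P H) (isz ws + (N ws + 1))"
        using isize_int_le[of i] i(1) j by (intro poly_nat_mono) simp
      finally show "isize x \<le> poly (P H) (isz ws + (N ws + 1))" .
    qed
    also have "\<dots> \<le> N ws * poly (P H) (isz ws + (N ws + 1))" using j by (simp add: eq[OF ws])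
    finally show "wsize (loop_state (g' H) ws [] j) \<le> N ws * poly (P H) (isz ws + (N ws + 1))" .
  qed
  then show ?thesis by (rule poly_comp_cong[rotated]) (simp add: eq)
qed

lemmas poly_comp_rules = poly_comp_nth poly_comp_read poly_comp_length poly_comp_scalar_nth poly_comp_add
  poly_comp_diff poly_comp_mult poly_comp_div poly_comp_mod poly_comp_cond poly_comp_cond_scalar
  poly_comp_append1

section \<open>Arithmetic in polynomial time\<close>


lemma poly_comp_call1:
  assumes "poly_comp HH (args 1) (\<lambda>H ws. F H (ws ! 0))" "arity k D" "poly_comp HH D f"
  shows "poly_comp HH D (\<lambda>H ws. F H (f H ws))"
  using poly_comp_call[OF assms(1,2), of "[f]"] assms(3) by simp

lemma poly_comp_call2:
  assumes "poly_comp HH (args 2) (\<lambda>H ws. F H (ws ! 0) (ws ! 1))" "arity k D" "poly_comp HH D f" "poly_comp HH D g"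
  shows "poly_comp HH D (\<lambda>H ws. F H (f H ws) (g H ws))"
  using poly_comp_call[OF assms(1,2), of "[f, g]"] assms(3,4) by auto

lemma poly_comp_extend:
  assumes f: "poly_comp HH D f" and D: "arity k D" and D': "arity m D'" "k \<le> m"
    and take: "\<And>ws. ws \<in> D' \<Longrightarrow> take k ws \<in> D"
  shows "poly_comp HH D' (\<lambda>H ws. f H (take k ws))"
proof -
  have eq: "map (\<lambda>i. ws ! i) [0..<k] = take k ws" if "ws \<in> D'" for ws
    using arityD[OF D'(1) that] D'(2) by (intro nth_equalityI) auto
  have "poly_comp HH D' (\<lambda>H ws. f H (map (\<lambda>i. ws ! i) [0..<k]))"
    using D'(2) take eq by (intro poly_comp_reindex[OF f D'(1)]) auto
  then show ?thesis by (rule poly_comp_cong[rotated]) (simp add: eq)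
qed

lemma store_word_1 [simp]: "store_word [a, b] 1 = a" "store_word [a, b] 2 = b" "store_word [] i = 0"
  by (simp_all add: store_word_def)

text \<open>The binary length is the number of halvings until 0 is reached. The loop is controlled
  by the data, since the number of its rounds is the result.\<close>

lemma poly_comp_isize: "poly_comp HH (args 1) (\<lambda>H ws. [int (isize (store_word (ws ! 0) 1))])"
proof -
  define v where "v ws = \<bar>store_word (ws ! 0) 1\<bar>" for ws :: "word list"
  define g :: "word list \<Rightarrow> word" where "g ws = [store_word (ws ! 1) 1 div 2] @ [store_word (ws ! 1) 2 + 1]" for ws
  define n where "n ws = nat (bitlen (v ws))" for ws
  have 1: "poly_comp HH (args 1) (\<lambda>H ws. [if store_word (ws ! 0) 1 > 0 then store_word (ws ! 0) 1 else 0 - store_word (ws ! 0) 1] @ [0])"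
    by (intro poly_comp_rules[OF arity_args] poly_comp_int) auto
  have init: "poly_comp HH (args 1) (\<lambda>H ws. [v ws, 0])"
    by (rule poly_comp_cong[OF _ 1]) (auto simp: v_def)
  have g: "poly_comp HH (args 3) (\<lambda>H. g)" unfolding g_def
    by (intro poly_comp_rules[OF arity_args] poly_comp_int) auto
  have eq: "loop_state g ws [v ws, 0] j = [v ws div 2 ^ j, int j]" if "length ws = 1" for ws j
  proof (induction j)
    case (Suc j)
    have "v ws div 2 ^ j div 2 = v ws div 2 ^ Suc j"
      by (simp add: zdiv_zmult2_eq power_Suc2 del: power_Suc)
    then show ?case using Suc that by (simp add: g_def nth_append)
  qed simp
  have v0: "v ws \<ge> 0" for ws by (simp add: v_def)
  have isz_v: "isize (v ws) \<le> isz ws + 1" if "length ws = 1" for ws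
  proof -
    have "isize (v ws) = isize (store_word (ws ! 0) 1)" by (simp add: v_def isize_def)
    also have "\<dots> \<le> wsize (ws ! 0) + 1" by (rule isize_store_word)
    finally show ?thesis using wsize_nth_le_isz[of 0 ws] that by simp
  qed
  have n_le: "n ws \<le> isz ws" if "length ws = 1" for ws
    using isz_v[OF that] v0[of ws] by (simp add: isize_def n_def)
  have "poly_comp HH (args 1) (\<lambda>H ws. loop_state g ws [v ws, 0] (n ws))"
  proof (rule poly_comp_loop[where e = "Cell 1 (Const 1)" and D' = "args 3" and k = 1, OF _ _ init g])
    fix H ws j assume ws: "ws \<in> args 1" and j: "j < n ws"
    have "int (Suc j) \<le> bitlen (v ws)" using j unfolding n_def by linarith
    then have "2 ^ (nat (int (Suc j)) - 1) \<le> v ws" unfolding bitlen_ge_iff_power by simp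
    then have "2 ^ j \<le> v ws" by (simp del: of_nat_Suc)
    then have "v ws div 2 ^ j > 0" by (simp add: pos_imp_zdiv_pos_iff)
    then show "ws @ [loop_state g ws [v ws, 0] j, [int j]] \<in> args 3 \<and>
        0 < eval (Cell 1 (Const 1)) (init_mem (ws @ [loop_state g ws [v ws, 0] j, [int j]]))"
      using ws by (simp add: eq init_mem_def nth_append)
  next
    fix H ws assume ws: "ws \<in> args 1"
    have "v ws < 2 ^ n ws" using bitlen_le_iff_power[of "v ws" "bitlen (v ws)"] bitlen_nonneg[of "v ws"] by (simp add: n_def)
    then have "v ws div 2 ^ n ws = 0" using v0[of ws] by simp
    then show "\<not> 0 < eval (Cell 1 (Const 1)) (init_mem (ws @ [loop_state g ws [v ws, 0] (n ws), [int (n ws)]]))"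
      using ws by (simp add: eq init_mem_def nth_append)
  next
    show "poly_bounded (args 1) n" using n_le by (intro poly_bounded_mono[OF poly_bounded_isz]) auto
    show "poly_bounded (args 1) (\<lambda>ws. isz ws + 1 + (isz ws + 1))"
      by (intro poly_bounded_add poly_bounded_isz poly_bounded_const)
  next
    fix H ws j assume ws: "ws \<in> args 1" and j: "j \<le> n ws"
    then have l: "length ws = 1" by simp
    have "isize (v ws div 2 ^ j) \<le> isz ws + 1" using isize_div isz_v[OF l] le_trans by blast
    moreover have "isize (int j) \<le> isz ws + 1" using isize_int_le[of j] n_le[OF l] j by linarith
    ultimately show "wsize (loop_state g ws [v ws, 0] j) \<le> isz ws + 1 + (isz ws + 1)"
      unfolding eq[OF l] by simp
  qed auto
  from poly_comp_add[OF arity_args poly_comp_read[OF arity_args this poly_comp_int[of _ _ 2]] poly_comp_int[of _ _ 1]]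
  have "poly_comp HH (args 1) (\<lambda>H ws. [store_word (loop_state g ws [v ws, 0] (n ws)) 2 + 1])" .
  then show ?thesis
  proof (rule poly_comp_cong[rotated])
    fix H ws assume "ws \<in> args 1"
    then show "[store_word (loop_state g ws [v ws, 0] (n ws)) 2 + 1] = [int (isize (store_word (ws ! 0) 1))]"
      using bitlen_nonneg[of "v ws"] by (simp add: eq n_def isize_def flip: v_def)
  qed
qed

text \<open>As \<open>opr\<close> at most adds sizes, after j rounds the accumulator has at most the
  size of \<open>u\<close> plus j times the largest size of an operand, which is polynomial even for
  products.\<close>

lemma poly_comp_fold:
  fixes opr :: "int \<Rightarrow> int \<Rightarrow> int"
  assumes opr: "\<And>D k x y. arity k D \<Longrightarrow> poly_comp HH D (\<lambda>H ws. [x H ws]) \<Longrightarrow> poly_comp HH D (\<lambda>H ws. [y H ws]) \<Longrightarrow>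
      poly_comp HH D (\<lambda>H ws. [opr (x H ws) (y H ws)])"
    and isize_opr: "\<And>i j. isize (opr i j) \<le> isize i + isize j"
    and D: "arity k D" "0 < k"
    and g: "poly_comp HH D' (\<lambda>H ws. [g H ws])"
    and N: "poly_comp HH D (\<lambda>H ws. [int (N ws)])" "poly_bounded D N"
    and D': "\<And>ws i. ws \<in> D \<Longrightarrow> i < N ws \<Longrightarrow> ws @ [[int i]] \<in> D'"
  shows "poly_comp HH D (\<lambda>H ws. [fold (\<lambda>i a. opr a (g H (ws @ [[int i]]))) [0..<N ws] u])"
proof -
  define D2 where "D2 = {ws @ [a, [int j]] | ws a j. ws \<in> D \<and> j < N ws}"
  have ar: "arity (k + 2) D2" using D by (auto simp: arity_def D2_def)
  let ?ii = "[0..<k] @ [k + 1]"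
  have ii: "map (\<lambda>i. (ws @ [a, b]) ! i) ?ii = ws @ [b]" if "ws \<in> D" for ws a b
    using arityD[OF D(1) that] by (intro nth_equalityI) (auto simp: nth_append)
  have nk: "(ws @ [a, b]) ! k = a" if "ws \<in> D" for ws a and b :: word
    using arityD[OF D(1) that] by (simp add: nth_append)
  define g' where "g' = (\<lambda>H vs. [opr (store_word (vs ! k) 1) (g H (map (\<lambda>i. vs ! i) ?ii))])"
  have "poly_comp HH D2 (\<lambda>H vs. [g H (map (\<lambda>i. vs ! i) ?ii)])"
    by (rule poly_comp_reindex[OF g ar]) (use ii D' in \<open>auto simp: D2_def simp del: map_append\<close>)
  then have g': "poly_comp HH D2 g'" unfolding g'_def
    by (intro opr[OF ar] poly_comp_scalar_nth[OF ar]) auto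
  define F where "F H ws j = fold (\<lambda>i a. opr a (g H (ws @ [[int i]]))) [0..<j] u" for H ws j
  have eq: "loop_state (g' H) ws [u] j = [F H ws j]" if "ws \<in> D" for H ws j
  proof (induction j)
    case (Suc j)
    have "g' H (ws @ [[a], b]) = [opr a (g H (ws @ [b]))]" for a b
      unfolding g'_def nk[OF that] ii[OF that] by simp
    then show ?case using Suc by (simp add: F_def)
  qed (simp add: F_def)
  have "\<exists>P. \<forall>ws \<in> D'. isize (g H ws) \<le> poly P (isz ws)" if "H \<in> HH" for H
    using poly_comp_wsize[OF g that] by (auto simp: poly_bounded_def)
  then obtain P where P: "\<And>H ws. H \<in> HH \<Longrightarrow> ws \<in> D' \<Longrightarrow> isize (g H ws) \<le> poly (P H) (isz ws)"
    by metis
  have "poly_comp HH D (\<lambda>H ws. loop_state (g' H) ws ((\<lambda>H ws. [u]) H ws) (N ws))"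
  proof (rule poly_comp_for[OF D poly_comp_int g' N])
    fix H ws j assume H: "H \<in> HH" and ws: "ws \<in> D" and j: "j < N ws"
    show "ws @ [loop_state (g' H) ws [u] j, [int j]] \<in> D2" using ws j by (auto simp: D2_def)
  next
    fix H assume H: "H \<in> HH"
    show "poly_bounded D (\<lambda>ws. isize u + N ws * poly (P H) (isz ws + (N ws + 1)))"
      by (intro poly_bounded_mult poly_bounded_poly poly_bounded_add poly_bounded_isz poly_bounded_const N)
  next
    fix H ws j assume H: "H \<in> HH" and ws: "ws \<in> D" and j: "j \<le> N ws"
    have "isize (F H ws j) \<le> isize u + j * poly (P H) (isz ws + (N ws + 1))"
      using j
    proof (induction j)
      case (Suc j)
      have "isize (g H (ws @ [[int j]])) \<le> poly (P H) (isz (ws @ [[int j]]))"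
        using Suc.prems ws by (intro P[OF H] D') auto
      also have "\<dots> \<le> poly (P H) (isz ws + (N ws + 1))"
        using isize_int_le[of j] Suc.prems by (intro poly_nat_mono) simp
      finally have "isize (g H (ws @ [[int j]])) \<le> poly (P H) (isz ws + (N ws + 1))" .
      moreover have "F H ws (Suc j) = opr (F H ws j) (g H (ws @ [[int j]]))" by (simp add: F_def)
      ultimately show ?case using isize_opr[of "F H ws j" "g H (ws @ [[int j]])"] Suc by simp
    qed (simp add: F_def)
    also have "\<dots> \<le> isize u + N ws * poly (P H) (isz ws + (N ws + 1))" using j by simp
    finally show "wsize (loop_state (g' H) ws [u] j) \<le> isize u + N ws * poly (P H) (isz ws + (N ws + 1))"
      by (simp add: eq[OF ws])
  qed
  then show ?thesis by (rule poly_comp_cong[rotated]) (simp add: eq F_def)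
qed

lemma poly_comp_sum:
  assumes D: "arity k D" "0 < k" and g: "poly_comp HH D' (\<lambda>H ws. [g H ws])"
    and N: "poly_comp HH D (\<lambda>H ws. [int (N ws)])" "poly_bounded D N"
    and D': "\<And>ws i. ws \<in> D \<Longrightarrow> i < N ws \<Longrightarrow> ws @ [[int i]] \<in> D'"
  shows "poly_comp HH D (\<lambda>H ws. [\<Sum>i<N ws. g H (ws @ [[int i]])])"
proof -
  have "fold (\<lambda>i a. a + f i) [0..<n] 0 = (\<Sum>i<n. f i)" for f :: "nat \<Rightarrow> int" and n
    by (induction n) auto
  note eq = this
  have "poly_comp HH D (\<lambda>H ws. [fold (\<lambda>i a. (+) a (g H (ws @ [[int i]]))) [0..<N ws] 0])"
  proof (rule poly_comp_fold[where opr = "(+)" and D' = D' and k = k, OF _ isize_add D g N D'])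
    fix E l and x y :: "(word \<Rightarrow> word) \<Rightarrow> word list \<Rightarrow> int"
    assume "arity l E" "poly_comp HH E (\<lambda>H ws. [x H ws])" "poly_comp HH E (\<lambda>H ws. [y H ws])"
    then show "poly_comp HH E (\<lambda>H ws. [x H ws + y H ws])" by (rule poly_comp_add)
  qed
  then show ?thesis unfolding eq .
qed

lemma poly_comp_prod:
  assumes D: "arity k D" "0 < k" and g: "poly_comp HH D' (\<lambda>H ws. [g H ws])"
    and N: "poly_comp HH D (\<lambda>H ws. [int (N ws)])" "poly_bounded D N"
    and D': "\<And>ws i. ws \<in> D \<Longrightarrow> i < N ws \<Longrightarrow> ws @ [[int i]] \<in> D'"
  shows "poly_comp HH D (\<lambda>H ws. [\<Prod>i<N ws. g H (ws @ [[int i]])])"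
proof -
  have "fold (\<lambda>i a. a * f i) [0..<n] 1 = (\<Prod>i<n. f i)" for f :: "nat \<Rightarrow> int" and n
    by (induction n) auto
  note eq = this
  have "poly_comp HH D (\<lambda>H ws. [fold (\<lambda>i a. (*) a (g H (ws @ [[int i]]))) [0..<N ws] 1])"
  proof (rule poly_comp_fold[where opr = "(*)" and D' = D' and k = k, OF _ isize_mult D g N D'])
    fix E l and x y :: "(word \<Rightarrow> word) \<Rightarrow> word list \<Rightarrow> int"
    assume "arity l E" "poly_comp HH E (\<lambda>H ws. [x H ws])" "poly_comp HH E (\<lambda>H ws. [y H ws])"
    then show "poly_comp HH E (\<lambda>H ws. [x H ws * y H ws])" by (rule poly_comp_mult)
  qed
  then show ?thesis unfolding eq .
qed

text \<open>The exponent must be polynomially bounded in value, not only in binary length; in the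
  applications it is the order of an encoded matrix.\<close>

lemma poly_comp_power:
  assumes D: "arity k D" "0 < k" and x: "poly_comp HH D (\<lambda>H ws. [x H ws])"
    and N: "poly_comp HH D (\<lambda>H ws. [int (N ws)])" "poly_bounded D N"
  shows "poly_comp HH D (\<lambda>H ws. [x H ws ^ N ws])"
proof -
  let ?D = "{ws @ [w] | ws w. ws \<in> D}"
  have ar: "arity (k + 1) ?D" using D by (auto simp: arity_def)
  have tk: "take k (ws @ [w]) = ws" if "ws \<in> D" for ws w using arityD[OF D(1) that] by simp
  have "poly_comp HH ?D (\<lambda>H ws. [x H (take k ws)])"
    by (rule poly_comp_extend[OF x D(1) ar]) (use tk in auto)
  from poly_comp_prod[OF D this N] have "poly_comp HH D (\<lambda>H ws. [\<Prod>i<N ws. x H (take k (ws @ [[int i]]))])"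
    by blast
  then show ?thesis by (rule poly_comp_cong[rotated]) (simp add: arityD[OF D(1)])
qed

text \<open>Witnesses and random strings have length \<open>poly q (wsize x)\<close>, so the machine
  has to compute the size of its own input.\<close>

lemma poly_comp_wsize_fun: "poly_comp HH (args 1) (\<lambda>H ws. [int (wsize (ws ! 0))])"
proof -
  have len: "poly_comp HH (args 1) (\<lambda>H ws. [int (length (ws ! 0))])"
    by (intro poly_comp_rules[OF arity_args]) auto
  have "poly_comp HH (args 2) (\<lambda>H ws. [store_word (ws ! 0) (store_word (ws ! 1) 1 + 1)])"
    by (intro poly_comp_rules[OF arity_args] poly_comp_int) auto
  from poly_comp_call1[OF poly_comp_isize arity_args this]
  have g: "poly_comp HH (args 2) (\<lambda>H ws. [int (isize (store_word (ws ! 0) (store_word (ws ! 1) 1 + 1)))])" by simp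
  have len': "poly_bounded (args 1) (\<lambda>ws. length (ws ! 0))"
  proof (rule poly_bounded_mono[OF poly_bounded_isz])
    fix ws :: "word list" assume "ws \<in> args 1"
    then show "length (ws ! 0) \<le> isz ws"
      using length_le_wsize[of "ws ! 0"] wsize_nth_le_isz[of 0 ws] by simp
  qed
  have "poly_comp HH (args 1) (\<lambda>H ws. [\<Sum>i<length (ws ! 0).
      int (isize (store_word ((ws @ [[int i]]) ! 0) (store_word ((ws @ [[int i]]) ! 1) 1 + 1)))])"
    by (rule poly_comp_sum[OF arity_args _ g len len']) auto
  then show ?thesis
  proof (rule poly_comp_cong[rotated])
    fix H :: "word \<Rightarrow> word" and ws :: "word list" assume "ws \<in> args 1"
    then obtain w where ws: "ws = [w]" by (auto simp: length_Suc_conv)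
    have "(\<Sum>i<length w. isize (w ! i)) = wsize w"
      by (simp add: wsize_def sum_list_sum_nth atLeast0LessThan)
    then show "[\<Sum>i<length (ws ! 0). int (isize (store_word ((ws @ [[int i]]) ! 0) (store_word ((ws @ [[int i]]) ! 1) 1 + 1)))] =
        [int (wsize (ws ! 0))]" unfolding ws by (simp flip: of_nat_sum)
  qed
qed

lemma poly_comp_poly:
  assumes D: "arity k D" and x: "poly_comp HH D (\<lambda>H ws. [int (x H ws)])"
  shows "poly_comp HH D (\<lambda>H ws. [int (poly q (x H ws))])"
proof (induction q)
  case (pCons a q)
  have "poly_comp HH D (\<lambda>H ws. [int a + int (x H ws) * int (poly q (x H ws))])"
    by (intro poly_comp_rules[OF D] poly_comp_int x pCons)
  then show ?case by simp
qed (simp add: poly_comp_int)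

section \<open>Minors of positive semi-definite matrices\<close>


text \<open>Rows and columns are given by lists rather than sets, so that a minor can be bordered by
  appending an index, and rows and columns may be chosen independently.\<close>

definition list_mat :: "'a mat \<Rightarrow> nat list \<Rightarrow> nat list \<Rightarrow> 'a mat" where
  "list_mat A xs ys = mat (length xs) (length ys) (\<lambda>(i, j). A $$ (xs ! i, ys ! j))"

lemma list_mat_dim [simp]:
  "list_mat A xs ys \<in> carrier_mat (length xs) (length ys)"
  "dim_row (list_mat A xs ys) = length xs" "dim_col (list_mat A xs ys) = length ys"
  by (simp_all add: list_mat_def)

lemma list_mat_index [simp]: "i < length xs \<Longrightarrow> j < length ys \<Longrightarrow> list_mat A xs ys $$ (i, j) = A $$ (xs ! i, ys ! j)"
  by (simp add: list_mat_def)

lemma list_mat_append: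
  "list_mat A (xs @ rs) (ys @ cs) =
    four_block_mat (list_mat A xs ys) (list_mat A xs cs) (list_mat A rs ys) (list_mat A rs cs)"
  by (rule eq_matI) (auto simp: nth_append)

text \<open>The determinant formula for the Schur complement. Column j of \<open>c\<close> solves
  the linear system with the block on \<open>xs\<close> as its matrix; it does not depend on
  \<open>rs\<close> and \<open>cs\<close>, so that one \<open>c\<close> serves all borderings at
  once.\<close>

lemma det_list_mat_append:
  fixes A :: "'a :: field mat"
  assumes "det (list_mat A xs xs) \<noteq> 0"
  shows "\<exists>c. (\<forall>j. \<forall>a < length xs. (\<Sum>b<length xs. A $$ (xs ! a, xs ! b) * c b j) = A $$ (xs ! a, j)) \<and>
    (\<forall>rs cs. length rs = length cs \<longrightarrow> det (list_mat A (xs @ rs) (xs @ cs)) = det (list_mat A xs xs) *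
      det (mat (length rs) (length cs) (\<lambda>(i, j). A $$ (rs ! i, cs ! j) - (\<Sum>b<length xs. A $$ (rs ! i, xs ! b) * c b (cs ! j)))))"
proof -
  let ?P = "list_mat A xs xs" and ?m = "length xs"
  obtain Q where Q: "Q \<in> carrier_mat ?m ?m" "?P * Q = 1\<^sub>m ?m"
  proof -
    have "?P \<in> Units (ring_mat TYPE('a) ?m ())" by (rule det_non_zero_imp_unit) (use assms in auto)
    then show ?thesis using that unfolding Units_def ring_mat_def by auto
  qed
  define c where "c b j = (\<Sum>a<?m. Q $$ (b, a) * A $$ (xs ! a, j))" for b j
  have PQ: "(\<Sum>b<?m. A $$ (xs ! a, xs ! b) * Q $$ (b, d)) = (if a = d then 1 else 0)" if "a < ?m" "d < ?m" for a d
  proof -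
    have "(?P * Q) $$ (a, d) = (\<Sum>b<?m. A $$ (xs ! a, xs ! b) * Q $$ (b, d))"
      using that Q(1) by (simp add: scalar_prod_def atLeast0LessThan)
    then show ?thesis using Q(2) that by simp
  qed
  have c: "(\<Sum>b<?m. A $$ (xs ! a, xs ! b) * c b j) = A $$ (xs ! a, j)" if a: "a < ?m" for a j
  proof -
    have "(\<Sum>b<?m. A $$ (xs ! a, xs ! b) * c b j) = (\<Sum>b<?m. \<Sum>d<?m. A $$ (xs ! a, xs ! b) * Q $$ (b, d) * A $$ (xs ! d, j))"
      by (simp add: c_def sum_distrib_left mult.assoc)
    also have "\<dots> = (\<Sum>d<?m. (\<Sum>b<?m. A $$ (xs ! a, xs ! b) * Q $$ (b, d)) * A $$ (xs ! d, j))"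
      by (subst sum.swap) (simp add: sum_distrib_right)
    also have "\<dots> = (\<Sum>d<?m. if a = d then A $$ (xs ! d, j) else 0)"
      using a by (intro sum.cong) (auto simp: PQ)
    also have "\<dots> = A $$ (xs ! a, j)" using a by simp
    finally show ?thesis .
  qed
  have "det (list_mat A (xs @ rs) (xs @ cs)) = det ?P *
      det (mat (length rs) (length cs) (\<lambda>(i, j). A $$ (rs ! i, cs ! j) - (\<Sum>b<?m. A $$ (rs ! i, xs ! b) * c b (cs ! j))))"
    if l: "length rs = length cs" for rs cs
  proof -
    let ?l = "length cs"
    let ?B = "list_mat A xs cs" and ?C = "list_mat A rs xs" and ?D = "list_mat A rs cs"
    define X where "X = mat ?m ?l (\<lambda>(b, j). - c b (cs ! j))"
    have car: "?P \<in> carrier_mat ?m ?m" "?B \<in> carrier_mat ?m ?l" "?C \<in> carrier_mat ?l ?m" "?D \<in> carrier_mat ?l ?l"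
      "X \<in> carrier_mat ?m ?l" using l list_mat_dim(1)[of A rs] by (auto simp: X_def)
    \<comment> \<open>Multiplying from the right by this matrix of determinant 1 clears the upper
      right block and leaves the Schur complement \<open>?S\<close> in the lower right one.\<close>
    let ?U = "four_block_mat (1\<^sub>m ?m) X (0\<^sub>m ?l ?m) (1\<^sub>m ?l)"
    let ?M = "four_block_mat ?P ?B ?C ?D"
    let ?S = "?C * X + ?D"
    have detU: "det ?U = 1"
      by (subst det_four_block_mat_lower_left_zero[of _ ?m _ ?l]) (use car in auto)
    have z: "?P * X + ?B = 0\<^sub>m ?m ?l"
      using c by (intro eq_matI) (auto simp: X_def scalar_prod_def atLeast0LessThan sum_negf)
    have "?M * ?U = four_block_mat (?P * 1\<^sub>m ?m + ?B * 0\<^sub>m ?l ?m) (?P * X + ?B * 1\<^sub>m ?l)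
        (?C * 1\<^sub>m ?m + ?D * 0\<^sub>m ?l ?m) (?C * X + ?D * 1\<^sub>m ?l)"
      by (rule mult_four_block_mat[of _ ?m ?m _ ?l _ ?l]) (use car in auto)
    also have "\<dots> = four_block_mat ?P (0\<^sub>m ?m ?l) ?C ?S"
      using car z by (simp add: right_mult_zero_mat)
    finally have MU: "?M * ?U = four_block_mat ?P (0\<^sub>m ?m ?l) ?C ?S" .
    have "det ?M * det ?U = det (?M * ?U)"
      by (rule det_mult[symmetric, of _ "?m + ?l"]) (use car in auto)
    also have "\<dots> = det ?P * det ?S" unfolding MU
      by (rule det_four_block_mat_upper_right_zero) (use car in auto)
    finally have "det ?M = det ?P * det ?S" using detU by simp
    moreover have "?S = mat (length rs) ?l (\<lambda>(i, j). A $$ (rs ! i, cs ! j) - (\<Sum>b<?m. A $$ (rs ! i, xs ! b) * c b (cs ! j)))"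
      using l by (intro eq_matI) (auto simp: X_def scalar_prod_def atLeast0LessThan sum_negf)
    ultimately show ?thesis unfolding list_mat_append by simp
  qed
  with c show ?thesis by (intro exI[of _ c] conjI allI impI)
qed

lemma det_mat_2:
  fixes f :: "nat \<times> nat \<Rightarrow> 'a :: idom"
  shows "det (mat 2 2 f) = f (0, 0) * f (1, 1) - f (0, 1) * f (1, 0)"
proof -
  let ?m = "\<lambda>x. mat 1 1 (\<lambda>_. x :: 'a)"
  have car: "?m x \<in> carrier_mat 1 1" for x by simp
  have mult: "?m x * ?m y = ?m (x * y)" for x y
    by (rule eq_matI) (simp_all add: scalar_prod_def)
  have minus: "?m x - ?m y = ?m (x - y)" for x y
    by (rule eq_matI) simp_all
  have "mat 2 2 f = four_block_mat (?m (f (0, 0))) (?m (f (0, 1))) (?m (f (1, 0))) (?m (f (1, 1)))"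
    by (rule eq_matI) (auto simp: less_Suc_eq numeral_2_eq_2)
  then have "det (mat 2 2 f) = det (?m (f (0, 0)) * ?m (f (1, 1)) - ?m (f (0, 1)) * ?m (f (1, 0)))"
    using det_four_block_mat[OF car car car car, of "f (1, 0)" "f (1, 1)" "f (0, 0)" "f (0, 1)"]
    by (simp only: mult mult.commute)
  also have "\<dots> = f (0, 0) * f (1, 1) - f (0, 1) * f (1, 0)"
    unfolding mult minus using det_single[OF car] by simp
  finally show ?thesis .
qed

text \<open>A minor bordered by one index is the pivot determinant times an entry s of the Schur
  complement, one bordered by two is the pivot determinant times a 2 x 2 minor of s. After
  substitution the claim is an identity of commutative algebra.\<close>

lemma sylvester_identity:
  fixes A :: "'a :: field mat"
  assumes "det (list_mat A xs xs) \<noteq> 0"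
  shows "det (list_mat A (xs @ [k, i]) (xs @ [k, j])) * det (list_mat A xs xs) =
    det (list_mat A (xs @ [i]) (xs @ [j])) * det (list_mat A (xs @ [k]) (xs @ [k])) -
    det (list_mat A (xs @ [i]) (xs @ [k])) * det (list_mat A (xs @ [k]) (xs @ [j]))"
proof -
  obtain c where c: "\<And>rs cs. length rs = length cs \<Longrightarrow> det (list_mat A (xs @ rs) (xs @ cs)) = det (list_mat A xs xs) *
      det (mat (length rs) (length cs) (\<lambda>(i, j). A $$ (rs ! i, cs ! j) - (\<Sum>b<length xs. A $$ (rs ! i, xs ! b) * c b (cs ! j))))"
    using det_list_mat_append[OF assms] by blast
  define s where "s i j = A $$ (i, j) - (\<Sum>b<length xs. A $$ (i, xs ! b) * c b j)" for i j
  have one: "det (list_mat A (xs @ [i]) (xs @ [j])) = det (list_mat A xs xs) * s i j" for i j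
    by (subst c) (auto simp: det_single s_def)
  have two: "det (list_mat A (xs @ [k, i]) (xs @ [k, j])) = det (list_mat A xs xs) * (s k k * s i j - s k j * s i k)"
    by (subst c) (simp_all add: det_mat_2 s_def flip: numeral_2_eq_2)
  show ?thesis unfolding one two by (simp only: algebra_simps)
qed

lemma psd_quadratic_form:
  assumes A: "psd n A" and x: "\<And>a. a < m \<Longrightarrow> x a < n"
  shows "0 \<le> (\<Sum>a<m. \<Sum>b<m. z a * A $$ (x a, x b) * z b)"
proof -
  have car: "A \<in> carrier_mat n n" using A by (simp add: psd_def)
  \<comment> \<open>Indices in \<open>x\<close> may repeat; their coefficients are collected into a
    single rational test vector.\<close>
  define w where "w i = (\<Sum>a<m. if x a = i then z a else 0)" for i
  define v where "v = vec n (\<lambda>i. real_of_rat (w i))"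
  have pick: "(\<Sum>i<n. w i * f i) = (\<Sum>a<m. z a * f (x a))" for f
  proof -
    have "(\<Sum>i<n. w i * f i) = (\<Sum>i<n. \<Sum>a<m. if x a = i then z a * f i else 0)"
      unfolding w_def sum_distrib_right by (intro sum.cong) auto
    also have "\<dots> = (\<Sum>a<m. \<Sum>i<n. if x a = i then z a * f i else 0)" by (rule sum.swap)
    also have "\<dots> = (\<Sum>a<m. z a * f (x a))" using x by (intro sum.cong) auto
    finally show ?thesis .
  qed
  have "scalar_prod v (map_mat real_of_rat A *\<^sub>v v) = real_of_rat (\<Sum>i<n. w i * (\<Sum>j<n. w j * A $$ (i, j)))"
    using car by (auto simp: v_def scalar_prod_def atLeast0LessThan of_rat_sum of_rat_mult intro!: sum.cong)
  also have "(\<Sum>i<n. w i * (\<Sum>j<n. w j * A $$ (i, j))) = (\<Sum>a<m. \<Sum>b<m. z a * A $$ (x a, x b) * z b)"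
    unfolding pick by (simp add: sum_distrib_left mult_ac)
  finally have eq: "scalar_prod v (map_mat real_of_rat A *\<^sub>v v) =
      real_of_rat (\<Sum>a<m. \<Sum>b<m. z a * A $$ (x a, x b) * z b)" .
  have "0 \<le> scalar_prod v (map_mat real_of_rat A *\<^sub>v v)" using A by (simp add: psd_def v_def)
  then show ?thesis unfolding eq by (simp only: zero_le_of_rat_iff)
qed

text \<open>All that is used of positive semi-definiteness; unlike \<open>psd\<close> it is clearly invariant under
  scaling and covers repeated indices.\<close>

definition psd_form :: "nat \<Rightarrow> rat mat \<Rightarrow> bool" where
  "psd_form n A \<longleftrightarrow> (\<forall>i < n. \<forall>j < n. A $$ (i, j) = A $$ (j, i)) \<and>
     (\<forall>m (x :: nat \<Rightarrow> nat) z. (\<forall>a < m. x a < n) \<longrightarrow> 0 \<le> (\<Sum>a<m. \<Sum>b<m. z a * A $$ (x a, x b) * z b))"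

lemma psd_imp_psd_form: "psd n A \<Longrightarrow> psd_form n A"
proof -
  assume A: "psd n A"
  have "A $$ (i, j) = A $$ (j, i)" if "i < n" "j < n" for i j
  proof -
    have "A\<^sup>T = A" "A \<in> carrier_mat n n" using A by (simp_all add: psd_def)
    then show ?thesis using index_transpose_mat(1)[of i A j] that by auto
  qed
  with psd_quadratic_form[OF A] show ?thesis unfolding psd_form_def by (intro conjI allI impI) blast+
qed

text \<open>The quadratic form on \<open>xs\<close> with one further index \<open>i\<close> of
  coefficient \<open>t\<close>, expanded in powers of t. Kernel vectors of a principal block and the
  sign of a Schur complement are both handled by a choice of \<open>z\<close> and
  \<open>t\<close>.\<close>

lemma psd_form_append:
  assumes A: "psd_form n A" and xs: "set xs \<subseteq> {..<n}" and i: "i < n"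
  shows "0 \<le> (\<Sum>a<length xs. \<Sum>b<length xs. z a * A $$ (xs ! a, xs ! b) * z b)
    + 2 * t * (\<Sum>b<length xs. A $$ (i, xs ! b) * z b) + t * t * A $$ (i, i)"
proof -
  let ?m = "length xs"
  have xa: "xs ! a < n" if "a < ?m" for a using subsetD[OF xs nth_mem[OF that]] by simp
  have sym: "A $$ (xs ! a, i) = A $$ (i, xs ! a)" if "a < ?m" for a
    using A i xa[OF that] by (simp add: psd_form_def)
  define x where "x a = (if a < ?m then xs ! a else i)" for a
  define y where "y a = (if a < ?m then z a else t)" for a
  have "0 \<le> (\<Sum>a<Suc ?m. \<Sum>b<Suc ?m. y a * A $$ (x a, x b) * y b)"
    using A[unfolded psd_form_def, THEN conjunct2, rule_format, of "Suc ?m" x y] xa i by (simp only: x_def) auto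
  also have "\<dots> = (\<Sum>a<?m. \<Sum>b<?m. z a * A $$ (xs ! a, xs ! b) * z b) + (\<Sum>a<?m. z a * A $$ (i, xs ! a) * t)
      + (\<Sum>b<?m. t * A $$ (i, xs ! b) * z b) + t * A $$ (i, i) * t"
    by (simp add: x_def y_def sum.distrib sym)
  also have "(\<Sum>a<?m. z a * A $$ (i, xs ! a) * t) = t * (\<Sum>b<?m. A $$ (i, xs ! b) * z b)"
    by (simp add: sum_distrib_left mult_ac)
  also have "(\<Sum>b<?m. t * A $$ (i, xs ! b) * z b) = t * (\<Sum>b<?m. A $$ (i, xs ! b) * z b)"
    by (simp add: sum_distrib_left mult_ac)
  finally show ?thesis by (simp add: algebra_simps)
qed

text \<open>The form vanishes at a kernel vector v of the principal block. With a further
  coefficient t at an index i it becomes 2 t L + t^2 A(i, i), and nonnegativity for all t forces L =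
  0. So v annihilates the columns \<open>xs\<close> in every row, whatever rows \<open>rs\<close>
  are taken, and v padded by zeros is a kernel vector of the larger matrix.\<close>

lemma psd_form_singular:
  assumes A: "psd_form n A" and xs: "set xs \<subseteq> {..<n}" and rs: "set rs \<subseteq> {..<n}"
    and len: "length rs = length (xs @ ys)" and det: "det (list_mat A xs xs) = 0"
  shows "det (list_mat A rs (xs @ ys)) = 0"
proof -
  let ?m = "length xs"
  obtain v where v: "v \<in> carrier_vec ?m" "v \<noteq> 0\<^sub>v ?m" "list_mat A xs xs *\<^sub>v v = 0\<^sub>v ?m"
    using det det_0_iff_vec_prod_zero_field[OF list_mat_dim(1)] by blast
  have Pv: "(\<Sum>b<?m. A $$ (xs ! a, xs ! b) * v $ b) = 0" if "a < ?m" for a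
  proof -
    have "(list_mat A xs xs *\<^sub>v v) $ a = (\<Sum>b<?m. A $$ (xs ! a, xs ! b) * v $ b)"
      using that v(1) by (simp add: scalar_prod_def atLeast0LessThan)
    then show ?thesis using v(3) that by simp
  qed
  have zero: "(\<Sum>b<?m. A $$ (i, xs ! b) * v $ b) = 0" if i: "i < n" for i
  proof -
    define L where "L = (\<Sum>b<?m. A $$ (i, xs ! b) * v $ b)"
    have "(\<Sum>a<?m. \<Sum>b<?m. v $ a * A $$ (xs ! a, xs ! b) * v $ b)
      = (\<Sum>a<?m. v $ a * (\<Sum>b<?m. A $$ (xs ! a, xs ! b) * v $ b))"
      by (simp add: sum_distrib_left mult.assoc)
    then have 0: "(\<Sum>a<?m. \<Sum>b<?m. v $ a * A $$ (xs ! a, xs ! b) * v $ b) = 0" using Pv by simp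
    have q: "0 \<le> 2 * t * L + t * t * A $$ (i, i)" for t
      using psd_form_append[OF A xs i, of "\<lambda>b. v $ b" t] unfolding 0 L_def by simp
    have aii: "0 \<le> A $$ (i, i)" using psd_form_append[OF A, of "[]" i "\<lambda>_. 0" 1] i by simp
    show ?thesis
    proof (rule ccontr)
      assume "\<not> ?thesis"
      then have L: "L \<noteq> 0" by (simp add: L_def)
      \<comment> \<open>The increment keeps the denominator positive when the diagonal entry is 0.
        At t = -L / d the form would be -L^2 (d + 1) / d^2, which is negative.\<close>
      define d where "d = A $$ (i, i) + 1"
      have d: "d > 0" using aii by (simp add: d_def)
      have "0 \<le> (2 * (- L / d) * L + (- L / d) * (- L / d) * (d - 1)) * (d * d)"
        using q[of "- L / d"] d by (intro mult_nonneg_nonneg) (auto simp: d_def)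
      also have "\<dots> = - (L * L) * (d + 1)" using d by (simp add: field_simps)
      also have "\<dots> < 0"
      proof -
        have "L * L > 0" using L by (simp add: zero_less_mult_iff linorder_neq_iff disj_commute)
        then have "(L * L) * (d + 1) > 0" by (rule mult_pos_pos) (use d in simp)
        then show ?thesis by (simp only: mult_minus_left neg_less_0_iff_less)
      qed
      finally show False by simp
    qed
  qed
  let ?l = "length (xs @ ys)"
  define w where "w = vec ?l (\<lambda>b. if b < ?m then v $ b else 0)"
  have "list_mat A rs (xs @ ys) *\<^sub>v w = 0\<^sub>v ?l"
  proof (rule eq_vecI)
    fix a assume "a < dim_vec (0\<^sub>v ?l :: rat vec)"
    then have a: "a < ?l" by simp
    have "(list_mat A rs (xs @ ys) *\<^sub>v w) $ a = (\<Sum>b<?l. A $$ (rs ! a, (xs @ ys) ! b) * (if b < ?m then v $ b else 0))"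
      using a len by (simp add: w_def scalar_prod_def atLeast0LessThan)
    also have "\<dots> = (\<Sum>b<?m. A $$ (rs ! a, (xs @ ys) ! b) * v $ b)"
      by (intro sum.mono_neutral_cong_right) auto
    also have "\<dots> = (\<Sum>b<?m. A $$ (rs ! a, xs ! b) * v $ b)" by (intro sum.cong) (auto simp: nth_append)
    also have "\<dots> = 0" using subsetD[OF rs nth_mem[of a rs]] a len by (intro zero) auto
    finally show "(list_mat A rs (xs @ ys) *\<^sub>v w) $ a = 0\<^sub>v ?l $ a" using a by simp
  qed (use len in simp)
  moreover have "w \<noteq> 0\<^sub>v ?l"
  proof
    assume w0: "w = 0\<^sub>v ?l"
    have "v = 0\<^sub>v ?m"
    proof (rule eq_vecI)
      fix b assume "b < dim_vec (0\<^sub>v ?m :: rat vec)"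
      then have "b < ?m" by simp
      then have "v $ b = w $ b" by (simp add: w_def)
      then show "v $ b = 0\<^sub>v ?m $ b" using w0 \<open>b < ?m\<close> by simp
    qed (use v(1) in simp)
    then show False using v(2) by blast
  qed
  moreover have "w \<in> carrier_vec ?l" by (simp add: w_def)
  moreover have "list_mat A rs (xs @ ys) \<in> carrier_mat ?l ?l" using len list_mat_dim(1)[of A rs "xs @ ys"] by simp
  ultimately show ?thesis using det_0_iff_vec_prod_zero_field by blast
qed

text \<open>Induction on the index list. A vanishing minor stays zero when an index is appended; a
  positive one is multiplied by the scalar Schur complement, which is a value of the form.\<close>

lemma psd_form_det_nonneg:
  assumes A: "psd_form n A" and xs: "set xs \<subseteq> {..<n}"
  shows "det (list_mat A xs xs) \<ge> 0"
  using xs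
proof (induction xs rule: rev_induct)
  case Nil
  then show ?case by (simp add: list_mat_def)
next
  case (snoc i xs)
  let ?m = "length xs"
  have i: "i < n" and xs: "set xs \<subseteq> {..<n}" using snoc.prems by auto
  show ?case
  proof (cases "det (list_mat A xs xs) = 0")
    case True
    then show ?thesis using psd_form_singular[OF A xs snoc.prems, of "[i]"] by simp
  next
    case False
    then have pos: "det (list_mat A xs xs) > 0" using snoc.IH[OF xs] by simp
    obtain c where c: "\<And>a j. a < ?m \<Longrightarrow> (\<Sum>b<?m. A $$ (xs ! a, xs ! b) * c b j) = A $$ (xs ! a, j)"
      "\<And>rs cs. length rs = length cs \<Longrightarrow> det (list_mat A (xs @ rs) (xs @ cs)) = det (list_mat A xs xs) *
      det (mat (length rs) (length cs) (\<lambda>(i, j). A $$ (rs ! i, cs ! j) - (\<Sum>b<?m. A $$ (rs ! i, xs ! b) * c b (cs ! j))))"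
      using det_list_mat_append[OF False] by blast
    define L where "L = (\<Sum>b<?m. A $$ (i, xs ! b) * c b i)"
    have sym: "A $$ (xs ! a, i) = A $$ (i, xs ! a)" if "a < ?m" for a
      using A i subsetD[OF xs nth_mem[OF that]] by (simp add: psd_form_def)
    have "(\<Sum>a<?m. \<Sum>b<?m. c a i * A $$ (xs ! a, xs ! b) * c b i) = (\<Sum>a<?m. c a i * (\<Sum>b<?m. A $$ (xs ! a, xs ! b) * c b i))"
      by (simp add: sum_distrib_left mult.assoc)
    also have "\<dots> = L" unfolding L_def by (intro sum.cong) (auto simp: c(1) sym)
    \<comment> \<open>The form is taken at the solution vector \<open>c\<close> with coefficient -1
      at the new index; its value is the Schur complement A(i, i) - L.\<close>
    finally have "0 \<le> L + 2 * (- 1) * L + A $$ (i, i)"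
      using psd_form_append[OF A xs i, of "\<lambda>b. c b i" "- 1"] by (simp add: L_def)
    then have "0 \<le> A $$ (i, i) - L" by simp
    moreover have "det (list_mat A (xs @ [i]) (xs @ [i])) = det (list_mat A xs xs) * (A $$ (i, i) - L)"
      by (subst c(2)) (auto simp: det_single L_def)
    ultimately show ?thesis using pos by simp
  qed
qed

text \<open>Both sides list the elements of \<open>S\<close> below n in increasing order, one
  through \<open>pick\<close> and the other through \<open>filter\<close>.\<close>

lemma submatrix_eq_list_mat:
  assumes A: "A \<in> carrier_mat n n"
  shows "submatrix A S S = list_mat A (filter (\<lambda>i. i \<in> S) [0..<n]) (filter (\<lambda>i. i \<in> S) [0..<n])"
proof -
  let ?f = "filter (\<lambda>i. i \<in> S) [0..<n]"
  have f: "?f = nths [0..<n] S" by (induction n) (simp_all add: nths_append)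
  have len: "length ?f = card {i. i < n \<and> i \<in> S}"
    using distinct_card[of ?f] by (simp add: conj_commute)
  have nth: "?f ! i = pick S i" if "i < length ?f" for i
  proof -
    have i: "i < card {i. i < length [0..<n] \<and> i \<in> S}" using that len by simp
    have "pick S i < n" using pick_le[of i n S] i by simp
    then show ?thesis unfolding f using nth_nths[OF i] by simp
  qed
  show ?thesis
    by (rule eq_matI) (use A in \<open>auto simp: dim_submatrix len submatrix_index nth\<close>)
qed

section \<open>Fraction-free elimination\<close>


lemma isize_power: "isize (x ^ l) \<le> l * isize x + 2"
proof (induction l)
  case 0
  have "isize 1 \<le> 2" using isize_int_le[of 1] by simp
  then show ?case by simp
next
  case (Suc l)
  then show ?case using isize_mult[of x "x ^ l"] by simp
qed

lemma isize_fact: "isize (fact l) \<le> (l + 2) ^ 2"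
proof (induction l)
  case 0
  have "isize 1 \<le> 2" using isize_int_le[of 1] by simp
  then show ?case by (simp add: power2_eq_square)
next
  case (Suc l)
  have "isize (fact (Suc l)) \<le> isize (int (Suc l)) + isize (fact l)"
    using isize_mult[of "int (Suc l)" "fact l"] by simp
  also have "\<dots> \<le> (l + 2) + (l + 2) ^ 2" using isize_int_le[of "Suc l"] Suc by simp
  also have "\<dots> \<le> (Suc l + 2) ^ 2" by (simp add: power2_eq_square)
  finally show ?case .
qed

text \<open>By the Leibniz formula the determinant is a sum of l! terms, each of absolute value at
  most 2^(b l); the size of l! is at most quadratic in l.\<close>

lemma isize_det_list_mat:
  fixes N :: "int mat"
  assumes "length xs = l" "length ys = l"
    and N: "\<And>i j. i \<in> set xs \<Longrightarrow> j \<in> set ys \<Longrightarrow> isize (N $$ (i, j)) \<le> b"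
  shows "isize (det (list_mat N xs ys)) \<le> (l + 2) ^ 2 + l * (b + 2) + 2"
proof -
  let ?P = "{p. p permutes {0..<l}}"
  have abs: "\<bar>N $$ (i, j)\<bar> \<le> 2 ^ b" if "i \<in> set xs" "j \<in> set ys" for i j
    using isize_le_iff[of "N $$ (i, j)" b] N[OF that] by simp
  have "\<bar>det (list_mat N xs ys)\<bar> = \<bar>\<Sum>p \<in> ?P. signof p * (\<Prod>i = 0..<l. list_mat N xs ys $$ (i, p i))\<bar>"
    using assms list_mat_dim(1)[of N xs ys] by (subst det_def'[of _ l]) auto
  also have "\<dots> \<le> (\<Sum>p \<in> ?P. \<bar>signof p * (\<Prod>i = 0..<l. list_mat N xs ys $$ (i, p i))\<bar>)"
    by (rule sum_abs)
  also have "\<dots> \<le> (\<Sum>p \<in> ?P. (2 ^ b) ^ l)"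
  proof (rule sum_mono)
    fix p assume p: "p \<in> ?P"
    have "\<bar>\<Prod>i = 0..<l. list_mat N xs ys $$ (i, p i)\<bar> \<le> (\<Prod>i = 0..<l. 2 ^ b)"
      unfolding abs_prod
    proof (rule prod_mono)
      fix i assume i: "i \<in> {0..<l}"
      then have "p i < l" using p by (simp add: permutes_in_image)
      then show "0 \<le> \<bar>list_mat N xs ys $$ (i, p i)\<bar> \<and> \<bar>list_mat N xs ys $$ (i, p i)\<bar> \<le> 2 ^ b"
        using i assms(1,2) abs by simp
    qed
    then show "\<bar>signof p * (\<Prod>i = 0..<l. list_mat N xs ys $$ (i, p i))\<bar> \<le> (2 ^ b) ^ l"
      by (simp add: abs_mult sign_def)
  qed
  also have "\<dots> = fact l * (2 ^ b) ^ l" using card_permutations[of "{0..<l}" l] by simp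
  finally have le: "\<bar>det (list_mat N xs ys)\<bar> \<le> \<bar>fact l * (2 ^ b) ^ l\<bar>" by simp
  have "isize (2 ^ b) \<le> b + 2" using isize_le_iff[of "2 ^ b" "Suc b"] by simp
  then have "l * isize (2 ^ b) \<le> l * (b + 2)" by (rule mult_le_mono2)
  moreover have "isize (fact l * (2 ^ b) ^ l) \<le> (l + 2) ^ 2 + (l * isize (2 ^ b) + 2)"
    using isize_mult[of "fact l" "(2 ^ b) ^ l"] isize_fact[of l] isize_power[of "2 ^ b" l] by linarith
  ultimately show ?thesis using isize_mono[OF le] by linarith
qed

lemma of_int_det_list_mat:
  assumes "N \<in> carrier_mat n n" "set xs \<subseteq> {..<n}" "set ys \<subseteq> {..<n}"
  shows "det (list_mat (map_mat rat_of_int N) xs ys) = rat_of_int (det (list_mat N xs ys))"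
proof -
  have "xs ! i < n" if "i < length xs" for i using assms(2) nth_mem[OF that] by blast
  moreover have "ys ! i < n" if "i < length ys" for i using assms(3) nth_mem[OF that] by blast
  ultimately have "list_mat (map_mat rat_of_int N) xs ys = map_mat rat_of_int (list_mat N xs ys)"
    using assms(1) by (intro eq_matI) auto
  then show ?thesis by (simp add: of_int_hom.hom_det)
qed

text \<open>For a nonzero pivot minor the division is exact by \<open>sylvester_identity\<close>.
  For a zero one the left side vanishes by \<open>psd_form_singular\<close>, and the right side
  vanishes because integer division by 0 yields 0; this is why zero pivots need no special
  treatment.\<close>

lemma bareiss_identity:
  assumes N: "N \<in> carrier_mat n n" and psd: "psd_form n (map_mat rat_of_int N)"
    and T: "set T \<subseteq> {..<n}" and kij: "k < n" "i < n" "j < n"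
  shows "det (list_mat N (T @ [k, i]) (T @ [k, j])) =
    (det (list_mat N (T @ [i]) (T @ [j])) * det (list_mat N (T @ [k]) (T @ [k])) -
     det (list_mat N (T @ [i]) (T @ [k])) * det (list_mat N (T @ [k]) (T @ [j]))) div det (list_mat N T T)"
proof -
  let ?A = "map_mat rat_of_int N"
  note h = of_int_det_list_mat[OF N]
  show ?thesis
  proof (cases "det (list_mat N T T) = 0")
    case True
    then have "det (list_mat ?A T T) = 0" using h[OF T T] by simp
    then have "det (list_mat ?A (T @ [k, i]) (T @ [k, j])) = 0"
      using T kij by (intro psd_form_singular[OF psd T]) auto
    then have "det (list_mat N (T @ [k, i]) (T @ [k, j])) = 0" using T kij h[of "T @ [k, i]" "T @ [k, j]"] by simp
    then show ?thesis using True by simp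
  next
    case False
    then have "det (list_mat ?A T T) \<noteq> 0" using h[OF T T] by simp
    from sylvester_identity[OF this, of k i j]
    have "rat_of_int (det (list_mat N (T @ [k, i]) (T @ [k, j])) * det (list_mat N T T)) =
      rat_of_int (det (list_mat N (T @ [i]) (T @ [j])) * det (list_mat N (T @ [k]) (T @ [k])) -
        det (list_mat N (T @ [i]) (T @ [k])) * det (list_mat N (T @ [k]) (T @ [j])))"
      using T kij by (simp add: h)
    then have "det (list_mat N (T @ [k, i]) (T @ [k, j])) * det (list_mat N T T) =
      det (list_mat N (T @ [i]) (T @ [j])) * det (list_mat N (T @ [k]) (T @ [k])) -
        det (list_mat N (T @ [i]) (T @ [k])) * det (list_mat N (T @ [k]) (T @ [j]))"
      by (simp only: of_int_eq_iff)
    then show ?thesis using False by (metis nonzero_mult_div_cancel_right)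
  qed
qed

text \<open>The state consists of the previous pivot and the current matrix, row by row. The arguments
  are the order, the indicator of the index set, the state and the pivot index; the last argument of
  \<open>bareiss_entry\<close> is the position in the state.\<close>

definition bareiss_entry :: "word list \<Rightarrow> int" where
  "bareiss_entry ws =
    (if store_word (ws ! 4) 1 > 0 then
      (if (store_word (ws ! 4) 1 - 1) div store_word (ws ! 0) 1 - store_word (ws ! 3) 1 > 0 then
        (if (store_word (ws ! 4) 1 - 1) mod store_word (ws ! 0) 1 - store_word (ws ! 3) 1 > 0 then
          (store_word (ws ! 2) (store_word (ws ! 4) 1 + 1) *
             store_word (ws ! 2) (store_word (ws ! 3) 1 * store_word (ws ! 0) 1 + store_word (ws ! 3) 1 + 2) -
           store_word (ws ! 2) ((store_word (ws ! 4) 1 - 1) div store_word (ws ! 0) 1 * store_word (ws ! 0) 1 + store_word (ws ! 3) 1 + 2) *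
             store_word (ws ! 2) (store_word (ws ! 3) 1 * store_word (ws ! 0) 1 + (store_word (ws ! 4) 1 - 1) mod store_word (ws ! 0) 1 + 2))
          div store_word (ws ! 2) 1
        else 0) else 0)
    else store_word (ws ! 2) (store_word (ws ! 3) 1 * store_word (ws ! 0) 1 + store_word (ws ! 3) 1 + 2))"

text \<open>The length of the table is taken from the indicator word and not from the number in the
  first argument: a length is bounded by the input size on arbitrary arguments, whereas a number may
  be exponentially large. Indices outside the set are skipped, so exactly its elements become
  pivots.\<close>

definition bareiss_step :: "word list \<Rightarrow> word" where
  "bareiss_step ws =
    (if store_word (ws ! 1) (store_word (ws ! 3) 1 + 1) > 0
     then map (\<lambda>idx. bareiss_entry (ws @ [[int idx]])) [0..<length (ws ! 1) * length (ws ! 1) + 1]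
     else ws ! 2)"

lemma poly_comp_bareiss_entry: "poly_comp HH (args 5) (\<lambda>H ws. [bareiss_entry ws])"
  unfolding bareiss_entry_def by (intro poly_comp_rules[OF arity_args] poly_comp_int) auto

lemma poly_comp_bareiss_step: "poly_comp HH (args 4) (\<lambda>H ws. bareiss_step ws)"
proof -
  have len: "poly_comp HH (args 4) (\<lambda>H ws. [int (length (ws ! 1) * length (ws ! 1) + 1)])"
  proof -
    have "poly_comp HH (args 4) (\<lambda>H ws. [int (length (ws ! 1)) * int (length (ws ! 1)) + 1])"
      by (intro poly_comp_rules[OF arity_args] poly_comp_int) auto
    then show ?thesis by (simp add: algebra_simps)
  qed
  have len': "poly_bounded (args 4) (\<lambda>ws. length (ws ! 1) * length (ws ! 1) + 1)"
  proof -
    have "poly_bounded (args 4) (\<lambda>ws. length (ws ! 1))"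
    proof (rule poly_bounded_mono[OF poly_bounded_isz])
      fix ws :: "word list" assume "ws \<in> args 4"
      then show "length (ws ! 1) \<le> isz ws"
        using length_le_wsize[of "ws ! 1"] wsize_nth_le_isz[of 1 ws] by simp
    qed
    then show ?thesis by (intro poly_bounded_add poly_bounded_mult poly_bounded_const)
  qed
  have tab: "poly_comp HH (args 4) (\<lambda>H ws. map (\<lambda>i. bareiss_entry (ws @ [[int i]])) [0..<length (ws ! 1) * length (ws ! 1) + 1])"
    by (rule poly_comp_tabulate[OF arity_args _ poly_comp_bareiss_entry len len']) auto
  show ?thesis unfolding bareiss_step_def
    by (intro poly_comp_rules[OF arity_args] poly_comp_int tab) auto
qed

locale bareiss =
  fixes n :: nat and N :: "int mat" and S :: "nat set" and ind :: word and b :: nat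
  assumes N: "N \<in> carrier_mat n n" and psd: "psd_form n (map_mat rat_of_int N)"
    and ind: "length ind = n" "\<And>i. i < n \<Longrightarrow> ind ! i > 0 \<longleftrightarrow> i \<in> S"
    and b: "\<And>i j. i < n \<Longrightarrow> j < n \<Longrightarrow> isize (N $$ (i, j)) \<le> b"
begin

definition pivots :: "nat \<Rightarrow> nat list" where
  "pivots k = filter (\<lambda>i. i \<in> S) [0..<k]"

text \<open>The bound of \<open>isize_det_list_mat\<close> for minors of at most n + 1 rows: up to n
  pivots and one bordering index.\<close>

definition bound :: nat where
  "bound = (n + 3) ^ 2 + (n + 1) * (b + 2) + 2"

text \<open>The invariant of Bareiss elimination: cell 0 holds the pivot minor and the other cells
  its borderings by one row and one column. Cells with row or column index below \<open>k\<close>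
  are no longer read and carry no meaning, but their sizes still have to be bounded.\<close>

definition state_inv :: "nat \<Rightarrow> word \<Rightarrow> bool" where
  "state_inv k acc \<longleftrightarrow> length acc = n * n + 1 \<and> acc ! 0 = det (list_mat N (pivots k) (pivots k)) \<and>
    (\<forall>i j. k \<le> i \<longrightarrow> i < n \<longrightarrow> k \<le> j \<longrightarrow> j < n \<longrightarrow>
      acc ! (i * n + j + 1) = det (list_mat N (pivots k @ [i]) (pivots k @ [j]))) \<and>
    (\<forall>x \<in> set acc. isize x \<le> bound)"

lemma pivots: "set (pivots k) \<subseteq> {..<k}" "length (pivots k) \<le> k"
  using length_filter_le[of "\<lambda>i. i \<in> S" "[0..<k]"] by (auto simp: pivots_def)

lemma isize_minor:
  assumes "length xs = length ys" "length xs \<le> n + 1" "set xs \<subseteq> {..<n}" "set ys \<subseteq> {..<n}"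
  shows "isize (det (list_mat N xs ys)) \<le> bound"
proof -
  have "isize (det (list_mat N xs ys)) \<le> (length xs + 2) ^ 2 + length xs * (b + 2) + 2"
    using assms b by (intro isize_det_list_mat) auto
  also have "\<dots> \<le> (n + 3) ^ 2 + (n + 1) * (b + 2) + 2"
  proof -
    have "(length xs + 2) ^ 2 \<le> (n + 3) ^ 2" using assms(2) by (intro power_mono) auto
    moreover have "length xs * (b + 2) \<le> (n + 1) * (b + 2)" using assms(2) by (rule mult_le_mono1)
    ultimately show ?thesis by linarith
  qed
  finally show ?thesis by (simp add: bound_def)
qed

lemma entry_0: "k < n \<Longrightarrow> length acc = n * n + 1 \<Longrightarrow>
    bareiss_entry [[int n], ind, acc, [int k], [int 0]] = acc ! (k * n + k + 1)"
proof -
  assume k: "k < n" and l: "length acc = n * n + 1"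
  have "k * n + k < n * n" using k mult_le_mono1[of "Suc k" n n] by simp
  then have "store_word acc (int (k * n + k + 1) + 1) = acc ! (k * n + k + 1)" using l by (intro store_word_nth) simp
  then show ?thesis by (simp add: bareiss_entry_def algebra_simps)
qed

lemma entry_Suc:
  assumes k: "k < n" and ij: "i < n" "j < n" and l: "length acc = n * n + 1"
  shows "bareiss_entry [[int n], ind, acc, [int k], [int (i * n + j + 1)]] =
    (if k < i \<and> k < j then (acc ! (i * n + j + 1) * acc ! (k * n + k + 1) -
      acc ! (i * n + k + 1) * acc ! (k * n + j + 1)) div acc ! 0 else 0)"
proof -
  have rd: "store_word acc (int x * int n + int y + 2) = acc ! (x * n + y + 1)" if "x < n" "y < n" for x y
  proof -
    have "x * n + y < n * n" using that mult_le_mono1[of "Suc x" n n] by simp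
    then have "store_word acc (int (x * n + y + 1) + 1) = acc ! (x * n + y + 1)" using l by (intro store_word_nth) simp
    then show ?thesis by (simp add: algebra_simps)
  qed
  have r0: "store_word acc 1 = acc ! 0" using store_word_nth[of 0 acc] l by simp
  define m where "m = int (i * n + j + 1)"
  have m: "m = int (i * n + j) + 1" by (simp add: m_def)
  have dm: "(m - 1) div int n = int i" "(m - 1) mod int n = int j"
    using ij by (simp_all add: m zdiv_int[symmetric] zmod_int[symmetric] flip: of_nat_mult of_nat_add)
  have nn: "m + 1 = int i * int n + int j + 2" by (simp add: m)
  have pos: "m > 0" unfolding m_def by (simp only: of_nat_0_less_iff)
  show ?thesis
    unfolding bareiss_entry_def m_def[symmetric]
    using k ij by (simp add: rd r0 dm nn pos)
qed

lemma pivots_Suc: "pivots (Suc k) = (if k \<in> S then pivots k @ [k] else pivots k)"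
  by (simp add: pivots_def)

text \<open>For k in \<open>S\<close> the update is \<open>bareiss_identity\<close> with the
  previous pivots. The sizes are not estimated through the recurrence, where they would accumulate;
  they are bounded anew in every round because each tracked entry is a minor of \<open>N\<close> and
  all others are 0.\<close>

lemma step:
  assumes st: "state_inv k acc" and k: "k < n"
  shows "state_inv (Suc k) (bareiss_step [[int n], ind, acc, [int k]])"
proof -
  have l: "length acc = n * n + 1" using st by (simp add: state_inv_def)
  have rk: "store_word ind (int k + 1) = ind ! k" using ind(1) k by simp
  have T: "set (pivots k) \<subseteq> {..<n}" "length (pivots k) \<le> n" using pivots[of k] k by auto
  show ?thesis
  proof (cases "k \<in> S")
    case False
    then have "bareiss_step [[int n], ind, acc, [int k]] = acc"
      using ind(2)[OF k] rk by (simp add: bareiss_step_def)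
    moreover have "pivots (Suc k) = pivots k" using False by (simp add: pivots_Suc)
    ultimately show ?thesis using st unfolding state_inv_def by simp
  next
    case True
    define acc' where "acc' = map (\<lambda>idx. bareiss_entry [[int n], ind, acc, [int k], [int idx]]) [0..<n * n + 1]"
    have step: "bareiss_step [[int n], ind, acc, [int k]] = acc'"
      using True ind k rk unfolding bareiss_step_def acc'_def by simp
    have pv: "pivots (Suc k) = pivots k @ [k]" using True by (simp add: pivots_Suc)
    have val: "acc ! (i * n + j + 1) = det (list_mat N (pivots k @ [i]) (pivots k @ [j]))"
      if "k \<le> i" "i < n" "k \<le> j" "j < n" for i j using st that by (simp add: state_inv_def)
    have a0: "acc ! 0 = det (list_mat N (pivots k) (pivots k))" using st by (simp add: state_inv_def)
    have z: "acc' ! 0 = det (list_mat N (pivots (Suc k)) (pivots (Suc k)))"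
      using entry_0[OF k l] val[of k k] k pv unfolding acc'_def by (simp del: upt_Suc)
    have lt: "i * n + j + 1 < n * n + 1" if "i < n" "j < n" for i j
      using that mult_le_mono1[of "Suc i" n n] by simp
    have ent: "acc' ! (i * n + j + 1) = (if k < i \<and> k < j then
        det (list_mat N (pivots (Suc k) @ [i]) (pivots (Suc k) @ [j])) else 0)" if "i < n" "j < n" for i j
    proof -
      have "acc' ! (i * n + j + 1) = bareiss_entry [[int n], ind, acc, [int k], [int (i * n + j + 1)]]"
        using lt[OF that] unfolding acc'_def by (simp del: upt_Suc)
      also have "\<dots> = (if k < i \<and> k < j then
        det (list_mat N (pivots k @ [k, i]) (pivots k @ [k, j])) else 0)"
        unfolding entry_Suc[OF k that l] bareiss_identity[OF N psd T(1) k that]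
        using that k by (simp add: val a0 del: One_nat_def)
      finally show ?thesis unfolding pv by simp
    qed
    have mem: "isize x \<le> bound" if "x \<in> set acc'" for x
    proof -
      have "length acc' = n * n + 1" by (simp add: acc'_def)
      with that obtain idx where idx: "idx < n * n + 1" "x = acc' ! idx"
        unfolding in_set_conv_nth by auto
      have T': "set (pivots (Suc k)) \<subseteq> {..<n}" "length (pivots (Suc k)) \<le> n" using pivots[of "Suc k"] k by auto
      show ?thesis
      proof (cases idx)
        case 0
        then show ?thesis unfolding idx(2) using z T' by (simp add: isize_minor)
      next
        \<comment> \<open>Behind the pivot, position m + 1 of the state belongs to row m div n and
          column m mod n.\<close>
        case (Suc m)
        have mn: "m < n * n" using idx Suc by simp
        then have n0: "n > 0" by (cases n) auto
        have ij: "m div n < n" "m mod n < n" using mn n0 by (auto simp: less_mult_imp_div_less)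
        have "x = acc' ! (m div n * n + m mod n + 1)" using idx Suc by simp
        also have "isize \<dots> \<le> bound"
        proof -
          have "isize (det (list_mat N (pivots (Suc k) @ [m div n]) (pivots (Suc k) @ [m mod n]))) \<le> bound"
            using ij T' by (intro isize_minor) auto
          moreover have "isize 0 \<le> bound" by (simp add: bound_def)
          ultimately show ?thesis unfolding ent[OF ij] by simp
        qed
        finally show ?thesis .
      qed
    qed
    have "length acc' = n * n + 1" by (simp add: acc'_def)
    then show ?thesis unfolding step state_inv_def using z ent mem by auto
  qed
qed

lemma init:
  assumes "length acc = n * n + 1" "acc ! 0 = 1"
    "\<And>i j. i < n \<Longrightarrow> j < n \<Longrightarrow> acc ! (i * n + j + 1) = N $$ (i, j)"
  shows "state_inv 0 acc"
proof -
  have d: "det (list_mat N [i] [j]) = N $$ (i, j)" for i j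
    by (subst det_single) (auto simp: list_mat_def)
  have d0: "det (list_mat N [] []) = 1" by (simp add: list_mat_def)
  have "isize x \<le> bound" if "x \<in> set acc" for x
  proof -
    from that obtain idx where idx: "idx < n * n + 1" "x = acc ! idx"
      using assms(1) by (auto simp: in_set_conv_nth)
    show ?thesis
    proof (cases idx)
      case 0
      then show ?thesis using idx assms(2) isize_minor[of "[]" "[]"] d0 by simp
    next
      case (Suc m)
      have mn: "m < n * n" using idx Suc by simp
      then have n0: "n > 0" by (cases n) auto
      have ij: "m div n < n" "m mod n < n" using mn n0 by (auto simp: less_mult_imp_div_less)
      have "x = acc ! (m div n * n + m mod n + 1)" using idx Suc by simp
      also have "\<dots> = det (list_mat N [m div n] [m mod n])" using assms(3)[OF ij] d by simp
      also have "isize \<dots> \<le> bound" using ij by (intro isize_minor) auto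
      finally show ?thesis .
    qed
  qed
  then show ?thesis using assms d d0 by (simp add: state_inv_def pivots_def)
qed

lemma loop:
  assumes "state_inv 0 acc"
  shows "k \<le> n \<Longrightarrow> state_inv k (loop_state bareiss_step [[int n], ind] acc k)"
  by (induction k) (use assms step in auto)

lemma wsize_state: "state_inv k acc \<Longrightarrow> wsize acc \<le> (n * n + 1) * bound"
  using wsize_bound[of acc bound] by (simp add: state_inv_def)

end

section \<open>Testing a principal minor\<close>


definition entry_num :: "rat mat \<Rightarrow> nat \<Rightarrow> nat \<Rightarrow> int" where
  "entry_num A i j = fst (quotient_of (A $$ (i, j)))"

definition entry_den :: "rat mat \<Rightarrow> nat \<Rightarrow> nat \<Rightarrow> int" where
  "entry_den A i j = snd (quotient_of (A $$ (i, j)))"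

lemma entry_den_pos: "entry_den A i j > 0"
  using quotient_of_denom_pos' by (simp add: entry_den_def)

lemma entry_eq: "A $$ (i, j) = rat_of_int (entry_num A i j) / rat_of_int (entry_den A i j)"
  using quotient_of_div[of "A $$ (i, j)"] by (simp add: entry_num_def entry_den_def)

lemma concat_map_upt:
  "concat (map (\<lambda>i. map (f i) [0..<n]) [0..<m]) = map (\<lambda>x. f (x div n) (x mod n)) [0..<m * n]"
proof (induction m)
  case (Suc m)
  have "[0..<Suc m * n] = [0..<m * n] @ [m * n..<m * n + n]"
    using upt_add_eq_append[of 0 "m * n" n] by (simp add: add.commute)
  moreover have "map (\<lambda>x. f (x div n) (x mod n)) [m * n..<m * n + n] = map (f m) [0..<n]"
    by (rule nth_equalityI) auto
  ultimately show ?case using Suc by simp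
qed simp

lemma concat_pairs_nth:
  "i < n \<Longrightarrow> concat (map (\<lambda>x. [f x, g x]) [0..<n]) ! (2 * i) = f i \<and> concat (map (\<lambda>x. [f x, g x]) [0..<n]) ! (2 * i + 1) = g i"
  and concat_pairs_length: "length (concat (map (\<lambda>x. [f x, g x]) [0..<n])) = 2 * n"
proof -
  show len: "length (concat (map (\<lambda>x. [f x, g x]) [0..<n])) = 2 * n" for n by (induction n) auto
  show "i < n \<Longrightarrow> concat (map (\<lambda>x. [f x, g x]) [0..<n]) ! (2 * i) = f i \<and> concat (map (\<lambda>x. [f x, g x]) [0..<n]) ! (2 * i + 1) = g i"
  proof (induction n)
    case (Suc n)
    have split: "concat (map (\<lambda>x. [f x, g x]) [0..<Suc n]) = concat (map (\<lambda>x. [f x, g x]) [0..<n]) @ [f n, g n]"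
      by simp
    show ?case
    proof (cases "i = n")
      case True
      then show ?thesis unfolding split nth_append len by simp
    next
      case False
      then show ?thesis using Suc unfolding split nth_append len by simp
    qed
  qed simp
qed

lemma enc_mat_eq:
  assumes "A \<in> carrier_mat n n"
  shows "enc_mat A = int n # concat (map (\<lambda>x. [entry_num A (x div n) (x mod n), entry_den A (x div n) (x mod n)]) [0..<n * n])"
proof -
  have flat: "concat (map (\<lambda>i. concat (f i)) l) = concat (concat (map f l))" for f :: "nat \<Rightarrow> word list" and l
    by (induction l) auto
  have "concat (map (\<lambda>i. concat (map (\<lambda>j. enc_rat (A $$ (i, j))) [0..<n])) [0..<n])
    = concat (concat (map (\<lambda>i. map (\<lambda>j. enc_rat (A $$ (i, j))) [0..<n]) [0..<n]))"
    by (rule flat)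
  then show ?thesis using assms unfolding enc_mat_def concat_map_upt by (simp add: enc_rat_def entry_num_def entry_den_def)
qed

lemma enc_mat_length: "A \<in> carrier_mat n n \<Longrightarrow> length (enc_mat A) = 2 * (n * n) + 1"
  by (simp add: enc_mat_eq concat_pairs_length del: length_concat)

lemma enc_mat_nth:
  assumes A: "A \<in> carrier_mat n n" and ij: "i < n" "j < n"
  shows "enc_mat A ! (2 * (i * n + j) + 1) = entry_num A i j" "enc_mat A ! (2 * (i * n + j) + 2) = entry_den A i j"
proof -
  have "i * n + j < n * n" using ij mult_le_mono1[of "Suc i" n n] by simp
  from concat_pairs_nth[OF this, of "\<lambda>x. entry_num A (x div n) (x mod n)" "\<lambda>x. entry_den A (x div n) (x mod n)"]
  show "enc_mat A ! (2 * (i * n + j) + 1) = entry_num A i j" "enc_mat A ! (2 * (i * n + j) + 2) = entry_den A i j"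
    unfolding enc_mat_eq[OF A] using ij by simp_all
qed

lemma enc_mat_read:
  assumes A: "A \<in> carrier_mat n n" and x: "x < n * n"
  shows "store_word (enc_mat A) (2 * int x + 2) = entry_num A (x div n) (x mod n)"
    "store_word (enc_mat A) (2 * int x + 3) = entry_den A (x div n) (x mod n)"
    "store_word (enc_mat A) 1 = int n"
proof -
  have n0: "n > 0" using x by (cases n) auto
  have ij: "x div n < n" "x mod n < n" using x n0 by (auto simp: less_mult_imp_div_less)
  note nth = enc_mat_nth[OF A ij]
  have l: "2 * x + 2 < length (enc_mat A)" using x enc_mat_length[OF A] by simp
  have "store_word (enc_mat A) (int (2 * x + 1) + 1) = enc_mat A ! (2 * x + 1)" using l by (intro store_word_nth) simp
  then show "store_word (enc_mat A) (2 * int x + 2) = entry_num A (x div n) (x mod n)" using nth by (simp add: algebra_simps)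
  have "store_word (enc_mat A) (int (2 * x + 2) + 1) = enc_mat A ! (2 * x + 2)" using l by (intro store_word_nth) simp
  then show "store_word (enc_mat A) (2 * int x + 3) = entry_den A (x div n) (x mod n)" using nth by (simp add: algebra_simps)
  show "store_word (enc_mat A) 1 = int n" by (simp add: enc_mat_eq[OF A])
qed

lemma enc_mat_order: "A \<in> carrier_mat n n \<Longrightarrow> store_word (enc_mat A) 1 = int n"
  by (simp add: enc_mat_eq)

text \<open>Needed because the output of a sampler is a function of the matrix, while the machine
  sees only its encoding.\<close>

lemma enc_mat_inj:
  assumes A: "A \<in> carrier_mat n n" and B: "B \<in> carrier_mat m m" and eq: "enc_mat A = enc_mat B"
  shows "A = B"
proof -
  have nm: "n = m" using enc_mat_order[OF A] enc_mat_order[OF B] eq by simp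
  show ?thesis
  proof (rule eq_matI)
    fix i j assume "i < dim_row B" "j < dim_col B"
    then have ij: "i < n" "j < n" using B nm by auto
    show "A $$ (i, j) = B $$ (i, j)"
      using enc_mat_nth[OF A ij] enc_mat_nth[OF B ij[unfolded nm]] eq nm by (simp add: entry_eq)
  qed (use A B nm in auto)
qed

text \<open>The product of all denominators turns \<open>A\<close> into an integer matrix.\<close>

definition common_den :: "nat \<Rightarrow> rat mat \<Rightarrow> int" where
  "common_den n A = (\<Prod>x<n * n. entry_den A (x div n) (x mod n))"

definition int_mat :: "nat \<Rightarrow> rat mat \<Rightarrow> int mat" where
  "int_mat n A = mat n n (\<lambda>(i, j). entry_num A i j * (common_den n A div entry_den A i j))"

lemma common_den_pos: "common_den n A > 0"
  unfolding common_den_def by (intro prod_pos) (simp add: entry_den_pos)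

lemma of_int_int_mat:
  assumes A: "A \<in> carrier_mat n n"
  shows "map_mat rat_of_int (int_mat n A) = rat_of_int (common_den n A) \<cdot>\<^sub>m A"
proof (rule eq_matI)
  fix i j assume "i < dim_row (rat_of_int (common_den n A) \<cdot>\<^sub>m A)" "j < dim_col (rat_of_int (common_den n A) \<cdot>\<^sub>m A)"
  then have ij: "i < n" "j < n" using A by auto
  have "i * n + j < n * n" using ij mult_le_mono1[of "Suc i" n n] by simp
  then have "entry_den A ((i * n + j) div n) ((i * n + j) mod n) dvd common_den n A"
    unfolding common_den_def by (intro dvd_prodI) auto
  then have "entry_den A i j dvd common_den n A" using ij by simp
  then obtain q where q: "common_den n A = entry_den A i j * q" by blast
  have d: "entry_den A i j \<noteq> 0" using entry_den_pos[of A i j] by simp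
  show "map_mat rat_of_int (int_mat n A) $$ (i, j) = (rat_of_int (common_den n A) \<cdot>\<^sub>m A) $$ (i, j)"
    using ij A d by (simp add: int_mat_def q entry_eq[of A i j])
qed (use A in \<open>auto simp: int_mat_def\<close>)

lemma psd_form_smult:
  assumes A: "psd_form n A" and car: "A \<in> carrier_mat n n" and c: "c \<ge> 0"
  shows "psd_form n (c \<cdot>\<^sub>m A)"
proof -
  have "0 \<le> (\<Sum>a<m. \<Sum>b<m. z a * (c \<cdot>\<^sub>m A) $$ (x a, x b) * z b)" if x: "\<forall>a<m. x a < n" for m x and z :: "nat \<Rightarrow> rat"
  proof -
    have "(\<Sum>a<m. \<Sum>b<m. z a * (c \<cdot>\<^sub>m A) $$ (x a, x b) * z b) = c * (\<Sum>a<m. \<Sum>b<m. z a * A $$ (x a, x b) * z b)"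
      using x car by (simp add: sum_distrib_left mult_ac)
    then show ?thesis using A x c by (simp add: psd_form_def)
  qed
  then show ?thesis using A car by (simp add: psd_form_def)
qed

text \<open>Scaling the matrix multiplies a minor by one factor for each selected index below n, so
  the power depends on the set; the final test has to correct for it.\<close>

lemma det_int_mat:
  fixes S :: "nat set"
  assumes A: "A \<in> carrier_mat n n"
  defines "T \<equiv> filter (\<lambda>i. i \<in> S) [0..<n]"
  shows "real_of_int (det (list_mat (int_mat n A) T T)) = real_of_int (common_den n A) ^ length T * minor A S"
proof -
  have T: "set T \<subseteq> {..<n}" by (auto simp: T_def)
  have Ti: "T ! i < n" if "i < length T" for i using T nth_mem[OF that] by blast
  have N: "int_mat n A \<in> carrier_mat n n" by (simp add: int_mat_def)
  have "rat_of_int (det (list_mat (int_mat n A) T T)) = det (list_mat (rat_of_int (common_den n A) \<cdot>\<^sub>m A) T T)"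
    using of_int_det_list_mat[OF N T T] of_int_int_mat[OF A] by simp
  also have "list_mat (rat_of_int (common_den n A) \<cdot>\<^sub>m A) T T = rat_of_int (common_den n A) \<cdot>\<^sub>m list_mat A T T"
    using A Ti by (intro eq_matI) auto
  also have "det \<dots> = rat_of_int (common_den n A) ^ length T * det (list_mat A T T)" by simp
  also have "det (list_mat A T T) = det (submatrix A S S)" unfolding submatrix_eq_list_mat[OF A] T_def ..
  finally have "real_of_rat (rat_of_int (det (list_mat (int_mat n A) T T))) =
      real_of_rat (rat_of_int (common_den n A) ^ length T * det (submatrix A S S))" by simp
  then show ?thesis by (simp add: minor_def of_rat_mult of_rat_power)
qed

lemma minor_nonneg: "psd n A \<Longrightarrow> minor A S \<ge> 0"
proof -
  assume A: "psd n A"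
  then have car: "A \<in> carrier_mat n n" by (simp add: psd_def)
  show ?thesis unfolding minor_def submatrix_eq_list_mat[OF car]
    using psd_form_det_nonneg[OF psd_imp_psd_form[OF A]] by (simp add: subset_eq)
qed

section \<open>Machine computations on encoded matrices\<close>

definition psd_words :: "word set" where
  "psd_words = {enc_mat A | A n. psd n A}"

definition mat_order :: "word \<Rightarrow> nat" where
  "mat_order e = nat (store_word e 1)"

lemma psd_carrier: "psd n A \<Longrightarrow> A \<in> carrier_mat n n"
  by (simp add: psd_def)

lemma mat_order_enc: "psd n A \<Longrightarrow> mat_order (enc_mat A) = n"
  by (simp add: mat_order_def enc_mat_order[OF psd_carrier])

text \<open>The order is written in binary, but a genuine encoding also lists its n^2 entries, so n
  is bounded by the input size and may serve as a number of rounds or as an exponent.\<close>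

lemma poly_comp_mat_order:
  assumes D: "arity k D" "0 < k" and psd: "\<And>ws. ws \<in> D \<Longrightarrow> ws ! 0 \<in> psd_words"
  shows "poly_comp HH D (\<lambda>H ws. [int (mat_order (ws ! 0))])" (is ?c)
    and "poly_bounded D (\<lambda>ws. mat_order (ws ! 0) * mat_order (ws ! 0) + 1)" (is ?s)
    and "poly_bounded D (\<lambda>ws. mat_order (ws ! 0))" (is ?b)
proof -
  have "poly_comp HH D (\<lambda>H ws. [store_word (ws ! 0) 1])"
    by (rule poly_comp_scalar_nth[OF D])
  then show ?c
  proof (rule poly_comp_cong[rotated])
    fix H ws assume "ws \<in> D"
    then obtain A n where "ws ! 0 = enc_mat A" "psd n A" using psd unfolding psd_words_def by blast
    then show "[store_word (ws ! 0) 1] = [int (mat_order (ws ! 0))]"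
      by (simp add: mat_order_def enc_mat_order[OF psd_carrier])
  qed
  show s: ?s
  proof (rule poly_bounded_mono[OF poly_bounded_isz])
    fix ws assume ws: "ws \<in> D"
    then obtain A n where A: "ws ! 0 = enc_mat A" "psd n A" using psd unfolding psd_words_def by blast
    then have "mat_order (ws ! 0) * mat_order (ws ! 0) + 1 \<le> length (ws ! 0)"
      using mat_order_enc[OF A(2)] enc_mat_length[OF psd_carrier[OF A(2)]] by simp
    also have "\<dots> \<le> isz ws"
      using length_le_wsize[of "ws ! 0"] wsize_nth_le_isz[of 0 ws] arityD[OF D(1) ws] D(2) by simp
    finally show "mat_order (ws ! 0) * mat_order (ws ! 0) + 1 \<le> isz ws" .
  qed
  show ?b
  proof (rule poly_bounded_mono[OF s])
    show "mat_order (ws ! 0) \<le> mat_order (ws ! 0) * mat_order (ws ! 0) + 1" for ws :: "word list"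
      using le_square[of "mat_order (ws ! 0)"] by (rule trans_le_add1)
  qed
qed

lemma poly_comp_common_den:
  assumes D: "arity k D" "0 < k" and psd: "\<And>ws. ws \<in> D \<Longrightarrow> ws ! 0 \<in> psd_words"
  shows "poly_comp HH D (\<lambda>H ws. [\<Prod>x<mat_order (ws ! 0) * mat_order (ws ! 0). store_word (ws ! 0) (2 * int x + 3)])"
proof -
  let ?D = "{ws @ [v] | ws v. ws \<in> D}"
  let ?N = "\<lambda>ws :: word list. mat_order (ws ! 0) * mat_order (ws ! 0)"
  have ar: "arity (k + 1) ?D" using D by (auto simp: arity_def)
  have g: "poly_comp HH ?D (\<lambda>H ws. [store_word (ws ! 0) (2 * store_word (ws ! k) 1 + 3)])"
    by (intro poly_comp_rules[OF ar] poly_comp_int) auto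
  have "poly_comp HH D (\<lambda>H ws. [int (mat_order (ws ! 0)) * int (mat_order (ws ! 0))])"
    by (intro poly_comp_rules[OF D(1)] poly_comp_mat_order[OF D psd])
  then have N: "poly_comp HH D (\<lambda>H ws. [int (?N ws)])" by simp
  have N': "poly_bounded D ?N" by (rule poly_bounded_mono[OF poly_comp_mat_order(2)[OF D psd]]) (assumption, rule le_add1)
  have "poly_comp HH D (\<lambda>H ws. [\<Prod>i<?N ws. store_word ((ws @ [[int i]]) ! 0) (2 * store_word ((ws @ [[int i]]) ! k) 1 + 3)])"
    by (rule poly_comp_prod[OF D g N N']) auto
  then show ?thesis
  proof (rule poly_comp_cong[rotated])
    fix H ws assume ws: "ws \<in> D"
    have "(ws @ [v]) ! 0 = ws ! 0" "(ws @ [v]) ! k = v" for v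
      using arityD[OF D(1) ws] D(2) by (simp_all add: nth_append)
    then show "[\<Prod>i<?N ws. store_word ((ws @ [[int i]]) ! 0) (2 * store_word ((ws @ [[int i]]) ! k) 1 + 3)] =
        [\<Prod>x<?N ws. store_word (ws ! 0) (2 * int x + 3)]" by simp
  qed
qed

lemma common_den_eq:
  assumes "psd n A"
  shows "(\<Prod>x<mat_order (enc_mat A) * mat_order (enc_mat A). store_word (enc_mat A) (2 * int x + 3)) = common_den n A"
  unfolding mat_order_enc[OF assms] common_den_def
  using assms by (intro prod.cong) (auto simp: psd_def enc_mat_read)

text \<open>The entry 1 at position 0 is the determinant of the empty minor, the pivot before the
  first round. Matrix entry number i - 1 has its numerator in cell 2 i and its denominator in cell 2
  i + 1 of the encoding.\<close>

definition initial_state :: "word \<Rightarrow> int \<Rightarrow> word" where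
  "initial_state e d = map (\<lambda>i. if int i > 0 then store_word e (2 * int i) * (d div store_word e (2 * int i + 1)) else 1)
     [0..<mat_order e * mat_order e + 1]"

lemma poly_comp_initial_state:
  "poly_comp HH {[e, [d]] | e d. e \<in> psd_words} (\<lambda>H ws. initial_state (ws ! 0) (store_word (ws ! 1) 1))"
proof -
  let ?D = "{[e, [d]] | e d. e \<in> psd_words}"
  have ar: "arity 2 ?D" by (auto simp: arity_def)
  have psd: "ws ! 0 \<in> psd_words" if "ws \<in> ?D" for ws using that by auto
  have g: "poly_comp HH (args 3) (\<lambda>H ws. [if store_word (ws ! 2) 1 > 0 then store_word (ws ! 0) (2 * store_word (ws ! 2) 1)
      * (store_word (ws ! 1) 1 div store_word (ws ! 0) (2 * store_word (ws ! 2) 1 + 1)) else 1])"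
    by (intro poly_comp_rules[OF arity_args] poly_comp_int) auto
  have "poly_comp HH ?D (\<lambda>H ws. [int (mat_order (ws ! 0)) * int (mat_order (ws ! 0)) + 1])"
    by (intro poly_comp_rules[OF ar] poly_comp_int poly_comp_mat_order[OF ar _ psd]) auto
  then have N: "poly_comp HH ?D (\<lambda>H ws. [int (mat_order (ws ! 0) * mat_order (ws ! 0) + 1)])"
    by (simp add: algebra_simps)
  have "poly_comp HH ?D (\<lambda>H ws. map (\<lambda>i. if store_word ((ws @ [[int i]]) ! 2) 1 > 0
      then store_word ((ws @ [[int i]]) ! 0) (2 * store_word ((ws @ [[int i]]) ! 2) 1)
      * (store_word ((ws @ [[int i]]) ! 1) 1 div store_word ((ws @ [[int i]]) ! 0) (2 * store_word ((ws @ [[int i]]) ! 2) 1 + 1)) else 1)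
      [0..<mat_order (ws ! 0) * mat_order (ws ! 0) + 1])"
    by (rule poly_comp_tabulate[OF ar _ g N poly_comp_mat_order(2)[OF ar _ psd]]) auto
  then show ?thesis
    by (rule poly_comp_cong[rotated]) (auto simp: initial_state_def simp del: upt_Suc)
qed

lemma initial_state_eq:
  assumes "psd n A"
  defines "acc \<equiv> initial_state (enc_mat A) (common_den n A)"
  shows "length acc = n * n + 1" "acc ! 0 = 1"
    "\<And>i j. i < n \<Longrightarrow> j < n \<Longrightarrow> acc ! (i * n + j + 1) = int_mat n A $$ (i, j)"
proof -
  have A: "A \<in> carrier_mat n n" using assms by (simp add: psd_def)
  show "length acc = n * n + 1" by (simp add: acc_def initial_state_def mat_order_enc[OF assms(1)])
  show "acc ! 0 = 1" by (simp add: acc_def initial_state_def nth_append del: upt_Suc)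
  fix i j assume ij: "i < n" "j < n"
  have lt: "i * n + j < n * n" using ij mult_le_mono1[of "Suc i" n n] by simp
  have "acc ! (i * n + j + 1) = store_word (enc_mat A) (2 * int (i * n + j) + 2) *
      (common_den n A div store_word (enc_mat A) (2 * int (i * n + j) + 3))"
    using lt by (simp add: acc_def initial_state_def mat_order_enc[OF assms(1)] algebra_simps del: upt_Suc)
  also have "\<dots> = int_mat n A $$ (i, j)" using enc_mat_read(1,2)[OF A lt] ij by (simp add: int_mat_def)
  finally show "acc ! (i * n + j + 1) = int_mat n A $$ (i, j)" .
qed

text \<open>Counts the occurrences of i in w by arithmetic alone: 1 div (1 + d^2) is 1 for d = 0 and
  0 otherwise. This decides membership in a sampled list, in which elements may repeat.\<close>

definition hits :: "word \<Rightarrow> int \<Rightarrow> int" where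
  "hits w i = (\<Sum>j<length w. 1 div (1 + (store_word w (int j + 1) - i) * (store_word w (int j + 1) - i)))"

lemma hits_pos: "hits w i > 0 \<longleftrightarrow> i \<in> set w"
proof -
  have e: "1 div (1 + (x - i) * (x - i)) = (if x = i then 1 else 0)" for x :: int
  proof (cases "x = i")
    case False
    then have "(x - i) * (x - i) \<noteq> 0" by simp
    then have "(x - i) * (x - i) > 0" using zero_le_square[of "x - i"] by (rule le_neq_trans[OF _ not_sym, rotated])
    then have "1 < 1 + (x - i) * (x - i)" by linarith
    then have "1 div (1 + (x - i) * (x - i)) = 0" by (rule div_pos_pos_trivial[rotated]) (rule zero_le_one)
    then show ?thesis using False by simp
  qed simp
  have h: "hits w i = (\<Sum>j<length w. if w ! j = i then 1 else 0)"
    unfolding hits_def e by (intro sum.cong) auto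
  show ?thesis
  proof
    assume "hits w i > 0"
    show "i \<in> set w"
    proof (rule ccontr)
      assume "i \<notin> set w"
      then have "hits w i = 0" unfolding h by (intro sum.neutral) auto
      then show False using \<open>hits w i > 0\<close> by simp
    qed
  next
    assume "i \<in> set w"
    then obtain j where j: "j < length w" "w ! j = i" by (auto simp: in_set_conv_nth)
    then have "1 \<le> (\<Sum>j<length w. if w ! j = i then 1 else (0::int))"
      using member_le_sum[of j "{..<length w}" "\<lambda>j. if w ! j = i then 1 else (0::int)"] by simp
    then show "hits w i > 0" unfolding h by simp
  qed
qed

lemma poly_bounded_length: "arity k D \<Longrightarrow> i < k \<Longrightarrow> poly_bounded D (\<lambda>ws. length (ws ! i))"
proof (rule poly_bounded_mono[OF poly_bounded_isz])
  fix ws assume "arity k D" "i < k" "ws \<in> D"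
  then show "length (ws ! i) \<le> isz ws"
    using length_le_wsize[of "ws ! i"] wsize_nth_le_isz[of i ws] by (simp add: arityD)
qed

lemma poly_comp_hits: "poly_comp HH (args 2) (\<lambda>H ws. [hits (ws ! 0) (store_word (ws ! 1) 1)])"
proof -
  let ?x = "\<lambda>ws :: word list. store_word (ws ! 0) (store_word (ws ! 2) 1 + 1) - store_word (ws ! 1) 1"
  have g: "poly_comp HH (args 3) (\<lambda>H ws. [1 div (1 + ?x ws * ?x ws)])"
    by (intro poly_comp_rules[OF arity_args] poly_comp_int) auto
  have len: "poly_comp HH (args 2) (\<lambda>H ws. [int (length (ws ! 0))])"
    by (intro poly_comp_rules[OF arity_args]) auto
  have "poly_comp HH (args 2) (\<lambda>H ws. [\<Sum>i<length (ws ! 0). 1 div (1 + ?x (ws @ [[int i]]) * ?x (ws @ [[int i]]))])"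
    by (rule poly_comp_sum[OF arity_args _ g len poly_bounded_length[OF arity_args]]) auto
  then show ?thesis by (rule poly_comp_cong[rotated]) (auto simp: hits_def nth_append)
qed

definition indicator_word :: "nat \<Rightarrow> word \<Rightarrow> word" where
  "indicator_word n w = map (\<lambda>i. hits w (int i)) [0..<n]"

lemma poly_comp_indicator_word:
  "poly_comp HH {[e, w] | e w. e \<in> psd_words} (\<lambda>H ws. indicator_word (mat_order (ws ! 0)) (ws ! 1))"
proof -
  let ?D = "{[e, w] | e w. e \<in> psd_words}"
  have ar: "arity 2 ?D" by (auto simp: arity_def)
  have psd: "ws ! 0 \<in> psd_words" if "ws \<in> ?D" for ws using that by auto
  have ar3: "arity 3 (args 3)" "(1::nat) < 3" "(2::nat) < 3" by simp_all
  have g: "poly_comp HH (args 3) (\<lambda>H ws. [hits (ws ! 1) (store_word (ws ! 2) 1)])"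
    using poly_comp_call2[OF poly_comp_hits ar3(1) poly_comp_nth[OF ar3(1,2)] poly_comp_nth[OF ar3(1,3)]] .
  have "poly_comp HH ?D (\<lambda>H ws. map (\<lambda>i. hits ((ws @ [[int i]]) ! 1) (store_word ((ws @ [[int i]]) ! 2) 1)) [0..<mat_order (ws ! 0)])"
    by (rule poly_comp_tabulate[OF ar _ g poly_comp_mat_order(1)[OF ar _ psd] poly_comp_mat_order(3)[OF ar _ psd]]) auto
  then show ?thesis by (rule poly_comp_cong[rotated]) (auto simp: indicator_word_def)
qed


definition bareiss_det :: "word list \<Rightarrow> int" where
  "bareiss_det ws = store_word (loop_state bareiss_step [ws ! 0, ws ! 1] (ws ! 2) (length (ws ! 1))) 1"

text \<open>The domain on which elimination stays small. The entries of the integer matrix occur in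
  \<open>acc\<close>, so \<open>wsize acc\<close> bounds their sizes and makes the bound of the
  locale polynomial in the input.\<close>

definition bareiss_inputs :: "word list set" where
  "bareiss_inputs = {[[int n], ind, acc] | n ind acc. \<exists>N S. bareiss n N S ind (wsize acc) \<and>
     length acc = n * n + 1 \<and> acc ! 0 = 1 \<and> (\<forall>i < n. \<forall>j < n. acc ! (i * n + j + 1) = N $$ (i, j))}"

lemma poly_comp_bareiss_det: "poly_comp HH bareiss_inputs (\<lambda>H ws. [bareiss_det ws])"
proof -
  let ?D = bareiss_inputs
  have ar: "arity 3 ?D" by (auto simp: arity_def bareiss_inputs_def)
  \<comment> \<open>The loop passes the order, the indicator, the initial state, the current state
    and the counter; the initial state is dropped.\<close>
  let ?ii = "[0, 1, 3, 4 :: nat]"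
  let ?g = "\<lambda>H us. bareiss_step (map (\<lambda>i. us ! i) ?ii)"
  have g: "poly_comp HH (args 5) ?g"
    by (rule poly_comp_reindex[OF poly_comp_bareiss_step arity_args]) auto
  have N: "poly_comp HH ?D (\<lambda>H ws. [int (length (ws ! 1))])"
    by (intro poly_comp_rules[OF ar]) auto
  have N': "poly_bounded ?D (\<lambda>ws. length (ws ! 1))" by (rule poly_bounded_length[OF ar]) simp
  have w2: "poly_bounded ?D (\<lambda>ws. wsize (ws ! 2))"
    by (rule poly_bounded_wsize_nth) (use ar in \<open>auto simp: arity_def\<close>)
  \<comment> \<open>This is the bound of \<open>wsize_state\<close>, with n read off as the length
    of the indicator.\<close>
  let ?M = "\<lambda>ws :: word list. (length (ws ! 1) * length (ws ! 1) + 1) *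
    ((length (ws ! 1) + 3) ^ 2 + (length (ws ! 1) + 1) * (wsize (ws ! 2) + 2) + 2)"
  have M: "poly_bounded ?D ?M"
    by (intro poly_bounded_add poly_bounded_mult poly_bounded_power poly_bounded_const N' w2)
  have eq: "loop_state (?g H) ws (ws ! 2) j = loop_state bareiss_step [ws ! 0, ws ! 1] (ws ! 2) j"
    if "ws \<in> ?D" for H ws j
  proof (induction j)
    case (Suc j)
    have "map (\<lambda>i. (ws @ [a, c]) ! i) ?ii = [ws ! 0, ws ! 1, a, c]" for a c
      using arityD[OF ar that] by (simp add: nth_append)
    then show ?case using Suc by simp
  qed simp
  have "poly_comp HH ?D (\<lambda>H ws. loop_state (?g H) ws ((\<lambda>H ws. ws ! 2) H ws) (length (ws ! 1)))"
  proof (rule poly_comp_for[OF ar _ _ g N N' _ M])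
    show "poly_comp HH ?D (\<lambda>H ws. ws ! 2)" by (rule poly_comp_nth[OF ar]) simp
    fix H ws j assume ws: "ws \<in> ?D"
    show "ws @ [loop_state (?g H) ws (ws ! 2) j, [int j]] \<in> args 5" using arityD[OF ar ws] by simp
    assume j: "j \<le> length (ws ! 1)"
    from ws obtain n ind acc N S where in3: "ws = [[int n], ind, acc]" "bareiss n N S ind (wsize acc)"
      and i: "length acc = n * n + 1" "acc ! 0 = 1" "\<And>i j. i < n \<Longrightarrow> j < n \<Longrightarrow> acc ! (i * n + j + 1) = N $$ (i, j)"
      unfolding bareiss_inputs_def by blast
    interpret bareiss n N S ind "wsize acc" by (rule in3(2))
    have "state_inv j (loop_state bareiss_step [[int n], ind] acc j)"
    proof -
      have "ws ! 1 = ind" by (simp add: in3(1))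
      with j ind(1) have "j \<le> n" by simp
      then show ?thesis using loop[OF init[OF i], of j] by simp
    qed
    from wsize_state[OF this] show "wsize (loop_state (?g H) ws (ws ! 2) j) \<le> ?M ws"
      unfolding eq[OF ws] using in3(1) ind(1) by (simp add: bound_def)
  qed simp
  from poly_comp_read[OF ar this poly_comp_int[of _ _ 1]]
  show ?thesis by (rule poly_comp_cong[rotated]) (simp only: bareiss_det_def eq)
qed

lemma bareiss_det_eq:
  assumes "bareiss n N S ind (wsize acc)" "length acc = n * n + 1" "acc ! 0 = 1"
    "\<And>i j. i < n \<Longrightarrow> j < n \<Longrightarrow> acc ! (i * n + j + 1) = N $$ (i, j)"
  shows "bareiss_det [[int n], ind, acc] = det (list_mat N (filter (\<lambda>i. i \<in> S) [0..<n]) (filter (\<lambda>i. i \<in> S) [0..<n]))"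
proof -
  interpret bareiss n N S ind "wsize acc" by (rule assms(1))
  have inv: "state_inv n (loop_state bareiss_step [[int n], ind] acc n)"
    using loop[OF init[OF assms(2-4)]] by simp
  let ?acc = "loop_state bareiss_step [[int n], ind] acc n"
  have "?acc \<noteq> []" using inv by (auto simp: state_inv_def)
  then have "store_word ?acc 1 = ?acc ! 0" using store_word_nth[of 0 ?acc] by simp
  then show ?thesis using inv ind(1) by (simp add: bareiss_det_def state_inv_def pivots_def)
qed

definition den_of :: "word \<Rightarrow> int" where
  "den_of e = (\<Prod>x<mat_order e * mat_order e. store_word e (2 * int x + 3))"

text \<open>The power of d by the number of selected indices, written as a product along the
  indicator, so that this number need not be computed.\<close>

definition den_power :: "word \<Rightarrow> int \<Rightarrow> int" where
  "den_power ind d = (\<Prod>i<length ind. if store_word ind (int i + 1) > 0 then d else 1)"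

lemma poly_comp_den_power: "poly_comp HH (args 2) (\<lambda>H ws. [den_power (ws ! 0) (store_word (ws ! 1) 1)])"
proof -
  have g: "poly_comp HH (args 3) (\<lambda>H ws. [if store_word (ws ! 0) (store_word (ws ! 2) 1 + 1) > 0 then store_word (ws ! 1) 1 else 1])"
    by (intro poly_comp_rules[OF arity_args] poly_comp_int) auto
  have len: "poly_comp HH (args 2) (\<lambda>H ws. [int (length (ws ! 0))])"
    by (intro poly_comp_rules[OF arity_args]) auto
  have "poly_comp HH (args 2) (\<lambda>H ws. [\<Prod>i<length (ws ! 0). if store_word ((ws @ [[int i]]) ! 0) (store_word ((ws @ [[int i]]) ! 2) 1 + 1) > 0
      then store_word ((ws @ [[int i]]) ! 1) 1 else 1])"
    by (rule poly_comp_prod[OF arity_args _ g len poly_bounded_length[OF arity_args]]) auto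
  then show ?thesis by (rule poly_comp_cong[rotated]) (simp add: den_power_def nth_append cong: if_cong)
qed

text \<open>Tests whether the minor is at least (u/v)^n, with all denominators cleared: the computed
  determinant is the minor times \<open>den_power\<close>. Adding 1 turns the weak inequality
  between integers into the strict test against 0 that conditionals offer.\<close>

definition threshold :: "int \<Rightarrow> int \<Rightarrow> word \<Rightarrow> word \<Rightarrow> int" where
  "threshold u v e w =
    (let ind = indicator_word (mat_order e) w in
     if bareiss_det [[int (mat_order e)], ind, initial_state e (den_of e)] * v ^ mat_order e
        - u ^ mat_order e * den_power ind (den_of e) + 1 > 0 then 1 else 0)"

lemma den_of_enc: "psd n A \<Longrightarrow> den_of (enc_mat A) = common_den n A"
  unfolding den_of_def by (rule common_den_eq)

lemma bareiss_enc:
  assumes A: "psd n A"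
  shows "bareiss n (int_mat n A) (word_subset w) (indicator_word n w) (wsize (initial_state (enc_mat A) (common_den n A)))"
proof
  have car: "A \<in> carrier_mat n n" by (rule psd_carrier[OF A])
  show "int_mat n A \<in> carrier_mat n n" by (simp add: int_mat_def)
  show "psd_form n (map_mat rat_of_int (int_mat n A))"
    unfolding of_int_int_mat[OF car] using common_den_pos[of n A]
    by (intro psd_form_smult psd_imp_psd_form A car) simp
  show "length (indicator_word n w) = n" by (simp add: indicator_word_def)
  show "indicator_word n w ! i > 0 \<longleftrightarrow> i \<in> word_subset w" if "i < n" for i
    using that by (simp add: indicator_word_def hits_pos word_subset_def)
  show "isize (int_mat n A $$ (i, j)) \<le> wsize (initial_state (enc_mat A) (common_den n A))" if "i < n" "j < n" for i j
  proof -
    note s = initial_state_eq[OF A]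
    have "i * n + j + 1 < n * n + 1" using that mult_le_mono1[of "Suc i" n n] by simp
    then have "initial_state (enc_mat A) (common_den n A) ! (i * n + j + 1) \<in> set (initial_state (enc_mat A) (common_den n A))"
      using s(1) by (intro nth_mem) simp
    then show ?thesis using s(3)[OF that] isize_le_wsize by simp
  qed
qed

lemma threshold_eq:
  assumes A: "psd n A" and v: "v > 0"
  shows "threshold u v (enc_mat A) w = (if minor A (word_subset w) \<ge> (real_of_int u / real_of_int v) ^ n then 1 else 0)"
proof -
  let ?S = "word_subset w" and ?ind = "indicator_word n w" and ?d = "common_den n A"
  let ?T = "filter (\<lambda>i. i \<in> ?S) [0..<n]"
  let ?acc = "initial_state (enc_mat A) ?d"
  have det: "bareiss_det [[int n], ?ind, ?acc] = det (list_mat (int_mat n A) ?T ?T)"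
    by (rule bareiss_det_eq[OF bareiss_enc[OF A] initial_state_eq[OF A]])
  have "den_power ?ind ?d = (\<Prod>i<n. if i \<in> ?S then ?d else 1)"
    unfolding den_power_def by (intro prod.cong) (auto simp: indicator_word_def hits_pos word_subset_def)
  also have "\<dots> = ?d ^ length ?T"
  proof -
    have "(\<Prod>i<m. if i \<in> ?S then d else 1) = d ^ length (filter (\<lambda>i. i \<in> ?S) [0..<m])" for m and d :: int
      by (induction m) auto
    then show ?thesis .
  qed
  finally have pw: "den_power ?ind ?d = ?d ^ length ?T" .
  let ?m = "minor A ?S"
  have d: "real_of_int ?d ^ length ?T > 0" using common_den_pos[of n A] by simp
  have vn: "real_of_int v ^ n > 0" using v by simp
  have "u ^ n * ?d ^ length ?T \<le> det (list_mat (int_mat n A) ?T ?T) * v ^ n \<longleftrightarrow>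
    real_of_int (u ^ n * ?d ^ length ?T) \<le> real_of_int (det (list_mat (int_mat n A) ?T ?T) * v ^ n)"
    by (simp only: of_int_le_iff)
  also have "\<dots> \<longleftrightarrow> real_of_int u ^ n * real_of_int ?d ^ length ?T \<le> (?m * real_of_int v ^ n) * real_of_int ?d ^ length ?T"
    using det_int_mat[OF psd_carrier[OF A], of ?S] by (simp add: mult_ac)
  also have "\<dots> \<longleftrightarrow> real_of_int u ^ n \<le> ?m * real_of_int v ^ n"
    using d by (rule mult_le_cancel_right_pos)
  also have "\<dots> \<longleftrightarrow> (real_of_int u / real_of_int v) ^ n \<le> ?m"
    using vn by (simp add: power_divide pos_divide_le_eq)
  finally have iff: "u ^ n * ?d ^ length ?T \<le> det (list_mat (int_mat n A) ?T ?T) * v ^ n \<longleftrightarrow>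
    (real_of_int u / real_of_int v) ^ n \<le> ?m" .
  show ?thesis
    unfolding threshold_def Let_def mat_order_enc[OF A] den_of_enc[OF A] det pw iff[symmetric] by simp
qed

lemma poly_comp_threshold:
  "poly_comp HH {[e, w] | e w. e \<in> psd_words} (\<lambda>H ws. [threshold u v (ws ! 0) (ws ! 1)])"
proof -
  let ?D = "{[e, w] | e w. e \<in> psd_words}"
  have ar: "arity 2 ?D" by (auto simp: arity_def)
  have psd: "ws ! 0 \<in> psd_words" if "ws \<in> ?D" for ws using that by auto
  have n: "poly_comp HH ?D (\<lambda>H ws. [int (mat_order (ws ! 0))])" "poly_bounded ?D (\<lambda>ws. mat_order (ws ! 0))"
    using poly_comp_mat_order(1,3)[OF ar _ psd] by auto
  have e: "poly_comp HH ?D (\<lambda>H ws. ws ! 0)" by (rule poly_comp_nth[OF ar]) simp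
  have d: "poly_comp HH ?D (\<lambda>H ws. [den_of (ws ! 0)])"
    unfolding den_of_def by (rule poly_comp_common_den[OF ar _ psd]) auto
  have ind: "poly_comp HH ?D (\<lambda>H ws. indicator_word (mat_order (ws ! 0)) (ws ! 1))"
    by (rule poly_comp_indicator_word)
  have acc: "poly_comp HH ?D (\<lambda>H ws. initial_state (ws ! 0) (den_of (ws ! 0)))"
    using poly_comp_call[OF poly_comp_initial_state ar, of "[\<lambda>H ws. ws ! 0, \<lambda>H ws. [den_of (ws ! 0)]]" HH] e d psd
    by auto
  have det: "poly_comp HH ?D (\<lambda>H ws. [bareiss_det [[int (mat_order (ws ! 0))], indicator_word (mat_order (ws ! 0)) (ws ! 1),
      initial_state (ws ! 0) (den_of (ws ! 0))]])"
  proof -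
    let ?gs = "[\<lambda>H ws. [int (mat_order (ws ! 0))], \<lambda>H ws. indicator_word (mat_order (ws ! 0)) (ws ! 1),
      \<lambda>H ws. initial_state (ws ! 0) (den_of (ws ! 0))] :: ((word \<Rightarrow> word) \<Rightarrow> word list \<Rightarrow> word) list"
    have "poly_comp HH ?D (\<lambda>H ws. [bareiss_det (map (\<lambda>g. g H ws) ?gs)])"
    proof (rule poly_comp_call[OF poly_comp_bareiss_det ar])
      show "poly_comp HH ?D g" if "g \<in> set ?gs" for g using that n(1) ind acc by auto
      fix H ws assume "ws \<in> ?D"
      then obtain A n w where ws: "ws = [enc_mat A, w]" "psd n A" unfolding psd_words_def by blast
      show "map (\<lambda>g. g H ws) ?gs \<in> bareiss_inputs"
        unfolding bareiss_inputs_def ws(1)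
        using bareiss_enc[OF ws(2), of w] initial_state_eq[OF ws(2)]
        by (auto simp: mat_order_enc[OF ws(2)] den_of_enc[OF ws(2)])
    qed
    then show ?thesis by simp
  qed
  have pw: "poly_comp HH ?D (\<lambda>H ws. [den_power (indicator_word (mat_order (ws ! 0)) (ws ! 1)) (den_of (ws ! 0))])"
    using poly_comp_call2[OF poly_comp_den_power ar ind d] by simp
  have powr: "poly_comp HH ?D (\<lambda>H ws. [c ^ mat_order (ws ! 0)])" for c
    by (rule poly_comp_power[OF ar _ poly_comp_int n]) simp
  show ?thesis unfolding threshold_def Let_def
    by (intro poly_comp_rules[OF ar] poly_comp_int det pw powr)
qed


section \<open>Partially determined witnesses\<close>

text \<open>The instance \<open>partial_input x s\<close> asks whether the entries 2 of \<open>s\<close> can be replaced by bits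
  so that \<open>s\<close> becomes a witness for \<open>x\<close>.\<close>

definition partial_input :: "word \<Rightarrow> word \<Rightarrow> word" where
  "partial_input x s = int (length x) # x @ s"

text \<open>The remainder changes nothing on genuine instances, where the stored number is below the
  modulus. On arbitrary words it forces the value down to at most the length of the word, so that
  the verifier is polynomial on all inputs.\<close>

definition input_length :: "word \<Rightarrow> nat" where
  "input_length y = nat (store_word y 1 mod (int (length y) + 1))"

definition input_part :: "word \<Rightarrow> word" where
  "input_part y = map (\<lambda>i. store_word y (int i + 2)) [0..<input_length y]"

text \<open>An open entry takes the bit of w at its own position, so bits at determined positions
  and beyond the end are ignored, and no count of the open entries is required.\<close>

definition filled_part :: "word \<Rightarrow> word \<Rightarrow> word" where
  "filled_part y w = map (\<lambda>i. if store_word y (int (input_length y) + int i + 2) - 1 > 0 then store_word w (int i + 1)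
     else store_word y (int (input_length y) + int i + 2)) [0..<length y - 1 - input_length y]"

lemma input_length_le: "input_length y \<le> length y"
proof -
  have "store_word y 1 mod (int (length y) + 1) < int (length y) + 1" by (rule pos_mod_bound) simp
  then show ?thesis by (simp add: input_length_def)
qed

lemma poly_comp_input_length:
  assumes D: "arity k D" "0 < k"
  shows "poly_comp HH D (\<lambda>H ws. [int (input_length (ws ! 0))])" "poly_bounded D (\<lambda>ws. input_length (ws ! 0))"
proof -
  have "poly_comp HH D (\<lambda>H ws. [store_word (ws ! 0) 1 mod (int (length (ws ! 0)) + 1)])"
    by (intro poly_comp_rules[OF D(1)] poly_comp_int D)
  then show "poly_comp HH D (\<lambda>H ws. [int (input_length (ws ! 0))])"
    by (simp add: input_length_def)
  show "poly_bounded D (\<lambda>ws. input_length (ws ! 0))"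
    by (rule poly_bounded_mono[OF poly_bounded_length[OF D]]) (rule input_length_le)
qed

lemma poly_comp_input_part: "poly_comp HH (args 2) (\<lambda>H ws. input_part (ws ! 0))"
proof -
  have g: "poly_comp HH (args 3) (\<lambda>H ws. [store_word (ws ! 0) (store_word (ws ! 2) 1 + 2)])"
    by (intro poly_comp_rules[OF arity_args] poly_comp_int) auto
  have "poly_comp HH (args 2) (\<lambda>H ws. map (\<lambda>i. store_word ((ws @ [[int i]]) ! 0) (store_word ((ws @ [[int i]]) ! 2) 1 + 2)) [0..<input_length (ws ! 0)])"
    by (rule poly_comp_tabulate[OF arity_args _ g poly_comp_input_length[OF arity_args]]) auto
  then show ?thesis by (rule poly_comp_cong[rotated]) (simp add: input_part_def nth_append)
qed

lemma poly_comp_filled_part: "poly_comp HH (args 2) (\<lambda>H ws. filled_part (ws ! 0) (ws ! 1))"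
proof -
  let ?N = "\<lambda>ws :: word list. length (ws ! 0) - 1 - input_length (ws ! 0)"
  let ?y = "\<lambda>ws :: word list. store_word (ws ! 0) (int (input_length (ws ! 0)) + store_word (ws ! 2) 1 + 2)"
  have il: "poly_comp HH (args 3) (\<lambda>H ws. [int (input_length (ws ! 0))])"
    "poly_comp HH (args 2) (\<lambda>H ws. [int (input_length (ws ! 0))])"
    by (intro poly_comp_input_length[OF arity_args]; simp)+
  have g: "poly_comp HH (args 3) (\<lambda>H ws. [if ?y ws - 1 > 0 then store_word (ws ! 1) (store_word (ws ! 2) 1 + 1) else ?y ws])"
    by (intro poly_comp_rules[OF arity_args] poly_comp_int il) auto
  let ?z = "\<lambda>ws :: word list. int (length (ws ! 0)) - 1 - int (input_length (ws ! 0))"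
  have "poly_comp HH (args 2) (\<lambda>H ws. [if ?z ws > 0 then ?z ws else 0])"
    by (intro poly_comp_rules[OF arity_args] poly_comp_int il) auto
  then have N: "poly_comp HH (args 2) (\<lambda>H ws. [int (?N ws)])"
  proof (rule poly_comp_cong[rotated])
    fix H and ws :: "word list"
    have "(if ?z ws > 0 then ?z ws else 0) = int (?N ws)" by auto
    then show "[if ?z ws > 0 then ?z ws else 0] = [int (?N ws)]" by simp
  qed
  have "poly_bounded (args 2) (\<lambda>ws. length (ws ! 0))" by (rule poly_bounded_length[OF arity_args]) simp
  then have N': "poly_bounded (args 2) ?N" by (rule poly_bounded_mono) simp
  have "poly_comp HH (args 2) (\<lambda>H ws. map (\<lambda>i. if ?y (ws @ [[int i]]) - 1 > 0
      then store_word ((ws @ [[int i]]) ! 1) (store_word ((ws @ [[int i]]) ! 2) 1 + 1) else ?y (ws @ [[int i]])) [0..<?N ws])"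
    by (rule poly_comp_tabulate[OF arity_args _ g N N']) auto
  then show ?thesis by (rule poly_comp_cong[rotated]) (simp add: filled_part_def nth_append cong: if_cong)
qed

lemma partial_input_parts:
  shows input_length_partial: "input_length (partial_input x s) = length x"
    and input_part_partial: "input_part (partial_input x s) = x"
    and filled_part_partial: "filled_part (partial_input x s) w = map (\<lambda>i. if s ! i > 1 then store_word w (int i + 1) else s ! i) [0..<length s]"
proof -
  let ?y = "partial_input x s"
  show l: "input_length ?y = length x" by (simp add: input_length_def partial_input_def)
  have rd: "store_word ?y (int i + 2) = (x @ s) ! i" if "i < length (x @ s)" for i
  proof -
    have "store_word ?y (int (Suc i) + 1) = ?y ! Suc i" using that by (intro store_word_nth) (simp add: partial_input_def)
    then show ?thesis by (simp add: partial_input_def algebra_simps)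
  qed
  show "input_part ?y = x"
    unfolding input_part_def l by (rule nth_equalityI) (use rd in \<open>auto simp: nth_append\<close>)
  have rd2: "store_word ?y (int (length x) + int i + 2) = s ! i" if "i < length s" for i
    using rd[of "length x + i"] that by (simp add: nth_append)
  have "length ?y - 1 - length x = length s" by (simp add: partial_input_def)
  then show "filled_part ?y w = map (\<lambda>i. if s ! i > 1 then store_word w (int i + 1) else s ! i) [0..<length s]"
    unfolding filled_part_def l by (auto simp: rd2)
qed

definition partial_verifier :: "(word \<Rightarrow> word \<Rightarrow> word) \<Rightarrow> word \<Rightarrow> word \<Rightarrow> word" where
  "partial_verifier V y w = V (input_part y) (filled_part y w)"

text \<open>A witness of \<open>wsize y\<close> bits has a bit for every position of y; the surplus
  is ignored by \<open>filled_part\<close>.\<close>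

definition partial_language :: "(word \<Rightarrow> word \<Rightarrow> word) \<Rightarrow> word set" where
  "partial_language V = {y. \<exists>w \<in> bit_words (wsize y). partial_verifier V y w = [1]}"

lemma polytime_partial_verifier:
  assumes "polytime2 V"
  shows "polytime2 (partial_verifier V)"
proof (rule polytime2I)
  have V: "poly_comp {no_help} (args 2) (\<lambda>H ws. V (ws ! 0) (ws ! 1))"
    by (rule poly_comp_polytime2[OF assms]) simp
  show "poly_comp {no_help} (args 2) (\<lambda>H ws. partial_verifier V (ws ! 0) (ws ! 1))"
    unfolding partial_verifier_def
    by (rule poly_comp_call2[OF V arity_args poly_comp_input_part poly_comp_filled_part])
qed

lemma partial_language_NP: "polytime2 V \<Longrightarrow> partial_language V \<in> NP_class"
  unfolding NP_class_def partial_language_def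
  \<comment> \<open>The polynomial \<open>[:0, 1:]\<close> is the identity, matching witnesses of
    length \<open>wsize y\<close>.\<close>
  by (intro CollectI exI[of _ "partial_verifier V"] exI[of _ "[:0, 1:]"]) (simp add: polytime_partial_verifier)

lemma bit_words_append: "u \<in> bit_words i \<Longrightarrow> z \<in> bit_words j \<Longrightarrow> u @ z \<in> bit_words (i + j)"
  by (auto simp: bit_words_def)

text \<open>The continuation z corresponds to the bits j to j + r - 1 of the longer witness w. In
  one direction it is cut out of w, in the other w is padded with zeros.\<close>

lemma partial_language_iff:
  assumes u: "u \<in> bit_words j"
  shows "partial_input x (u @ replicate r 2) \<in> partial_language V \<longleftrightarrow> (\<exists>z \<in> bit_words r. V x (u @ z) = [1])"
proof -
  let ?s = "u @ replicate r 2"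
  let ?y = "partial_input x ?s"
  have lu: "length u = j" and su: "set u \<subseteq> {0, 1}" using u by (simp_all add: bit_words_def)
  have u01: "\<not> u ! i > 1" if "i < j" for i
    using subsetD[OF su nth_mem[of i u]] that lu by auto
  have fill: "filled_part ?y w = u @ take r (drop j w)" if "j + r \<le> length w" for w
  proof (rule nth_equalityI)
    show "length (filled_part ?y w) = length (u @ take r (drop j w))"
      using that lu by (simp add: filled_part_partial)
    fix i assume "i < length (filled_part ?y w)"
    then have i: "i < j + r" using lu by (simp add: filled_part_partial)
    then have rw: "store_word w (int i + 1) = w ! i" using that by (intro store_word_nth) simp
    show "filled_part ?y w ! i = (u @ take r (drop j w)) ! i"
    proof (cases "i < j")
      case True
      then show ?thesis using i lu u01[OF True] by (simp add: filled_part_partial nth_append)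
    next
      case False
      then show ?thesis using i lu rw that by (simp add: filled_part_partial nth_append)
    qed
  qed
  have ly: "j + r \<le> wsize ?y"
    using length_le_wsize[of ?y] lu by (simp add: partial_input_def)
  show ?thesis
  proof
    assume "?y \<in> partial_language V"
    then obtain w where w: "w \<in> bit_words (wsize ?y)" and "partial_verifier V ?y w = [1]"
      unfolding partial_language_def by blast
    then have Vw: "V x (filled_part ?y w) = [1]"
      unfolding partial_verifier_def input_part_partial by simp
    have lw: "j + r \<le> length w" using w ly by (simp add: bit_words_def)
    have "take r (drop j w) \<in> bit_words r"
    proof -
      have "set (take r (drop j w)) \<subseteq> set w" using set_take_subset set_drop_subset by fastforce
      moreover have "length (take r (drop j w)) = r" using lw by simp
      ultimately show ?thesis using w unfolding bit_words_def by (simp only: mem_Collect_eq) blast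
    qed
    moreover have "V x (u @ take r (drop j w)) = [1]" using Vw unfolding fill[OF lw] .
    ultimately show "\<exists>z \<in> bit_words r. V x (u @ z) = [1]" by (rule bexI[rotated])
  next
    assume "\<exists>z \<in> bit_words r. V x (u @ z) = [1]"
    then obtain z where z: "z \<in> bit_words r" "V x (u @ z) = [1]" by blast
    define w where "w = u @ z @ replicate (wsize ?y - (j + r)) 0"
    have "replicate (wsize ?y - (j + r)) 0 \<in> bit_words (wsize ?y - (j + r))"
      by (simp add: bit_words_def set_replicate_conv_if)
    from bit_words_append[OF u bit_words_append[OF z(1) this]] have w: "w \<in> bit_words (wsize ?y)"
      using ly by (simp add: w_def)
    have "filled_part ?y w = u @ z"
      using fill[of w] z(1) lu by (simp add: w_def bit_words_def)
    then have "partial_verifier V ?y w = [1]"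
      unfolding partial_verifier_def input_part_partial using z(2) by simp
    with w show "?y \<in> partial_language V" unfolding partial_language_def by blast
  qed
qed

definition initial_input :: "nat poly \<Rightarrow> word \<Rightarrow> word" where
  "initial_input q x = partial_input x (replicate (poly q (wsize x)) 2)"

lemma poly_comp_witness_length:
  "poly_comp HH (args 1) (\<lambda>H ws. [int (poly q (wsize (ws ! 0)))])" "poly_bounded (args 1) (\<lambda>ws. poly q (wsize (ws ! 0)))"
proof -
  show "poly_comp HH (args 1) (\<lambda>H ws. [int (poly q (wsize (ws ! 0)))])"
    by (rule poly_comp_poly[OF arity_args poly_comp_wsize_fun])
  show "poly_bounded (args 1) (\<lambda>ws. poly q (wsize (ws ! 0)))"
    by (intro poly_bounded_poly poly_bounded_wsize_nth) simp
qed

lemma poly_comp_initial_input: "poly_comp HH (args 1) (\<lambda>H ws. initial_input q (ws ! 0))"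
proof -
  let ?N = "\<lambda>ws :: word list. 1 + length (ws ! 0) + poly q (wsize (ws ! 0))"
  let ?i = "\<lambda>ws :: word list. store_word (ws ! 1) 1"
  let ?g = "\<lambda>ws :: word list. if ?i ws > 0 then (if int (length (ws ! 0)) + 1 - ?i ws > 0 then store_word (ws ! 0) (?i ws) else 2)
      else int (length (ws ! 0))"
  have g: "poly_comp HH (args 2) (\<lambda>H ws. [?g ws])"
    by (intro poly_comp_rules[OF arity_args] poly_comp_int) auto
  have "poly_comp HH (args 1) (\<lambda>H ws. [1 + int (length (ws ! 0)) + int (poly q (wsize (ws ! 0)))])"
    by (intro poly_comp_rules[OF arity_args] poly_comp_int poly_comp_witness_length) auto
  then have N: "poly_comp HH (args 1) (\<lambda>H ws. [int (?N ws)])" by (simp add: add.assoc)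
  have N': "poly_bounded (args 1) ?N"
    by (intro poly_bounded_add poly_bounded_const poly_bounded_length[OF arity_args] poly_comp_witness_length) simp
  have "poly_comp HH (args 1) (\<lambda>H ws. map (\<lambda>i. ?g (ws @ [[int i]])) [0..<?N ws])"
    by (rule poly_comp_tabulate[OF arity_args _ g N N']) auto
  then show ?thesis
  proof (rule poly_comp_cong[rotated])
    fix H :: "word \<Rightarrow> word" and ws :: "word list" assume "ws \<in> args 1"
    then obtain x where ws: "ws = [x]" by (auto simp: length_Suc_conv)
    show "map (\<lambda>i. ?g (ws @ [[int i]])) [0..<?N ws] = initial_input q (ws ! 0)"
    proof (rule nth_equalityI)
      show "length (map (\<lambda>i. ?g (ws @ [[int i]])) [0..<?N ws]) = length (initial_input q (ws ! 0))"
        by (simp add: ws initial_input_def partial_input_def)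
      fix i assume "i < length (map (\<lambda>i. ?g (ws @ [[int i]])) [0..<?N ws])"
      then have i: "i < 1 + length x + poly q (wsize x)" by (simp add: ws)
      have "map (\<lambda>i. ?g (ws @ [[int i]])) [0..<?N ws] ! i = ?g (ws @ [[int i]])" using i by (simp add: ws del: upt_Suc)
      also have "\<dots> = initial_input q x ! i"
      proof (cases i)
        case 0
        then show ?thesis by (simp add: ws initial_input_def partial_input_def)
      next
        case (Suc m)
        show ?thesis
        proof (cases "m < length x")
          case True
          then show ?thesis using Suc store_word_nth[of m x] by (simp add: ws initial_input_def partial_input_def nth_append add.commute)
        next
          case False
          then show ?thesis using Suc i by (simp add: ws initial_input_def partial_input_def nth_append)
        qed
      qed
      finally show "map (\<lambda>i. ?g (ws @ [[int i]])) [0..<?N ws] ! i = initial_input q (ws ! 0) ! i" by (simp add: ws)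
    qed
  qed
qed


section \<open>Hardness of approximation\<close>

lemma poly_comp_order_power:
  "poly_comp HH {[e, b] | e b. e \<in> psd_words} (\<lambda>H ws. [store_word (ws ! 1) 1 ^ mat_order (ws ! 0)])"
proof -
  let ?D = "{[e, b] | e b. e \<in> psd_words}"
  have ar: "arity 2 ?D" by (auto simp: arity_def)
  have psd: "ws ! 0 \<in> psd_words" if "ws \<in> ?D" for ws using that by auto
  have x: "poly_comp HH ?D (\<lambda>H ws. [store_word (ws ! 1) 1])" by (rule poly_comp_scalar_nth[OF ar]) simp
  show ?thesis
    by (rule poly_comp_power[OF ar _ x poly_comp_mat_order(1)[OF ar _ psd] poly_comp_mat_order(3)[OF ar _ psd]]) auto
qed

text \<open>Compares the \<open>n\<close>-th roots of two estimates: cells 1 and 2 hold the numerator and the denominator.\<close>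

definition prefer_first :: "word \<Rightarrow> word \<Rightarrow> word \<Rightarrow> word \<Rightarrow> int" where
  "prefer_first e h e' h' = int (mat_order e') *
     (store_word h 1 ^ mat_order e' * store_word h' 2 ^ mat_order e -
      store_word h' 1 ^ mat_order e * store_word h 2 ^ mat_order e' + 1)"

lemma poly_comp_prefer_first:
  assumes D: "arity k D"
    and e: "poly_comp HH D e" "poly_comp HH D e'" "\<And>H ws. H \<in> HH \<Longrightarrow> ws \<in> D \<Longrightarrow> e H ws \<in> psd_words \<and> e' H ws \<in> psd_words"
    and h: "poly_comp HH D h" "poly_comp HH D h'"
  shows "poly_comp HH D (\<lambda>H ws. [prefer_first (e H ws) (h H ws) (e' H ws) (h' H ws)])"
proof -
  have pw: "poly_comp HH D (\<lambda>H ws. [b H ws ^ mat_order (d H ws)])"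
    if "poly_comp HH D (\<lambda>H ws. [b H ws])" "poly_comp HH D d" "\<And>H ws. H \<in> HH \<Longrightarrow> ws \<in> D \<Longrightarrow> d H ws \<in> psd_words" for b d
    using poly_comp_call[OF poly_comp_order_power D, of "[d, \<lambda>H ws. [b H ws]]" HH] that by auto
  have ord: "poly_comp HH D (\<lambda>H ws. [int (mat_order (e' H ws))])"
  proof -
    have ar: "arity 1 {[e] | e. e \<in> psd_words}" by (auto simp: arity_def)
    have psd: "ws ! 0 \<in> psd_words" if "ws \<in> {[e] | e. e \<in> psd_words}" for ws using that by auto
    have "poly_comp HH {[e] | e. e \<in> psd_words} (\<lambda>H ws. [int (mat_order (ws ! 0))])"
      by (rule poly_comp_mat_order(1)[OF ar _ psd]) auto
    from poly_comp_call[OF this D, of "[e']"] e show ?thesis by auto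
  qed
  show ?thesis unfolding prefer_first_def
    by (intro poly_comp_rules[OF D] poly_comp_int pw ord e h) (use e(3) in auto)
qed

section \<open>Bitwise search for a witness\<close>

definition select_bit :: "(word \<Rightarrow> word) \<Rightarrow> (word \<Rightarrow> word) \<Rightarrow> word \<Rightarrow> nat \<Rightarrow> word" where
  "select_bit f H y p =
     (if prefer_first (f (y[p := 0])) (H (f (y[p := 0]))) (f (y[p := 1])) (H (f (y[p := 1]))) > 0
      then y[p := 0] else y[p := 1])"

definition select_step :: "(word \<Rightarrow> word) \<Rightarrow> (word \<Rightarrow> word) \<Rightarrow> word list \<Rightarrow> word" where
  "select_step f H ws = select_bit f H (ws ! 1) (length (ws ! 0) + 1 + nat (store_word (ws ! 2) 1))"

lemma poly_comp_select_step:
  assumes f: "polytime1 f" "\<And>y. f y \<in> psd_words"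
    and HH: "\<And>H. H \<in> HH \<Longrightarrow> poly_bounded {[e] | e. e \<in> psd_words} (\<lambda>ws. wsize (H (ws ! 0)))"
  shows "poly_comp HH {[x, y, [int j]] | x y j. length x + 1 + j < length y} (select_step f)"
proof -
  let ?D = "{[x, y, [int j]] | x y j. length x + 1 + j < length y} :: word list set"
  have ar: "arity 3 ?D" by (auto simp: arity_def)
  let ?p = "\<lambda>ws :: word list. length (ws ! 0) + 1 + nat (store_word (ws ! 2) 1)"
  have "poly_comp HH ?D (\<lambda>H ws. [int (length (ws ! 0)) + 1 + store_word (ws ! 2) 1])"
    by (intro poly_comp_rules[OF ar] poly_comp_int) auto
  then have p: "poly_comp HH ?D (\<lambda>H ws. [int (?p ws)])"
    by (rule poly_comp_cong[rotated]) auto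
  have y: "poly_comp HH ?D (\<lambda>H ws. (ws ! 1)[?p ws := c])" for c
    by (rule poly_comp_list_update[OF ar poly_comp_nth[OF ar] poly_comp_int p]) auto
  have fc: "poly_comp HH (args 1) (\<lambda>H ws. f (ws ! 0))" by (rule poly_comp_polytime1[OF f(1)]) simp
  have fy: "poly_comp HH ?D (\<lambda>H ws. f ((ws ! 1)[?p ws := c]))" for c
    by (rule poly_comp_call1[OF fc ar y])
  have ask: "poly_comp HH {[e] | e. e \<in> psd_words} (\<lambda>H ws. H (ws ! 0))"
    by (rule poly_comp_ask) (use HH in auto)
  have hy: "poly_comp HH ?D (\<lambda>H ws. H (f ((ws ! 1)[?p ws := c])))" for c
    using poly_comp_call[OF ask ar, of "[\<lambda>H ws. f ((ws ! 1)[?p ws := c])]"] fy f(2) by simp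
  have "poly_comp HH ?D (\<lambda>H ws. [prefer_first (f ((ws ! 1)[?p ws := 0])) (H (f ((ws ! 1)[?p ws := 0])))
      (f ((ws ! 1)[?p ws := 1])) (H (f ((ws ! 1)[?p ws := 1])))])"
    by (rule poly_comp_prefer_first[OF ar fy fy _ hy hy]) (simp add: f(2))
  from poly_comp_cond[OF ar this y y]
  show ?thesis unfolding select_step_def select_bit_def .
qed

definition search :: "(word \<Rightarrow> word) \<Rightarrow> nat poly \<Rightarrow> (word \<Rightarrow> word) \<Rightarrow> word \<Rightarrow> nat \<Rightarrow> word" where
  "search f q H x j = loop_state (select_step f H) [x] (initial_input q x) j"

lemma partial_input_update:
  "length u = j \<Longrightarrow> (partial_input x (u @ replicate (Suc r) 2))[length x + 1 + j := b] = partial_input x ((u @ [b]) @ replicate r 2)"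
  by (simp add: partial_input_def list_update_append)

lemma search_Suc: "search f q H x (Suc j) = select_bit f H (search f q H x j) (length x + 1 + j)"
  by (simp add: search_def select_step_def)

text \<open>Holds whatever the external function answers, since each round merely fixes one more
  bit. The size bound and the soundness of the final check rest on this.\<close>

lemma search_form:
  "j \<le> poly q (wsize x) \<Longrightarrow> \<exists>u \<in> bit_words j. search f q H x j = partial_input x (u @ replicate (poly q (wsize x) - j) 2)"
proof (induction j)
  case 0
  then show ?case by (auto simp: search_def initial_input_def bit_words_def)
next
  case (Suc j)
  define r where "r = poly q (wsize x) - Suc j"
  have r: "poly q (wsize x) - j = Suc r" using Suc.prems by (simp add: r_def)
  obtain u where u: "u \<in> bit_words j" "search f q H x j = partial_input x (u @ replicate (Suc r) 2)"
    using Suc r by auto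
  have lu: "length u = j" using u(1) by (simp add: bit_words_def)
  obtain c where c: "c \<in> {0, 1}" "search f q H x (Suc j) = (search f q H x j)[length x + 1 + j := c]"
  proof (cases "search f q H x (Suc j) = (search f q H x j)[length x + 1 + j := 0]")
    case True
    then show ?thesis using that[of 0] by simp
  next
    case False
    then have "search f q H x (Suc j) = (search f q H x j)[length x + 1 + j := 1]"
      unfolding search_Suc select_bit_def by (simp split: if_splits)
    then show ?thesis using that[of 1] by simp
  qed
  have "u @ [c] \<in> bit_words (Suc j)" using u(1) c(1) by (auto simp: bit_words_def)
  moreover have "search f q H x (Suc j) = partial_input x ((u @ [c]) @ replicate r 2)"
    unfolding c(2) u(2) by (rule partial_input_update[OF lu])
  ultimately show ?case unfolding r_def by blast
qed

lemma search_size: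
  assumes j: "j \<le> poly q (wsize x)"
  shows "length (search f q H x j) = 1 + length x + poly q (wsize x)"
    and "wsize (search f q H x j) \<le> Suc (wsize x) + wsize x + 3 * poly q (wsize x)"
proof -
  let ?m = "poly q (wsize x)"
  obtain u where u: "u \<in> bit_words j" "search f q H x j = partial_input x (u @ replicate (?m - j) 2)"
    using search_form[OF j] by blast
  have lu: "length u = j" and su: "set u \<subseteq> {0, 1}" using u by (simp_all add: bit_words_def)
  show "length (search f q H x j) = 1 + length x + ?m" using u(2) lu j by (simp add: partial_input_def)
  have "isize 0 \<le> 3" "isize 1 \<le> 3" "isize 2 \<le> 3"
    using isize_int_le[of 1] isize_int_le[of 2] by simp_all
  then have "wsize (u @ replicate (?m - j) 2) \<le> length (u @ replicate (?m - j) 2) * 3"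
    using su by (intro wsize_bound) auto
  then have "wsize (u @ replicate (?m - j) 2) \<le> 3 * ?m" using lu j by simp
  moreover have "isize (int (length x)) \<le> Suc (wsize x)"
    using isize_int_le[of "length x"] length_le_wsize[of x] by linarith
  ultimately show "wsize (search f q H x j) \<le> Suc (wsize x) + wsize x + 3 * ?m"
    unfolding u(2) partial_input_def by simp
qed

text \<open>After the last round no entry is open, so the verifier for partial instances is run with
  the empty witness.\<close>

definition decide :: "(word \<Rightarrow> word \<Rightarrow> word) \<Rightarrow> (word \<Rightarrow> word) \<Rightarrow> nat poly \<Rightarrow> (word \<Rightarrow> word) \<Rightarrow> word \<Rightarrow> word" where
  "decide V f q H x = partial_verifier V (search f q H x (poly q (wsize x))) []"

lemma poly_comp_decide:
  assumes V: "polytime2 V" and f: "polytime1 f" "\<And>y. f y \<in> psd_words"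
    and HH: "\<And>H. H \<in> HH \<Longrightarrow> poly_bounded {[e] | e. e \<in> psd_words} (\<lambda>ws. wsize (H (ws ! 0)))"
  shows "poly_comp HH (args 1) (\<lambda>H ws. decide V f q H (ws ! 0))"
proof -
  let ?D = "{[x, y, [int j]] | x y j. length x + 1 + j < length y} :: word list set"
  let ?N = "\<lambda>ws :: word list. poly q (wsize (ws ! 0))"
  have ls: "loop_state (select_step f H) ws (initial_input q (ws ! 0)) j = search f q H (ws ! 0) j"
    if ws: "ws \<in> args 1" for H ws j
  proof -
    obtain x where "ws = [x]" using ws by (auto simp: length_Suc_conv)
    then show ?thesis by (simp add: search_def)
  qed
  have w0: "poly_bounded (args 1) (\<lambda>ws. wsize (ws ! 0))" by (rule poly_bounded_wsize_nth) simp
  have "poly_comp HH (args 1) (\<lambda>H ws. loop_state (select_step f H) ws ((\<lambda>H ws. initial_input q (ws ! 0)) H ws) (?N ws))"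
  proof (rule poly_comp_for[OF arity_args _ poly_comp_initial_input poly_comp_select_step[OF f HH] poly_comp_witness_length])
    fix H and ws :: "word list" and j assume ws: "ws \<in> args 1"
    obtain x where x: "ws = [x]" using ws by (auto simp: length_Suc_conv)
    show "ws @ [loop_state (select_step f H) ws (initial_input q (ws ! 0)) j, [int j]] \<in> ?D" if "j < ?N ws"
      unfolding ls[OF ws] using search_size(1)[of j q x f H] that by (simp add: x)
    show "wsize (loop_state (select_step f H) ws (initial_input q (ws ! 0)) j)
      \<le> Suc (wsize (ws ! 0)) + wsize (ws ! 0) + 3 * poly q (wsize (ws ! 0))" if "j \<le> ?N ws"
      unfolding ls[OF ws] using search_size(2)[of j q x f H] that by (simp add: x)
  next
    show "poly_bounded (args 1) (\<lambda>ws. Suc (wsize (ws ! 0)) + wsize (ws ! 0) + 3 * poly q (wsize (ws ! 0)))"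
      by (intro poly_bounded_add poly_bounded_Suc poly_bounded_mult poly_bounded_const poly_bounded_poly w0)
  qed simp_all
  then have s: "poly_comp HH (args 1) (\<lambda>H ws. search f q H (ws ! 0) (?N ws))"
    by (rule poly_comp_cong[rotated]) (simp add: ls)
  have pv: "poly_comp HH (args 2) (\<lambda>H ws. partial_verifier V (ws ! 0) (ws ! 1))"
    by (rule poly_comp_polytime2[OF polytime_partial_verifier[OF V]]) simp
  show ?thesis unfolding decide_def
    by (rule poly_comp_call2[OF pv arity_args s poly_comp_Nil])
qed

text \<open>Acceptance is always justified, because the found bits are checked by V itself. The
  assumption \<open>sel\<close> serves the converse: on a yes instance one of the two continuations
  keeps a witness, and the selection then stays inside the partial language.\<close>

lemma decide_correct:
  assumes L: "\<And>x. x \<in> L \<longleftrightarrow> (\<exists>w \<in> bit_words (poly q (wsize x)). V x w = [1])"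
    and sel: "\<And>y p. y[p := 0] \<in> partial_language V \<or> y[p := 1] \<in> partial_language V \<Longrightarrow> select_bit f H y p \<in> partial_language V"
  shows "decide V f q H x = [1] \<longleftrightarrow> x \<in> L"
proof -
  let ?m = "poly q (wsize x)"
  have inL: "search f q H x j \<in> partial_language V" if "x \<in> L" "j \<le> ?m" for j
    using that(2)
  proof (induction j)
    case 0
    have "[] \<in> bit_words 0" by (simp add: bit_words_def)
    from partial_language_iff[OF this, of x ?m V] show ?case
      using that(1) L by (simp add: search_def initial_input_def)
  next
    case (Suc j)
    define r where "r = ?m - Suc j"
    have r: "?m - j = Suc r" using Suc.prems by (simp add: r_def)
    obtain u where u: "u \<in> bit_words j" "search f q H x j = partial_input x (u @ replicate (Suc r) 2)"
      using search_form[of j q x f H] Suc.prems r by auto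
    have lu: "length u = j" using u(1) by (simp add: bit_words_def)
    have "partial_input x (u @ replicate (Suc r) 2) \<in> partial_language V" using Suc u(2) by simp
    then obtain z where z: "z \<in> bit_words (Suc r)" "V x (u @ z) = [1]"
      using partial_language_iff[OF u(1)] by blast
    then obtain b z' where b: "z = b # z'" "b \<in> {0, 1}" "z' \<in> bit_words r"
      by (cases z) (auto simp: bit_words_def)
    have "u @ [b] \<in> bit_words (Suc j)" using u(1) b(2) by (auto simp: bit_words_def)
    from partial_language_iff[OF this, of x r V] have "partial_input x ((u @ [b]) @ replicate r 2) \<in> partial_language V"
      using z(2) b(1,3) by auto
    then have "(search f q H x j)[length x + 1 + j := b] \<in> partial_language V"
      unfolding u(2) partial_input_update[OF lu] .
    with b(2) show ?case unfolding search_Suc by (intro sel) auto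
  qed
  obtain u where u: "u \<in> bit_words ?m" "search f q H x ?m = partial_input x (u @ replicate 0 2)"
    using search_form[of ?m q x f H] by auto
  have "filled_part (partial_input x u) [] = u"
  proof (rule nth_equalityI)
    fix i assume "i < length (filled_part (partial_input x u) [])"
    then have i: "i < length u" by (simp add: filled_part_partial)
    have "u ! i \<in> {0, 1}" using u(1) nth_mem[OF i] unfolding bit_words_def by blast
    then show "filled_part (partial_input x u) [] ! i = u ! i" using i by (auto simp: filled_part_partial)
  qed (simp add: filled_part_partial)
  then have d: "decide V f q H x = V x u"
    unfolding decide_def u(2) partial_verifier_def by (simp add: input_part_partial)
  show ?thesis
  proof
    assume "decide V f q H x = [1]"
    then show "x \<in> L" using L u(1) d by auto
  next
    assume "x \<in> L"
    then have "partial_input x (u @ replicate 0 2) \<in> partial_language V" using inL[of ?m] u(2) by simp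
    then obtain z where "z \<in> bit_words 0" "V x (u @ z) = [1]" using partial_language_iff[OF u(1)] by blast
    then show "decide V f q H x = [1]" using d by (simp add: bit_words_def)
  qed
qed

section \<open>Bounds on the normalizing constant\<close>

lemma minor_empty: "psd n A \<Longrightarrow> minor A {} = 1"
  unfolding minor_def by (subst submatrix_eq_list_mat[OF psd_carrier]) (assumption, simp add: list_mat_def)

lemma maxdet_attained:
  assumes "psd n A"
  shows "\<exists>S \<subseteq> {..<n}. minor A S = maxdet A" and "S \<subseteq> {..<n} \<Longrightarrow> minor A S \<le> maxdet A"
proof -
  have n: "dim_row A = n" using psd_carrier[OF assms] by simp
  have fin: "finite (minor A ` Pow {..<n})" by simp
  have "Max (minor A ` Pow {..<n}) \<in> minor A ` Pow {..<n}" by (rule Max_in) auto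
  then show "\<exists>S \<subseteq> {..<n}. minor A S = maxdet A" unfolding maxdet_def n by auto
  show "minor A S \<le> maxdet A" if "S \<subseteq> {..<n}"
    unfolding maxdet_def n using that by (intro Max_ge fin) auto
qed

lemma maxdet_ge_1: "psd n A \<Longrightarrow> maxdet A \<ge> 1"
  using maxdet_attained(2)[of n A "{}"] by (simp add: minor_empty)

text \<open>The term of a maximizing set alone reaches the bound, as all terms are
  nonnegative.\<close>

lemma Zp_lower:
  assumes A: "psd n A" and p: "p > 0" and c: "0 \<le> c" "c \<le> maxdet A"
  shows "c powr p \<le> Zp p A"
proof -
  have n: "dim_row A = n" using psd_carrier[OF A] by simp
  obtain S where S: "S \<subseteq> {..<n}" "minor A S = maxdet A" using maxdet_attained(1)[OF A] by blast
  have "c powr p \<le> minor A S powr p" using c p S(2) by (intro powr_mono2) auto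
  also have "\<dots> \<le> Zp p A" unfolding Zp_def n
    using S(1) by (intro member_le_sum[of S "Pow {..<n}" "\<lambda>S. minor A S powr p"]) auto
  finally show ?thesis .
qed

text \<open>All 2^n terms lie below s^p; the factor 2^n is the loss that the term -1 in the exponent
  of the approximation ratio pays for.\<close>

lemma Zp_upper:
  assumes A: "psd n A" and p: "p > 0" and s: "maxdet A < s"
  shows "Zp p A < 2 ^ n * s powr p"
proof -
  have n: "dim_row A = n" using psd_carrier[OF A] by simp
  have "Zp p A < (\<Sum>S \<in> Pow {..<n}. s powr p)" unfolding Zp_def n
  proof (rule sum_strict_mono)
    fix S assume "S \<in> Pow {..<n}"
    then have "minor A S < s" using maxdet_attained(2)[OF A, of S] s by auto
    then show "minor A S powr p < s powr p" using minor_nonneg[OF A] p by (intro powr_less_mono2) auto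
  qed auto
  also have "\<dots> = 2 ^ n * s powr p" by (simp add: card_Pow)
  finally show ?thesis .
qed

text \<open>For n' = 0 roots are meaningless and the second continuation is chosen. This is right:
  the maximum of the minors is then at least 1 = 2^(lam_s 0), so the reduction cannot have produced
  a no instance there.\<close>

lemma prefer_first_iff:
  assumes "psd n A" "psd n' A'"
  shows "prefer_first (enc_mat A) (enc_rat z) (enc_mat A') (enc_rat z') > 0 \<longleftrightarrow> n' > 0 \<and> z' ^ n \<le> z ^ n'"
proof -
  obtain a b where ab: "quotient_of z = (a, b)" by force
  obtain a' b' where ab': "quotient_of z' = (a', b')" by force
  have b: "b > 0" "b' > 0" using quotient_of_denom_pos[OF ab] quotient_of_denom_pos[OF ab'] .
  have z: "z = of_int a / of_int b" "z' = of_int a' / of_int b'" using quotient_of_div[OF ab] quotient_of_div[OF ab'] .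
  have pos: "(of_int b :: rat) ^ n' > 0" "(of_int b' :: rat) ^ n > 0" using b by simp_all
  have "z' ^ n \<le> z ^ n' \<longleftrightarrow> of_int a' ^ n * of_int b ^ n' \<le> (of_int a ^ n' * of_int b' ^ n :: rat)"
    unfolding z power_divide using pos by (simp add: divide_le_eq le_divide_eq field_simps)
  also have "\<dots> \<longleftrightarrow> rat_of_int (a' ^ n * b ^ n') \<le> rat_of_int (a ^ n' * b' ^ n)" by simp
  also have "\<dots> \<longleftrightarrow> a' ^ n * b ^ n' \<le> a ^ n' * b' ^ n" by (simp only: of_int_le_iff)
  finally have iff: "z' ^ n \<le> z ^ n' \<longleftrightarrow> a' ^ n * b ^ n' \<le> a ^ n' * b' ^ n" .
  have rd: "store_word (enc_rat z) 1 = a" "store_word (enc_rat z) 2 = b" "store_word (enc_rat z') 1 = a'" "store_word (enc_rat z') 2 = b'"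
    by (simp_all add: enc_rat_def ab ab')
  show ?thesis unfolding prefer_first_def iff rd mat_order_enc[OF assms(1)] mat_order_enc[OF assms(2)]
    by (auto simp: zero_less_mult_iff)
qed

text \<open>The ratio is exactly what still separates the cases: for a no instance the estimate is
  below 2^(((lam_c - lam_s) p - 1) n) 2^n 2^(lam_s p n) = 2^(lam_c p n), which an estimate for a yes
  instance reaches. Positivity allows estimates to be raised to powers monotonically.\<close>

lemma estimate_bounds:
  fixes lam_c lam_s p :: real
  assumes A: "psd n A" and p: "p > 0"
    and app: "rho_approx (2 powr (((lam_c - lam_s) * p - 1) * real n)) (Zp p A) (real_of_rat z)"
  shows "maxdet A \<ge> 2 powr (lam_c * real n) \<Longrightarrow> (2 powr (lam_c * p)) ^ n \<le> real_of_rat z"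
    and "maxdet A < 2 powr (lam_s * real n) \<Longrightarrow> real_of_rat z < (2 powr (lam_c * p)) ^ n"
    and "z > 0"
proof -
  let ?r = "2 powr (((lam_c - lam_s) * p - 1) * real n)"
  have th: "(2 powr (lam_c * p)) ^ n = 2 powr (lam_c * p * real n)"
    by (simp add: powr_realpow[symmetric] powr_powr)
  show "(2 powr (lam_c * p)) ^ n \<le> real_of_rat z" if "maxdet A \<ge> 2 powr (lam_c * real n)"
  proof -
    have "(2 powr (lam_c * real n)) powr p \<le> Zp p A" using that by (intro Zp_lower[OF A p]) auto
    also have "\<dots> \<le> real_of_rat z" using app by (simp add: rho_approx_def)
    finally show ?thesis unfolding th by (simp add: powr_powr mult_ac)
  qed
  show "real_of_rat z < (2 powr (lam_c * p)) ^ n" if "maxdet A < 2 powr (lam_s * real n)"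
  proof -
    have "real_of_rat z \<le> ?r * Zp p A" using app by (simp add: rho_approx_def)
    also have "\<dots> < ?r * (2 ^ n * (2 powr (lam_s * real n)) powr p)"
      using Zp_upper[OF A p that] by (intro mult_strict_left_mono) auto
    also have "\<dots> = 2 powr (((lam_c - lam_s) * p - 1) * real n) * (2 powr real n * 2 powr (lam_s * real n * p))"
      by (simp add: powr_powr powr_realpow)
    also have "\<dots> = 2 powr (lam_c * p * real n)"
      unfolding powr_add[symmetric] by (simp add: algebra_simps)
    finally show ?thesis unfolding th .
  qed
  have "0 < (1 :: real) powr p" by simp
  also have "\<dots> \<le> Zp p A" using maxdet_ge_1[OF A] by (intro Zp_lower[OF A p]) auto
  also have "\<dots> \<le> real_of_rat z" using app by (simp add: rho_approx_def)
  finally show "z > 0" by simp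
qed

lemma hard_to_approximate:
  fixes lam_c lam_s p :: real
  assumes hard: "NP_hard_promise (gap_detmax (\<lambda>n. 2 powr (lam_s * real n)) (\<lambda>n. 2 powr (lam_c * real n)))"
    and p: "p > 0"
  shows "NP_hard_to_approximate (Zp p) (\<lambda>n. 2 powr (((lam_c - lam_s) * p - 1) * real n))"
  unfolding NP_hard_to_approximate_def
proof
  let ?Q = "gap_detmax (\<lambda>n. 2 powr (lam_s * real n)) (\<lambda>n. 2 powr (lam_c * real n))"
  let ?rho = "\<lambda>n. 2 powr (((lam_c - lam_s) * p - 1) * real n)"
  let ?th = "2 powr (lam_c * p)"
  \<comment> \<open>Taking all approximators together makes \<open>poly_comp\<close> deliver a
    single program, with a time bound for each of them.\<close>
  define HH where "HH = {H. approximator (Zp p) ?rho H}"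
  fix L assume "L \<in> NP_class"
  then have "\<exists>V (q :: nat poly). polytime2 V \<and> (\<forall>x. x \<in> L \<longleftrightarrow> (\<exists>w \<in> bit_words (poly q (wsize x)). V x w = [1]))"
    unfolding NP_class_def by (rule CollectD)
  then obtain V and q :: "nat poly" where V: "polytime2 V"
    and L: "\<forall>x. x \<in> L \<longleftrightarrow> (\<exists>w \<in> bit_words (poly q (wsize x)). V x w = [1])" by (elim exE conjE)
  from bspec[OF hard[unfolded NP_hard_promise_def] partial_language_NP[OF V]]
  obtain f where f: "polytime1 f"
    and red: "\<forall>y. (y \<in> partial_language V \<longrightarrow> f y \<in> fst ?Q) \<and> (y \<notin> partial_language V \<longrightarrow> f y \<in> snd ?Q)"
    by (elim exE conjE)
  have yes: "\<exists>A n. f y = enc_mat A \<and> psd n A \<and> maxdet A \<ge> 2 powr (lam_c * real n)" if "y \<in> partial_language V" for y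
    using red[THEN spec, of y] that unfolding gap_detmax_def fst_conv snd_conv by simp
  have no: "\<exists>A n. f y = enc_mat A \<and> psd n A \<and> maxdet A < 2 powr (lam_s * real n)" if "y \<notin> partial_language V" for y
    using red[THEN spec, of y] that unfolding gap_detmax_def fst_conv snd_conv by simp
  have fp: "f y \<in> psd_words" for y using yes[of y] no[of y] unfolding psd_words_def by blast
  have bd: "poly_bounded {[e] | e. e \<in> psd_words} (\<lambda>ws. wsize (H (ws ! 0)))" if H: "H \<in> HH" for H
  proof -
    obtain B :: "nat poly" where "\<forall>n A. psd n A \<longrightarrow> wsize (H (enc_mat A)) \<le> poly B (wsize (enc_mat A))"
      using H unfolding HH_def approximator_def by blast
    then show ?thesis by (intro poly_boundedI[of _ _ B]) (auto simp: psd_words_def)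
  qed
  have sel: "select_bit f H y i \<in> partial_language V"
    if H: "H \<in> HH" and or: "y[i := 0] \<in> partial_language V \<or> y[i := 1] \<in> partial_language V" for H y i
  proof (rule ccontr)
    assume not: "select_bit f H y i \<notin> partial_language V"
    have est: "\<exists>z. H (enc_mat A) = enc_rat z \<and> rho_approx (?rho n) (Zp p A) (real_of_rat z)" if "psd n A" for n A
      using H that unfolding HH_def approximator_def by blast
    let ?y0 = "y[i := 0]" and ?y1 = "y[i := 1]"
    let ?c = "prefer_first (f ?y0) (H (f ?y0)) (f ?y1) (H (f ?y1)) > 0"
    show False
    proof (cases ?c)
      case True
      then have n0: "?y0 \<notin> partial_language V" using not by (simp add: select_bit_def)
      then have y1: "?y1 \<in> partial_language V" using or by blast
      obtain A n where A: "f ?y0 = enc_mat A" "psd n A" "maxdet A < 2 powr (lam_s * real n)" using no[OF n0] by blast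
      obtain A' n' where A': "f ?y1 = enc_mat A'" "psd n' A'" "maxdet A' \<ge> 2 powr (lam_c * real n')" using yes[OF y1] by blast
      obtain z where z: "H (enc_mat A) = enc_rat z" "rho_approx (?rho n) (Zp p A) (real_of_rat z)" using est[OF A(2)] by blast
      obtain z' where z': "H (enc_mat A') = enc_rat z'" "rho_approx (?rho n') (Zp p A') (real_of_rat z')" using est[OF A'(2)] by blast
      have c: "n' > 0" "z' ^ n \<le> z ^ n'"
        using True unfolding A(1) A'(1) z(1) z'(1) prefer_first_iff[OF A(2) A'(2)] by auto
      \<comment> \<open>A no instance was preferred to a yes instance: z < th^n and th^n' \<le> z'.
        Raised to the powers n' and n, both meet at th^(n n') and contradict the comparison;
        strictness survives because n' > 0.\<close>
      have "real_of_rat (z ^ n') < (?th ^ n) ^ n'" unfolding of_rat_power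
        using estimate_bounds(2)[OF A(2) p z(2) A(3)] estimate_bounds(3)[OF A(2) p z(2)] c(1)
        by (intro power_strict_mono) auto
      also have "\<dots> = (?th ^ n') ^ n" by (simp add: power_mult[symmetric] mult.commute)
      also have "\<dots> \<le> real_of_rat (z' ^ n)" unfolding of_rat_power
        using estimate_bounds(1)[OF A'(2) p z'(2) A'(3)] by (intro power_mono) auto
      finally have "z ^ n' < z' ^ n" by (simp only: of_rat_less)
      then show False using c(2) by simp
    next
      case False
      then have n1: "?y1 \<notin> partial_language V" using not by (simp add: select_bit_def)
      then have y0: "?y0 \<in> partial_language V" using or by blast
      obtain A n where A: "f ?y0 = enc_mat A" "psd n A" "maxdet A \<ge> 2 powr (lam_c * real n)" using yes[OF y0] by blast
      obtain A' n' where A': "f ?y1 = enc_mat A'" "psd n' A'" "maxdet A' < 2 powr (lam_s * real n')" using no[OF n1] by blast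
      obtain z where z: "H (enc_mat A) = enc_rat z" "rho_approx (?rho n) (Zp p A) (real_of_rat z)" using est[OF A(2)] by blast
      obtain z' where z': "H (enc_mat A') = enc_rat z'" "rho_approx (?rho n') (Zp p A') (real_of_rat z')" using est[OF A'(2)] by blast
      \<comment> \<open>Order 0 is impossible for a no instance, whose minors would all have to be
        below 1, although the empty minor is 1. So the comparison itself has failed, not the test of
        the order.\<close>
      have "n' > 0"
      proof (rule ccontr)
        assume "\<not> n' > 0"
        then show False using A'(3) maxdet_ge_1[OF A'(2)] by simp
      qed
      then have c: "z ^ n' < z' ^ n"
        using False unfolding A(1) A'(1) z(1) z'(1) prefer_first_iff[OF A(2) A'(2)] by auto
      \<comment> \<open>Only a weak inequality, since n may be 0 here; the strictness of the
        contradiction comes from the failed comparison.\<close>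
      have "real_of_rat (z' ^ n) \<le> (?th ^ n') ^ n" unfolding of_rat_power
        using estimate_bounds(2)[OF A'(2) p z'(2) A'(3)] estimate_bounds(3)[OF A'(2) p z'(2)]
        by (intro power_mono) auto
      also have "\<dots> = (?th ^ n) ^ n'" by (simp add: power_mult[symmetric] mult.commute)
      also have "\<dots> \<le> real_of_rat (z ^ n')" unfolding of_rat_power
        using estimate_bounds(1)[OF A(2) p z(2) A(3)] by (intro power_mono) auto
      finally have "z' ^ n \<le> z ^ n'" by (simp only: of_rat_less_eq)
      then show False using c by simp
    qed
  qed
  obtain c where c: "\<forall>H \<in> HH. \<exists>P. \<forall>ws \<in> args 1. runs_within H c ws (decide V f q H (ws ! 0)) P"
    using poly_comp_runs_within[OF poly_comp_decide[OF V f fp bd, of HH q]] by blast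
  show "\<exists>c. \<forall>H. approximator (Zp p) ?rho H \<longrightarrow> (\<exists>P. \<forall>x. \<exists>out. runs_within H c [x] out P \<and> (out = [1] \<longleftrightarrow> x \<in> L))"
  proof (intro exI[of _ c] allI impI)
    fix H assume "approximator (Zp p) ?rho H"
    then have H: "H \<in> HH" by (simp add: HH_def)
    obtain P where P: "\<forall>ws \<in> args 1. runs_within H c ws (decide V f q H (ws ! 0)) P" using c H by blast
    show "\<exists>P. \<forall>x. \<exists>out. runs_within H c [x] out P \<and> (out = [1] \<longleftrightarrow> x \<in> L)"
    proof (intro exI[of _ P] allI)
      fix x
      have "runs_within H c [x] (decide V f q H x) P" using bspec[OF P, of "[x]"] by simp
      moreover have "decide V f q H x = [1] \<longleftrightarrow> x \<in> L" by (rule decide_correct[OF L[rule_format] sel[OF H]])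
      ultimately show "\<exists>out. runs_within H c [x] out P \<and> (out = [1] \<longleftrightarrow> x \<in> L)" by blast
    qed
  qed
qed


section \<open>Hardness of sampling\<close>

lemma bit_words_finite [simp]: "finite (bit_words m)"
  unfolding bit_words_def by (rule finite_lists_length_eq) simp

lemma card_bit_words: "card (bit_words m) = 2 ^ m"
  unfolding bit_words_def by (subst card_lists_length_eq) (simp_all add: numeral_2_eq_2)

lemma bit_words_nonempty [simp]: "bit_words m \<noteq> {}"
  using card_bit_words[of m] by (metis card.empty power_not_zero zero_neq_numeral)

lemma prob_bit_words: "measure_pmf.prob (pmf_of_set (bit_words m)) X = real (card (bit_words m \<inter> X)) / 2 ^ m"
  by (subst measure_pmf_of_set) (simp_all add: card_bit_words)

text \<open>The sampler consumes a number of bits depending on the size of f x, while in RP the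
  number depends on x alone. The remedy is to draw more bits and to use a prefix; the surplus bits
  contribute the factor 2^(M - m) to both counts.\<close>

lemma prob_take_bit_words:
  assumes "m \<le> M"
  shows "measure_pmf.prob (pmf_of_set (bit_words M)) {r. take m r \<in> X} = measure_pmf.prob (pmf_of_set (bit_words m)) X"
proof -
  have "bit_words M \<inter> {r. take m r \<in> X} = (\<lambda>(u, z). u @ z) ` ((bit_words m \<inter> X) \<times> bit_words (M - m))" (is "?l = ?r")
  proof
    show "?l \<subseteq> ?r"
    proof
      fix r assume r: "r \<in> ?l"
      then have len: "length r = M" and sr: "set r \<subseteq> {0, 1}" by (simp_all add: bit_words_def)
      have "take m r \<in> bit_words m" "drop m r \<in> bit_words (M - m)"
        using len assms order_trans[OF set_take_subset sr] order_trans[OF set_drop_subset sr] by (simp_all add: bit_words_def)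
      then have "(take m r, drop m r) \<in> (bit_words m \<inter> X) \<times> bit_words (M - m)" using r by simp
      then have "(\<lambda>(u, z). u @ z) (take m r, drop m r) \<in> ?r" by (rule imageI)
      then show "r \<in> ?r" by simp
    qed
    show "?r \<subseteq> ?l"
    proof
      fix r assume "r \<in> ?r"
      then obtain u z where uz: "r = u @ z" "u \<in> bit_words m" "u \<in> X" "z \<in> bit_words (M - m)" by auto
      have "r \<in> bit_words (m + (M - m))" unfolding uz(1) by (rule bit_words_append[OF uz(2,4)])
      moreover have "take m r = u" using uz(1,2) by (simp add: bit_words_def)
      ultimately show "r \<in> ?l" using assms uz(3) by simp
    qed
  qed
  moreover have "inj_on (\<lambda>(u, z). u @ z) ((bit_words m \<inter> X) \<times> bit_words (M - m))"
  proof (rule inj_onI)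
    fix a a' assume a: "a \<in> (bit_words m \<inter> X) \<times> bit_words (M - m)" "a' \<in> (bit_words m \<inter> X) \<times> bit_words (M - m)"
      and eq: "(case a of (u, z) \<Rightarrow> u @ z) = (case a' of (u, z) \<Rightarrow> u @ z)"
    obtain u z u' z' where uz: "a = (u, z)" "a' = (u', z')" by (cases a, cases a')
    have "length u = length u'" using a unfolding uz bit_words_def by simp
    then show "a = a'" using eq unfolding uz by simp
  qed
  ultimately have "card (bit_words M \<inter> {r. take m r \<in> X}) = card (bit_words m \<inter> X) * 2 ^ (M - m)"
    by (simp only: card_image card_cartesian_product card_bit_words)
  moreover have "(2::real) ^ M = 2 ^ m * 2 ^ (M - m)" using assms by (simp flip: power_add)
  ultimately show ?thesis unfolding prob_bit_words by simp
qed

text \<open>An accepted random string is a witness; positive probability yields one, and none exists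
  for inputs outside the language.\<close>

lemma RP_subset_NP: "RP_class \<subseteq> NP_class"
proof
  fix L assume "L \<in> RP_class"
  then have "\<exists>V (q :: nat poly). polytime2 V \<and>
     (\<forall>x. (x \<in> L \<longrightarrow> measure_pmf.prob (pmf_of_set (bit_words (poly q (wsize x)))) {r. V x r = [1]} \<ge> 1 / 2) \<and>
          (x \<notin> L \<longrightarrow> (\<forall>r \<in> bit_words (poly q (wsize x)). V x r \<noteq> [1])))"
    unfolding RP_class_def by (rule CollectD)
  then obtain V and q :: "nat poly" where V: "polytime2 V" and
    R: "\<forall>x. (x \<in> L \<longrightarrow> measure_pmf.prob (pmf_of_set (bit_words (poly q (wsize x)))) {r. V x r = [1]} \<ge> 1 / 2) \<and>
          (x \<notin> L \<longrightarrow> (\<forall>r \<in> bit_words (poly q (wsize x)). V x r \<noteq> [1]))"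
    by (elim exE conjE)
  have "x \<in> L \<longleftrightarrow> (\<exists>w \<in> bit_words (poly q (wsize x)). V x w = [1])" for x
  proof
    assume "x \<in> L"
    then have p: "measure_pmf.prob (pmf_of_set (bit_words (poly q (wsize x)))) {r. V x r = [1]} \<ge> 1 / 2"
      using R by simp
    show "\<exists>w \<in> bit_words (poly q (wsize x)). V x w = [1]"
    proof (rule ccontr)
      assume "\<not> ?thesis"
      then have "bit_words (poly q (wsize x)) \<inter> {r. V x r = [1]} = {}" by blast
      then show False using p unfolding prob_bit_words by simp
    qed
  next
    assume "\<exists>w \<in> bit_words (poly q (wsize x)). V x w = [1]"
    then show "x \<in> L" using R by blast
  qed
  then show "L \<in> NP_class" unfolding NP_class_def using V by (intro CollectI exI[of _ V] exI[of _ q] conjI allI)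
qed

text \<open>As both masses are 1, the excess of \<eta> on G equals its deficit on the complement.
  Each is at most the part of the sum over its own region, and averaging the two gives the factor
  1/2.\<close>

lemma tv_dist_event:
  assumes fin: "finite U" and G: "G \<subseteq> U" and one: "sum \<mu> U = 1" "sum \<eta> U = (1 :: real)"
  shows "sum \<eta> G - sum \<mu> G \<le> tv_dist U \<mu> \<eta>"
proof -
  have U: "sum f U = sum f (U - G) + sum f G" for f :: "'a \<Rightarrow> real"
    using sum.subset_diff[OF G fin] by simp
  have "sum \<eta> G - sum \<mu> G = (\<Sum>x\<in>G. \<eta> x - \<mu> x)" by (simp add: sum_subtractf)
  also have "\<dots> \<le> (\<Sum>x\<in>G. \<bar>\<mu> x - \<eta> x\<bar>)" by (rule sum_mono) simp
  finally have 1: "sum \<eta> G - sum \<mu> G \<le> (\<Sum>x\<in>G. \<bar>\<mu> x - \<eta> x\<bar>)" .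
  have "sum \<mu> (U - G) - sum \<eta> (U - G) = (\<Sum>x\<in>U - G. \<mu> x - \<eta> x)" by (simp add: sum_subtractf)
  also have "\<dots> \<le> (\<Sum>x\<in>U - G. \<bar>\<mu> x - \<eta> x\<bar>)" by (rule sum_mono) simp
  finally have "sum \<mu> (U - G) - sum \<eta> (U - G) \<le> (\<Sum>x\<in>U - G. \<bar>\<mu> x - \<eta> x\<bar>)" .
  then have "sum \<eta> G - sum \<mu> G \<le> (\<Sum>x\<in>U - G. \<bar>\<mu> x - \<eta> x\<bar>)"
    using one U[of \<mu>] U[of \<eta>] by linarith
  with 1 show ?thesis unfolding tv_dist_def U[of "\<lambda>x. \<bar>\<mu> x - \<eta> x\<bar>"] by simp
qed

lemma Zp_pos: "psd n A \<Longrightarrow> p > 0 \<Longrightarrow> Zp p A > 0"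
  using Zp_lower[of n A p 1] maxdet_ge_1[of n A] by simp

lemma edpp_sum:
  assumes "psd n A" "p > 0"
  shows "sum (edpp p A) (Pow {..<n}) = 1"
proof -
  have n: "dim_row A = n" using psd_carrier[OF assms(1)] by simp
  have "sum (edpp p A) (Pow {..<n}) = Zp p A / Zp p A"
    unfolding edpp_def sum_divide_distrib[symmetric] by (simp only: Zp_def n)
  then show ?thesis using Zp_pos[OF assms] by simp
qed

text \<open>At most 2^n sets have weight at most b^(n p) each, against a normalizing constant of at
  least 2^(lam p n).\<close>

lemma edpp_small_minors:
  fixes b p lam :: real
  assumes A: "psd n A" and p: "p > 0" and b: "b > 0" and big: "maxdet A \<ge> 2 powr (lam * real n)"
  shows "(\<Sum>S \<in> {S \<in> Pow {..<n}. minor A S < b ^ n}. edpp p A S) \<le> (2 * b powr p / 2 powr (lam * p)) ^ n"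
proof -
  let ?B = "{S \<in> Pow {..<n}. minor A S < b ^ n}"
  have Z: "(2 powr (lam * real n)) powr p \<le> Zp p A" using big by (intro Zp_lower[OF A p]) auto
  have Z0: "Zp p A > 0" by (rule Zp_pos[OF A p])
  have "(\<Sum>S \<in> ?B. edpp p A S) = (\<Sum>S \<in> ?B. minor A S powr p) / Zp p A"
    by (simp add: edpp_def sum_divide_distrib)
  also have "(\<Sum>S \<in> ?B. minor A S powr p) \<le> (\<Sum>S \<in> ?B. (b ^ n) powr p)"
    using p minor_nonneg[OF A] by (intro sum_mono powr_mono2) auto
  also have "\<dots> \<le> (\<Sum>S \<in> Pow {..<n}. (b ^ n) powr p)" by (intro sum_mono2) auto
  also have "\<dots> = 2 ^ n * (b ^ n) powr p" by (simp add: card_Pow)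
  finally have "(\<Sum>S \<in> ?B. edpp p A S) \<le> 2 ^ n * (b ^ n) powr p / Zp p A"
    using Z0 by (simp add: divide_right_mono)
  also have "\<dots> \<le> 2 ^ n * (b ^ n) powr p / (2 powr (lam * real n)) powr p"
    using Z Z0 by (intro divide_left_mono mult_pos_pos) auto
  also have "(b ^ n) powr p = (b powr p) ^ n"
    using b by (simp add: powr_realpow[symmetric] powr_powr mult.commute)
  also have "(2 powr (lam * real n)) powr p = (2 powr (lam * p)) ^ n"
    by (simp add: powr_realpow[symmetric] powr_powr mult_ac)
  also have "2 ^ n * (b powr p) ^ n / (2 powr (lam * p)) ^ n = (2 * b powr p / 2 powr (lam * p)) ^ n"
    by (simp add: power_divide power_mult_distrib)
  finally show ?thesis .
qed

text \<open>The E-DPP gives the large minors mass at least 5/6, and a total variation distance of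
  1/3 leaves 1/2.\<close>

lemma sampler_finds_large_minor:
  fixes b p lam :: real and D :: "nat set pmf"
  assumes A: "psd n A" and p: "p > 0" and b: "b > 0" and big: "maxdet A \<ge> 2 powr (lam * real n)"
    and small: "(2 * b powr p / 2 powr (lam * p)) ^ n \<le> 1 / 6"
    and D: "set_pmf D \<subseteq> Pow {..<n}" "tv_dist (Pow {..<n}) (pmf D) (edpp p A) \<le> 1 / 3"
  shows "measure_pmf.prob D {S. minor A S \<ge> b ^ n} \<ge> 1 / 2"
proof -
  let ?U = "Pow {..<n}"
  let ?G = "{S \<in> ?U. minor A S \<ge> b ^ n}" and ?B = "{S \<in> ?U. minor A S < b ^ n}"
  have B: "?U - ?G = ?B" and G: "?G \<subseteq> ?U" and fin: "finite ?U" by auto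
  have "sum (edpp p A) ?U = sum (edpp p A) ?B + sum (edpp p A) ?G"
    using sum.subset_diff[OF G fin, of "edpp p A"] unfolding B .
  moreover have "sum (edpp p A) ?B \<le> 1 / 6" using edpp_small_minors[OF A p b big] small by linarith
  ultimately have "sum (edpp p A) ?G \<ge> 5 / 6" using edpp_sum[OF A p] by linarith
  moreover have "sum (edpp p A) ?G - sum (pmf D) ?G \<le> tv_dist ?U (pmf D) (edpp p A)"
    by (rule tv_dist_event) (use sum_pmf_eq_1[of ?U D] D(1) edpp_sum[OF A p] in auto)
  ultimately have "sum (pmf D) ?G \<ge> 1 / 2" using D(2) by linarith
  also have "sum (pmf D) ?G = measure_pmf.prob D ?G" by (subst measure_measure_pmf_finite) auto
  also have "\<dots> \<le> measure_pmf.prob D {S. minor A S \<ge> b ^ n}"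
    by (rule measure_pmf.finite_measure_mono) auto
  finally show ?thesis .
qed

text \<open>Recovers the matrix from its encoding, so that the output of the sampler becomes a
  function on words; the choice is unique by \<open>enc_mat_inj\<close>.\<close>

definition decoded :: "word \<Rightarrow> rat mat" where
  "decoded e = (SOME A. \<exists>n. psd n A \<and> enc_mat A = e)"

lemma decoded_enc: "psd n A \<Longrightarrow> decoded (enc_mat A) = A"
proof -
  assume A: "psd n A"
  then have "\<exists>m. psd m (decoded (enc_mat A)) \<and> enc_mat (decoded (enc_mat A)) = enc_mat A"
    unfolding decoded_def by (intro someI[of "\<lambda>B. \<exists>m. psd m B \<and> enc_mat B = enc_mat A" A]) blast
  then show ?thesis using enc_mat_inj psd_carrier A by blast
qed

text \<open>A verifier must run in polynomial time on every second argument, but the sampler is only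
  known to do so on bit strings of the right length. Reduction mod 2 and the default value 0 of
  cells beyond the end produce one from any word.\<close>

definition clip_bits :: "nat \<Rightarrow> word \<Rightarrow> word" where
  "clip_bits m r = map (\<lambda>i. store_word r (int i + 1) mod 2) [0..<m]"

lemma clip_bits_in: "clip_bits m r \<in> bit_words m"
proof -
  have "x mod 2 \<in> {0, 1}" for x :: int by auto
  then show ?thesis by (auto simp: clip_bits_def bit_words_def)
qed

lemma clip_bits_take:
  assumes r: "r \<in> bit_words M" and m: "m \<le> M"
  shows "clip_bits m r = take m r"
proof (rule nth_equalityI)
  have len: "length r = M" and sr: "set r \<subseteq> {0, 1}" using r by (simp_all add: bit_words_def)
  show "length (clip_bits m r) = length (take m r)" using len m by (simp add: clip_bits_def)
  fix i assume "i < length (clip_bits m r)"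
  then have i: "i < m" by (simp add: clip_bits_def)
  then have "r ! i \<in> {0, 1}" using subsetD[OF sr nth_mem[of i r]] len m by simp
  then show "clip_bits m r ! i = take m r ! i" using i len m by (auto simp: clip_bits_def)
qed

lemma poly_comp_clip_bits:
  "poly_comp HH (args 2) (\<lambda>H ws. clip_bits (poly q (wsize (ws ! 0))) (ws ! 1))"
proof -
  have g: "poly_comp HH (args 3) (\<lambda>H ws. [store_word (ws ! 1) (store_word (ws ! 2) 1 + 1) mod 2])"
    by (intro poly_comp_rules[OF arity_args] poly_comp_int) auto
  have "poly_comp HH (args 2) (\<lambda>H ws. ws ! 0)" by (rule poly_comp_nth[OF arity_args]) simp
  from poly_comp_poly[OF arity_args poly_comp_call1[OF poly_comp_wsize_fun arity_args this]]
  have N: "poly_comp HH (args 2) (\<lambda>H ws. [int (poly q (wsize (ws ! 0)))])" .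
  have N': "poly_bounded (args 2) (\<lambda>ws. poly q (wsize (ws ! 0)))"
    by (intro poly_bounded_poly poly_bounded_wsize_nth) simp
  have "poly_comp HH (args 2) (\<lambda>H ws. map (\<lambda>i. store_word ((ws @ [[int i]]) ! 1) (store_word ((ws @ [[int i]]) ! 2) 1 + 1) mod 2) [0..<poly q (wsize (ws ! 0))])"
    by (rule poly_comp_tabulate[OF arity_args _ g N N']) auto
  then show ?thesis by (rule poly_comp_cong[rotated]) (simp add: clip_bits_def nth_append)
qed

lemma poly_comp_runs:
  assumes "\<And>ws. ws \<in> D \<Longrightarrow> runs_within no_help c ws (f ws) P"
  shows "poly_comp {no_help} D (\<lambda>H ws. f ws)"
  unfolding poly_comp_def
proof (intro exI[of _ c] ballI exI[of _ "\<lambda>ws. poly P (isz ws)"] conjI)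
  show "poly_bounded D (\<lambda>ws. poly P (isz ws))" by (intro poly_bounded_poly poly_bounded_isz)
  fix H ws assume "H \<in> {no_help}" "ws \<in> D"
  then show "\<exists>t \<le> poly P (isz ws). runs H c ws (f ws) t" using assms[of ws] unfolding runs_within_def by auto
qed

lemma poly_comp_threshold_sum:
  assumes D: "arity k D" and e: "poly_comp HH D e" "\<And>H ws. H \<in> HH \<Longrightarrow> ws \<in> D \<Longrightarrow> e H ws \<in> psd_words"
  shows "poly_comp HH D (\<lambda>H ws. [\<Sum>w\<leftarrow>cs. threshold u v (e H ws) w])"
proof (induction cs)
  case (Cons w cs)
  have "poly_comp HH D (\<lambda>H ws. [threshold u v (e H ws) w])"
    using poly_comp_call[OF poly_comp_threshold D, of "[e, \<lambda>H ws. w]" HH u v] e poly_comp_const[OF D] by auto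
  from poly_comp_add[OF D this Cons] show ?case by simp
qed (simp add: poly_comp_int)

text \<open>The constant candidates \<open>cs\<close> cover the small orders, for which the sampler is useless.\<close>

definition sample_test :: "int \<Rightarrow> int \<Rightarrow> word list \<Rightarrow> (word \<Rightarrow> word) \<Rightarrow> (word \<Rightarrow> word \<Rightarrow> word) \<Rightarrow> nat poly \<Rightarrow> word \<Rightarrow> word \<Rightarrow> word" where
  "sample_test u v cs f h q x r =
    [if (\<Sum>w\<leftarrow>cs. threshold u v (f x) w) + threshold u v (f x) (h (f x) (clip_bits (poly q (wsize (f x))) r)) > 0 then 1 else 0]"

lemma polytime_sample_test:
  assumes f: "polytime1 f" "\<And>x. f x \<in> psd_words"
    and h: "poly_comp {no_help} {[e, r] | e r. e \<in> psd_words \<and> r \<in> bit_words (poly q (wsize e))} (\<lambda>H ws. h (ws ! 0) (ws ! 1))"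
  shows "polytime2 (sample_test u v cs f h q)"
proof (rule polytime2I)
  let ?HH = "{no_help}"
  have ar: "arity 2 (args 2)" by simp
  have fc: "poly_comp ?HH (args 1) (\<lambda>H ws. f (ws ! 0))" by (rule poly_comp_polytime1[OF f(1)]) simp
  have e: "poly_comp ?HH (args 2) (\<lambda>H ws. f (ws ! 0))"
    by (rule poly_comp_call1[OF fc ar poly_comp_nth[OF ar]]) simp
  have r: "poly_comp ?HH (args 2) (\<lambda>H ws. clip_bits (poly q (wsize (f (ws ! 0)))) (ws ! 1))"
    by (rule poly_comp_call2[OF poly_comp_clip_bits ar e poly_comp_nth[OF ar]]) simp
  have w: "poly_comp ?HH (args 2) (\<lambda>H ws. h (f (ws ! 0)) (clip_bits (poly q (wsize (f (ws ! 0)))) (ws ! 1)))"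
    using poly_comp_call[OF h ar, of "[\<lambda>H ws. f (ws ! 0), \<lambda>H ws. clip_bits (poly q (wsize (f (ws ! 0)))) (ws ! 1)]"]
      e r f(2) clip_bits_in by auto
  have t: "poly_comp ?HH (args 2) (\<lambda>H ws. [threshold u v (f (ws ! 0)) (h (f (ws ! 0)) (clip_bits (poly q (wsize (f (ws ! 0)))) (ws ! 1)))])"
    using poly_comp_call[OF poly_comp_threshold ar, of "[\<lambda>H ws. f (ws ! 0),
      \<lambda>H ws. h (f (ws ! 0)) (clip_bits (poly q (wsize (f (ws ! 0)))) (ws ! 1))]" ?HH u v] e w f(2) by auto
  have s: "poly_comp ?HH (args 2) (\<lambda>H ws. [\<Sum>w\<leftarrow>cs. threshold u v (f (ws ! 0)) w])"
    by (rule poly_comp_threshold_sum[OF ar e f(2)])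
  show "poly_comp ?HH (args 2) (\<lambda>H ws. sample_test u v cs f h q (ws ! 0) (ws ! 1))"
    unfolding sample_test_def by (intro poly_comp_cond_scalar[OF ar] poly_comp_add[OF ar] poly_comp_int s t)
qed

lemma threshold_nonneg: "threshold u v e w \<ge> 0"
  by (simp add: threshold_def Let_def)

lemma sample_test_accepts:
  assumes "threshold u v (f x) w = 1"
    and "w \<in> set cs \<or> w = h (f x) (clip_bits (poly q (wsize (f x))) r)"
  shows "sample_test u v cs f h q x r = [1]"
proof -
  have s: "(\<Sum>w\<leftarrow>cs. threshold u v (f x) w) \<ge> 0" for cs
    by (rule sum_list_nonneg) (auto simp: threshold_nonneg)
  have "(\<Sum>w\<leftarrow>cs. threshold u v (f x) w) \<ge> 1" if "w \<in> set cs"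
    using that s assms(1) threshold_nonneg by (induction cs) (auto simp: add_increasing add_increasing2)
  then have "(\<Sum>w\<leftarrow>cs. threshold u v (f x) w) + threshold u v (f x) (h (f x) (clip_bits (poly q (wsize (f x))) r)) > 0"
    using assms s[of cs] threshold_nonneg[of u v "f x" "h (f x) (clip_bits (poly q (wsize (f x))) r)"] by auto
  then show ?thesis by (simp add: sample_test_def)
qed

text \<open>Candidate sets may contain indices beyond the order of the matrix; the submatrix ignores
  them.\<close>

lemma minor_le_maxdet: "psd n A \<Longrightarrow> minor A S \<le> maxdet A"
proof -
  assume A: "psd n A"
  have "filter (\<lambda>i. i \<in> S \<inter> {..<n}) [0..<n] = filter (\<lambda>i. i \<in> S) [0..<n]" by (rule filter_cong) auto
  then have "minor A S = minor A (S \<inter> {..<n})"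
    unfolding minor_def submatrix_eq_list_mat[OF psd_carrier[OF A]] by simp
  then show ?thesis using maxdet_attained(2)[OF A, of "S \<inter> {..<n}"] by simp
qed

lemma sampler_gives_RP:
  fixes lam_c lam_s p :: real
  assumes hard: "NP_hard_promise (gap_detmax (\<lambda>n. 2 powr (lam_s * real n)) (\<lambda>n. 2 powr (lam_c * real n)))"
    and p: "p > 0" "lam_s < lam_c - 1 / p"
    and sampler: "polytime_sampler (edpp p) (1 / 3)"
  shows "NP_class \<subseteq> RP_class"
proof
  let ?Q = "gap_detmax (\<lambda>n. 2 powr (lam_s * real n)) (\<lambda>n. 2 powr (lam_c * real n))"
  fix L assume "L \<in> NP_class"
  from bspec[OF hard[unfolded NP_hard_promise_def] this]
  obtain f where f: "polytime1 f" and red: "\<forall>y. (y \<in> L \<longrightarrow> f y \<in> fst ?Q) \<and> (y \<notin> L \<longrightarrow> f y \<in> snd ?Q)"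
    by (elim exE conjE)
  have yes: "\<exists>A n. f y = enc_mat A \<and> psd n A \<and> maxdet A \<ge> 2 powr (lam_c * real n)" if "y \<in> L" for y
    using red[THEN spec, of y] that unfolding gap_detmax_def fst_conv snd_conv by simp
  have no: "\<exists>A n. f y = enc_mat A \<and> psd n A \<and> maxdet A < 2 powr (lam_s * real n)" if "y \<notin> L" for y
    using red[THEN spec, of y] that unfolding gap_detmax_def fst_conv snd_conv by simp
  have fp: "f y \<in> psd_words" for y using yes[of y] no[of y] unfolding psd_words_def by blast
  obtain c P and q :: "nat poly" and g where sam: "\<forall>n A. psd n A \<longrightarrow>
     (let R = bit_words (poly q (wsize (enc_mat A)));
          D = map_pmf (\<lambda>r. word_subset (g A r)) (pmf_of_set R)
      in (\<forall>r \<in> R. runs_within no_help c [enc_mat A, r] (g A r) P) \<and>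
         set_pmf D \<subseteq> Pow {..<n} \<and>
         tv_dist (Pow {..<n}) (pmf D) (edpp p A) \<le> 1 / 3)"
    using sampler unfolding polytime_sampler_def by (elim exE)
  define h where "h e r = g (decoded e) r" for e r
  have hc: "poly_comp {no_help} {[e, r] | e r. e \<in> psd_words \<and> r \<in> bit_words (poly q (wsize e))} (\<lambda>H ws. h (ws ! 0) (ws ! 1))"
  proof (rule poly_comp_runs[of _ c _ P])
    fix ws assume "ws \<in> {[e, r] | e r. e \<in> psd_words \<and> r \<in> bit_words (poly q (wsize e))}"
    then obtain A n r where ws: "ws = [enc_mat A, r]" "psd n A" "r \<in> bit_words (poly q (wsize (enc_mat A)))"
      unfolding psd_words_def by blast
    then show "runs_within no_help c ws (h (ws ! 0) (ws ! 1)) P"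
      using sam unfolding Let_def by (simp add: h_def decoded_enc[OF ws(2)])
  qed
  obtain b where b: "b \<in> \<rat>" "2 powr lam_s < b" "b < 2 powr (lam_c - 1 / p)"
    using Rats_dense_in_real[of "2 powr lam_s" "2 powr (lam_c - 1 / p)"] p(2) by auto
  obtain u v :: int where uv: "v > 0" "b = real_of_int u / real_of_int v"
    using Rats_cases'[OF b(1)] by metis
  have b0: "b > 0" using b(2) by (rule less_trans[rotated]) simp
  let ?d = "2 * b powr p / 2 powr (lam_c * p)"
  \<comment> \<open>The upper limit for b is chosen so that b^p falls below half of 2^(lam_c p);
    hence the base \<open>?d\<close> of the bound on the small minors is below 1.\<close>
  have "b powr p < (2 powr (lam_c - 1 / p)) powr p" using b(3) b0 p(1) by (intro powr_less_mono2) auto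
  also have "\<dots> = 2 powr ((lam_c - 1 / p) * p)" by (rule powr_powr)
  also have "(lam_c - 1 / p) * p = lam_c * p - 1" using p(1) by (simp add: left_diff_distrib)
  also have "2 powr (lam_c * p - 1) = 2 powr (lam_c * p) / 2" by (simp add: powr_diff)
  finally have d: "0 \<le> ?d" "?d < 1" by (simp_all add: field_simps)
  \<comment> \<open>From order n0 on the small minors have mass at most 1/6. For smaller orders all
    index sets are among the constantly many subsets of {..<n0}.\<close>
  obtain n0 where n0: "?d ^ n0 < 1 / 6" using real_arch_pow_inv[of "1 / 6" ?d] d by auto
  have small: "?d ^ n \<le> 1 / 6" if "n0 \<le> n" for n
    using power_decreasing[OF that, of ?d] d n0 by linarith
  define cs where "cs = map (map int) (subseqs [0..<n0])"
  have cs: "\<exists>w \<in> set cs. word_subset w = S" if "S \<subseteq> {..<n0}" for S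
  proof -
    have "S \<in> set ` set (subseqs [0..<n0])" unfolding subseqs_powset using that by auto
    then obtain xs where "xs \<in> set (subseqs [0..<n0])" "S = set xs" by blast
    then show ?thesis by (intro bexI[of _ "map int xs"]) (auto simp: cs_def word_subset_def)
  qed
  obtain Pf :: "nat poly" where Pf: "\<And>x. wsize (f x) \<le> poly Pf (wsize x)"
  proof -
    have "poly_comp {no_help} (args 1) (\<lambda>H ws. f (ws ! 0))" by (rule poly_comp_polytime1[OF f]) simp
    from poly_comp_wsize[OF this, of no_help]
    obtain Pf :: "nat poly" where Pf: "\<forall>ws \<in> args 1. wsize (f (ws ! 0)) \<le> poly Pf (isz ws)" by (auto simp: poly_bounded_def)
    have "wsize (f x) \<le> poly Pf (wsize x)" for x using bspec[OF Pf, of "[x]"] by simp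
    then show thesis by (rule that)
  qed
  \<comment> \<open>The composed polynomial bounds the number of bits used on f x in terms of the
    size of x, as \<open>prob_take_bit_words\<close> requires.\<close>
  let ?V = "sample_test u v cs f h q" and ?q = "pcompose q Pf"
  have qle: "poly q (wsize (f x)) \<le> poly ?q (wsize x)" for x
    unfolding poly_pcompose by (rule poly_nat_mono[OF Pf])
  have pos: "measure_pmf.prob (pmf_of_set (bit_words (poly ?q (wsize x)))) {r. ?V x r = [1]} \<ge> 1 / 2" if x: "x \<in> L" for x
  proof -
    obtain A n where A: "f x = enc_mat A" "psd n A" "maxdet A \<ge> 2 powr (lam_c * real n)" using yes[OF x] by blast
    let ?M = "poly ?q (wsize x)" and ?m = "poly q (wsize (f x))"
    have th: "threshold u v (f x) w = 1" if "minor A (word_subset w) \<ge> b ^ n" for w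
      unfolding A(1) threshold_eq[OF A(2) uv(1)] using that uv(2) by simp
    show ?thesis
    proof (cases "n0 \<le> n")
      \<comment> \<open>A set attaining the maximum is itself among the candidates, so the test
        accepts with every random string.\<close>
      case False
      obtain S where S: "S \<subseteq> {..<n}" "minor A S = maxdet A" using maxdet_attained(1)[OF A(2)] by blast
      have "S \<subseteq> {..<n0}" using S(1) False by auto
      then obtain w where w: "w \<in> set cs" "word_subset w = S" using cs by blast
      have "b < 2 powr lam_c"
        by (rule less_le_trans[OF b(3)]) (use p(1) in simp)
      then have "b ^ n \<le> (2 powr lam_c) ^ n" using b0 by (intro power_mono) auto
      also have "\<dots> = 2 powr (lam_c * real n)" by (simp add: powr_realpow[symmetric] powr_powr)
      finally have "minor A (word_subset w) \<ge> b ^ n" using A(3) S(2) w(2) by simp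
      from th[OF this] w(1) have "?V x r = [1]" for r by (intro sample_test_accepts[of u v f x w]) auto
      then show ?thesis by simp
    next
      case True
      let ?R = "bit_words ?m"
      let ?D = "map_pmf (\<lambda>r. word_subset (g A r)) (pmf_of_set ?R)"
      have D: "set_pmf ?D \<subseteq> Pow {..<n}" "tv_dist (Pow {..<n}) (pmf ?D) (edpp p A) \<le> 1 / 3"
        using sam A(2) unfolding A(1) Let_def by auto
      let ?X = "{r. minor A (word_subset (g A r)) \<ge> b ^ n}"
      have "1 / 2 \<le> measure_pmf.prob ?D {S. minor A S \<ge> b ^ n}"
        by (rule sampler_finds_large_minor[OF A(2) p(1) b0 A(3) small[OF True] D])
      also have "\<dots> = measure_pmf.prob (pmf_of_set ?R) ?X" by (simp add: vimage_def)
      also have "\<dots> = measure_pmf.prob (pmf_of_set (bit_words ?M)) {r. take ?m r \<in> ?X}"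
        by (rule prob_take_bit_words[OF qle, symmetric])
      \<comment> \<open>Restricting to genuine bit strings is harmless for the probability, and on
        them clipping is just taking the prefix.\<close>
      also have "\<dots> = measure_pmf.prob (pmf_of_set (bit_words ?M)) ({r. take ?m r \<in> ?X} \<inter> bit_words ?M)"
        using measure_Int_set_pmf[of "pmf_of_set (bit_words ?M)" "{r. take ?m r \<in> ?X}"] by simp
      also have "\<dots> \<le> measure_pmf.prob (pmf_of_set (bit_words ?M)) {r. ?V x r = [1]}"
      proof (rule measure_pmf.finite_measure_mono)
        show "{r. take ?m r \<in> ?X} \<inter> bit_words ?M \<subseteq> {r. ?V x r = [1]}"
        proof
          fix r assume r: "r \<in> {r. take ?m r \<in> ?X} \<inter> bit_words ?M"
          then have cl: "clip_bits ?m r = take ?m r" by (intro clip_bits_take[OF _ qle]) simp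
          have "h (f x) (clip_bits ?m r) = g A (take ?m r)"
            unfolding cl h_def unfolding A(1) decoded_enc[OF A(2)] ..
          then have "threshold u v (f x) (h (f x) (clip_bits ?m r)) = 1" using r by (intro th) simp
          then show "r \<in> {r. ?V x r = [1]}" by (simp add: sample_test_accepts)
        qed
      qed simp
      finally show ?thesis .
    qed
  qed
  have neg: "?V x r \<noteq> [1]" if x: "x \<notin> L" for x r
  proof -
    obtain A n where A: "f x = enc_mat A" "psd n A" "maxdet A < 2 powr (lam_s * real n)" using no[OF x] by blast
    \<comment> \<open>On a no instance every set fails, whether sampled or constant, since all
      minors lie below 2^(lam_s n) \<le> b^n; so rejection is certain.\<close>
    have "threshold u v (f x) w = 0" for w
    proof -
      have "minor A (word_subset w) < 2 powr (lam_s * real n)" using minor_le_maxdet[OF A(2)] A(3) by (rule le_less_trans)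
      also have "\<dots> = (2 powr lam_s) ^ n" by (simp add: powr_realpow[symmetric] powr_powr)
      also have "\<dots> \<le> b ^ n" using b(2) by (intro power_mono) auto
      finally show ?thesis unfolding A(1) threshold_eq[OF A(2) uv(1)] using uv(2) by simp
    qed
    then show ?thesis by (simp add: sample_test_def)
  qed
  show "L \<in> RP_class" unfolding RP_class_def
    using polytime_sample_test[OF f fp hc] pos neg
    by (intro CollectI exI[of _ ?V] exI[of _ ?q] conjI allI impI ballI) auto
qed

theorem theorem4p1:
  fixes lam_c lam_s :: real
  assumes "lam_s < lam_c"
    and "NP_hard_promise (gap_detmax (\<lambda>n. 2 powr (lam_s * real n)) (\<lambda>n. 2 powr (lam_c * real n)))"
  shows "\<forall>p :: real. p > 1 / (lam_c - lam_s) \<longrightarrow>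
    NP_hard_to_approximate (Zp p) (\<lambda>n. 2 powr (((lam_c - lam_s) * p - 1) * real n)) \<and>
    (RP_class \<noteq> NP_class \<longrightarrow> \<not> polytime_sampler (edpp p) (1 / 3))"
proof (intro allI impI conjI)
  fix p :: real assume p: "p > 1 / (lam_c - lam_s)"
  have gap: "lam_c - lam_s > 0" using assms(1) by simp
  have p0: "p > 0" using p gap by (meson less_trans zero_less_divide_1_iff)
  \<comment> \<open>The hypothesis on p says exactly that 2^lam_s < 2^(lam_c - 1/p), which leaves
    room for the rational b.\<close>
  have "1 / p < lam_c - lam_s" using p p0 gap by (simp add: field_simps)
  then have gap': "lam_s < lam_c - 1 / p" by simp
  show "NP_hard_to_approximate (Zp p) (\<lambda>n. 2 powr (((lam_c - lam_s) * p - 1) * real n))"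
    by (rule hard_to_approximate[OF assms(2) p0])
  assume "RP_class \<noteq> NP_class"
  then show "\<not> polytime_sampler (edpp p) (1 / 3)"
    using sampler_gives_RP[OF assms(2) p0 gap'] RP_subset_NP by blast
qed

end
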